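(* Let $\boldsymbol X=A\times_{\max}\boldsymbol Z$ be a recursive max-linear (ML) vector satisfying assumptions (A1)-(A3) of the context, and let $\boldsymbol X_1,\dots,\boldsymbol X_n$ be i.i.d. copies of $\boldsymbol X$. Choose $k=k(n)$ such that $k=o(n)$ and $k\to\infty$ as $n\to\infty$. Let $S_M$ be the vector of squared scalings and $\hat S_M$ its estimator as defined in the context. Assume that for every $\boldsymbol h_i\subset\{1,\dots,d\}$ such that $S_{M_{\boldsymbol h_i}}=\sigma^2_{M_{\boldsymbol h_i}}$ is a component of $S_M$, the function $f(\boldsymbol\omega)=d\bigvee_{j\in\boldsymbol h_i}\omega_j^2$ satisfies $\mathrm{Var}_{\tilde H_{\boldsymbol X}}(f(\boldsymbol\omega))>0$ and $$\lim_{n\to\infty}\sqrt k\Big(\frac nk\,\mathbb E\big[f(\boldsymbol\omega_1)\mathbf 1\{R_1\ge b_{\lfloor n/k\rfloor}t^{-1/2}\}\big]-\mathbb E_{\tilde H_{\boldsymbol X}}[f(\boldsymbol\omega_1)]\,\frac nk\,\bar F\big(b_{\lfloor n/k\rfloor}t^{-1/2}\big)\Big)=0$$ locally uniformly for $t\in[0,\infty)$. Then $$\sqrt k(\hat S_M-S_M)\xrightarrow{\ \mathcal D\ }N(0,W_M),\qquad n\to\infty,$$ where the entries of the covariance matrix $W_M$ are given by the right-hand sides of the following two limits. The diagonal entries satisfy, for $\boldsymbol h\subset\{1,\dots,d\}$ indexing a component of $S_M$, $$\lim_{n\to\infty}k\,\mathrm{Var}(\hat S_{M_{\boldsymbol h}})=d^2\,\mathrm{Var}_{\tilde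 H_{\boldsymbol X}}\Big(\bigvee_{i\in\boldsymbol h}\omega_i^2\Big),$$ and the non-diagonal entries, for two different such sets $\boldsymbol h_i\ne\boldsymbol h_j$, are given by $$\lim_{n\to\infty}k\,\mathrm{Cov}(\hat S_{M_{\boldsymbol h_i}},\hat S_{M_{\boldsymbol h_j}})=\frac{d^2}2\Big(\mathrm{Var}_{\tilde H_{\boldsymbol X}}\Big(\bigvee_{k\in\boldsymbol h_i}\omega_k^2+\bigvee_{l\in\boldsymbol h_j}\omega_l^2\Big)-\mathrm{Var}_{\tilde H_{\boldsymbol X}}\Big(\bigvee_{k\in\boldsymbol h_i}\omega_k^2\Big)-\mathrm{Var}_{\tilde H_{\boldsymbol X}}\Big(\bigvee_{l\in\boldsymbol h_j}\omega_l^2\Big)\Big).$$ Moreover, the covariance matrix $W_M$ is singular.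
   Context: Recursive ML vector. Let $\mathcal D=(V,E)$ be a DAG with nodes $V=\{1,\dots,d\}$; $\mathrm{pa}(i)$ are the parents of $i$, $\mathrm{an}(i)$ the ancestors of $i$ (not including $i$), $\mathrm{An}(i)=\mathrm{an}(i)\cup\{i\}$. An innovations vector $\boldsymbol Z=(Z_1,\dots,Z_d)$ has independent, atom-free components with support $\mathbb R_+$. Given edge weights $c_{ik}>0$ for $k\in\mathrm{pa}(i)\cup\{i\}$, define $X_i=\bigvee_{k\in\mathrm{pa}(i)}c_{ik}X_k\vee c_{ii}Z_i$. For a path $p=[j\to k_1\to\cdots\to k_l=i]$ put $d(p)=c_{jj}c_{k_1j}\cdots c_{ik_{l-1}}$; let $a_{ij}=\max_p d(p)$ over all paths from $j$ to $i$ if $j\in\mathrm{an}(i)$, $a_{ii}=c_{ii}$, and $a_{ij}=0$ if $j\notin\mathrm{An}(i)$. Then $X_i=\bigvee_{j=1}^d a_{ij}Z_j$, written $\boldsymbol X=A\times_{\max}\boldsymbol Z$; $\boldsymbol X$ is called a recursive ML vector and $A=(a_{ij})$ its ML coefficient matrix. Regular variation. $\boldsymbol Y\in\mathbb R^d_+$ is in $RV^d_+(2)$ (with normalizing sequence $b_n=\sqrt n$ and the Euclidean norm) if, for $R=\|\boldsymbol Y\|_2$ and $\boldsymbol\omega=\boldsymbol Y/R$, $n\mathbb P[(R/b_n,\boldsymbol\omega)\in\cdot]\to\nu_2\times H_{\boldsymbol Y}$ vaguely on $(0,\infty]\times\Theta_+^{d-1}$, where $d\nu_2(x)=2x^{-3}dx$,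 $\Theta_+^{d-1}=\{\boldsymbol\omega\in\mathbb R_+^d:\|\boldsymbol\omega\|_2=1\}$ and $H_{\boldsymbol Y}$ is a finite (spectral) measure. $\tilde H_{\boldsymbol Y}=H_{\boldsymbol Y}/H_{\boldsymbol Y}(\Theta_+^{d-1})$; $\mathbb E_{\tilde H_{\boldsymbol Y}}$, $\mathrm{Var}_{\tilde H_{\boldsymbol Y}}$ are expectation and variance when $\boldsymbol\omega\sim\tilde H_{\boldsymbol Y}$. Assumptions. (A1) $\boldsymbol Z\in RV^d_+(2)$ has independent and standardized components: $n\mathbb P(n^{-1/2}Z_i>x)\to x^{-2}$ for all $x>0$ and all $i$. (A2) The norm is the Euclidean norm. (A3) $A$ is standardized, i.e. $a_{ij}$ is replaced by $a_{ij}/(\sum_{k=1}^da_{ik}^2)^{1/2}$, so that every row of $A$ has Euclidean norm $1$. Scalings. For $Y\in RV^1_+(2)$ the squared scaling is $\sigma_Y^2=\lim_{n\to\infty}n\mathbb P(Y>\sqrt n)$. For nonempty $\boldsymbol h\subseteq\{1,\dots,d\}$, $M_{\boldsymbol h}=\max_{i\in\boldsymbol h}X_i$, and $\sigma_i^2=\sigma_{X_i}^2=\sigma^2_{M_{\{i\}}}$. Put $$S_M=(\sigma^2_{M_{1,2,\dots,d}},\sigma^2_{M_{1,3,\dots,d}},\dots,\sigma^2_{M_{1,d}},\sigma_1^2,\ \sigma^2_{M_{2,3,\dots,d}},\sigma^2_{M_{2,4,\dots,d}},\dots,\sigma^2_{M_{2,d}},\sigma_2^2,\ \dots,\ \sigma^2_{M_{d-1,d}},\sigma^2_{d-1},\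 \sigma_d^2)^\top\in\mathbb R_+^{d(d+1)/2},$$ with components written $S_{M_{\boldsymbol h}}=\sigma^2_{M_{\boldsymbol h}}$. Estimators. $R_\ell=\|\boldsymbol X_\ell\|_2$, $\boldsymbol\omega_\ell=(\omega_{\ell1},\dots,\omega_{\ell d})=\boldsymbol X_\ell/R_\ell$, $R^{(k)}$ is the $k$-th largest among $R_1,\dots,R_n$, $F$ is the distribution function of $R_1$, $\bar F=1-F$, and $$\hat S_{M_{\boldsymbol h}}=\hat\sigma^2_{M_{\boldsymbol h}}=\frac dk\sum_{\ell=1}^n\bigvee_{j\in\boldsymbol h}\omega_{\ell j}^2\,\mathbf 1\{R_\ell\ge R^{(k)}\}$$ (for $\boldsymbol h=\{i\}$ this is $\hat\sigma_i^2$). $\hat S_M$ is obtained from $S_M$ by replacing each component by its estimator. *)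

theory Defs
  imports "HOL-Probability.Probability"
begin

(* The nodes 1, ..., d are the elements of a finite linearly ordered type 'd, with d = CARD('d).
   The order only fixes which subsets of nodes occur in the vector of scalings below; it is not
   required to be compatible with the edges. *)

(* (k, i) \<in> E is the edge k \<rightarrow> i, and c i k is the weight of that edge (c i i that of Z_i). *)

definition pa :: "('d \<times> 'd) set \<Rightarrow> 'd \<Rightarrow> 'd set" where
  "pa E i = {k. (k, i) \<in> E}"

definition an :: "('d \<times> 'd) set \<Rightarrow> 'd \<Rightarrow> 'd set" where
  "an E i = {j. (j, i) \<in> E\<^sup>+}"

definition paths :: "('d \<times> 'd) set \<Rightarrow> 'd \<Rightarrow> 'd \<Rightarrow> 'd list set" where
  "paths E j i = {p. 2 \<le> length p \<and> hd p = j \<and> last p = i \<and> successively (\<lambda>u v. (u, v) \<in> E) p}"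

definition path_weight :: "('d \<Rightarrow> 'd \<Rightarrow> real) \<Rightarrow> 'd list \<Rightarrow> real" where
  "path_weight c p = c (hd p) (hd p) * (\<Prod>m<length p - 1. c (p ! Suc m) (p ! m))"

(* The entry a_ij is ml_coeff E c $ i $ j. The set of paths is finite because E is acyclic. *)
definition ml_coeff :: "('d \<times> 'd) set \<Rightarrow> ('d \<Rightarrow> 'd \<Rightarrow> real) \<Rightarrow> real ^ 'd ^ 'd" where
  "ml_coeff E c = (\<chi> i j. if j = i then c i i
                          else if j \<in> an E i then Max (path_weight c ` paths E j i)
                          else 0)"

definition law_support :: "'b::topological_space measure \<Rightarrow> 'b set" where
  "law_support \<mu> = {x. \<forall>U. open U \<and> x \<in> U \<longrightarrow> 0 < emeasure \<mu> U}"

definition innovations :: "'a measure \<Rightarrow> ('a \<Rightarrow> real ^ 'd) \<Rightarrow> bool" where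
  "innovations M Z \<longleftrightarrow>
     prob_space.indep_vars M (\<lambda>_. borel) (\<lambda>i x. Z x $ i) UNIV \<and>
     (\<forall>i z. measure M {x \<in> space M. Z x $ i = z} = 0) \<and>
     (\<forall>i. law_support (distr M borel (\<lambda>x. Z x $ i)) = {0..})"

definition recursive_ml ::
  "'a measure \<Rightarrow> ('d \<times> 'd) set \<Rightarrow> ('d \<Rightarrow> 'd \<Rightarrow> real) \<Rightarrow> ('a \<Rightarrow> real ^ 'd) \<Rightarrow> ('a \<Rightarrow> real ^ 'd) \<Rightarrow> bool"
  where
  "recursive_ml M E c Z X \<longleftrightarrow>
     acyclic E \<and>
     (\<forall>i. \<forall>k \<in> pa E i \<union> {i}. 0 < c i k) \<and>
     innovations M Z \<and>
     (\<forall>x \<in> space M. \<forall>i.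
        X x $ i = Max (insert (c i i * Z x $ i) ((\<lambda>k. c i k * X x $ k) ` pa E i)))"

definition vague_conv_on ::
  "'b::topological_space set \<Rightarrow> (nat \<Rightarrow> 'b measure) \<Rightarrow> 'b measure \<Rightarrow> bool" where
  "vague_conv_on S \<mu>s \<mu> \<longleftrightarrow>
     (\<forall>(g :: 'b \<Rightarrow> real) K. compact K \<and> K \<subseteq> S \<and> continuous_on S g \<and> (\<forall>x. x \<notin> K \<longrightarrow> g x = 0)
        \<longrightarrow> (\<lambda>n. \<integral>x. g x \<partial>\<mu>s n) \<longlonglongrightarrow> (\<integral>x. g x \<partial>\<mu>))"

definition pos_sphere :: "(real ^ 'd::finite) set" where
  "pos_sphere = {w. (\<forall>i. 0 \<le> w $ i) \<and> norm w = 1}"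

definition angle :: "real ^ 'd::finite \<Rightarrow> real ^ 'd" where
  "angle y = (1 / norm y) *\<^sub>R y"

definition nu2 :: "ereal measure" where
  "nu2 = distr (density lborel (\<lambda>x::real. ennreal (2 / x ^ 3) * indicator {0<..} x)) borel ereal"

(* The radial component lives in ereal, since relatively compact sets of (0, \<infinity>] \<times> pos_sphere are
   bounded away from 0 but may contain \<infinity>. *)
definition spectral_measure_of :: "'a measure \<Rightarrow> ('a \<Rightarrow> real ^ 'd::finite) \<Rightarrow> (real ^ 'd) measure \<Rightarrow> bool"
  where
  "spectral_measure_of M Y H \<longleftrightarrow>
     sets H = sets borel \<and> finite_measure H \<and> emeasure H (- pos_sphere) = 0 \<and>
     vague_conv_on ({0<..} \<times> pos_sphere)
       (\<lambda>n. scale_measure (of_nat n)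
              (distr M borel (\<lambda>x. (ereal (norm (Y x) / sqrt (real n)), angle (Y x)))))
       (nu2 \<Otimes>\<^sub>M H)"

definition RV2 :: "'a measure \<Rightarrow> ('a \<Rightarrow> real ^ 'd::finite) \<Rightarrow> bool" where
  "RV2 M Y \<longleftrightarrow> Y \<in> borel_measurable M \<and> (AE x in M. \<forall>i. 0 \<le> Y x $ i) \<and> (\<exists>H. spectral_measure_of M Y H)"

(* The vague limit determines H uniquely. *)
definition spectral_measure :: "'a measure \<Rightarrow> ('a \<Rightarrow> real ^ 'd::finite) \<Rightarrow> (real ^ 'd) measure" where
  "spectral_measure M Y = (THE H. spectral_measure_of M Y H)"

definition norm_spectral_measure :: "'a measure \<Rightarrow> ('a \<Rightarrow> real ^ 'd::finite) \<Rightarrow> (real ^ 'd) measure" where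
  "norm_spectral_measure M Y =
     scale_measure (1 / emeasure (spectral_measure M Y) pos_sphere) (spectral_measure M Y)"

definition standardized_innovations :: "'a measure \<Rightarrow> ('a \<Rightarrow> real ^ 'd::finite) \<Rightarrow> bool" where
  "standardized_innovations M Z \<longleftrightarrow>
     RV2 M Z \<and>
     (\<forall>i. \<forall>z>0. (\<lambda>n. real n * measure M {x \<in> space M. Z x $ i / sqrt (real n) > z})
                   \<longlonglongrightarrow> 1 / z\<^sup>2)"

definition standardized_matrix :: "real ^ 'd::finite ^ 'd \<Rightarrow> bool" where
  "standardized_matrix A \<longleftrightarrow> (\<forall>i. sqrt (\<Sum>k\<in>UNIV. (A $ i $ k)\<^sup>2) = 1)"

definition sq_scaling :: "'a measure \<Rightarrow> ('a \<Rightarrow> real) \<Rightarrow> real" where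
  "sq_scaling M Y = lim (\<lambda>n. real n * measure M {x \<in> space M. Y x > sqrt (real n)})"

(* Node sets {i} \<union> {j, ..., d} with i < j \<le> d + 1, where j = d + 1 yields {i}. *)
definition scaling_sets :: "'d::linorder set set" where
  "scaling_sets = {insert i {j..} | i j. i < j} \<union> {{i} | i. True}"

(* Index type for the components of S_M, so that S_M is an element of a Euclidean space
   of dimension d (d + 1) / 2. *)
typedef (overloaded) ('d::"{finite,linorder}") scaling_index = "scaling_sets :: 'd set set"
  morphisms index_set Abs_scaling_index
  by (auto simp: scaling_sets_def)

instance scaling_index :: ("{finite,linorder}") finite
proof
  have "finite (index_set ` (UNIV :: 'a scaling_index set))"
    by (rule finite_subset[of _ "UNIV :: 'a set set"]) auto
  then show "finite (UNIV :: 'a scaling_index set)"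
    by (rule finite_imageD) (simp add: inj_on_def index_set_inject)
qed

definition max_over :: "'d set \<Rightarrow> real ^ 'd::finite \<Rightarrow> real" where
  "max_over h y = Max ((\<lambda>j. y $ j) ` h)"

definition max_sq :: "'d set \<Rightarrow> real ^ 'd::finite \<Rightarrow> real" where
  "max_sq h w = Max ((\<lambda>j. (w $ j)\<^sup>2) ` h)"

definition S_M :: "'a measure \<Rightarrow> ('a \<Rightarrow> real ^ 'd::{finite,linorder}) \<Rightarrow> real ^ 'd scaling_index" where
  "S_M M X = (\<chi> q. sq_scaling M (\<lambda>x. max_over (index_set q) (X x)))"

(* k-th largest of R_1, ..., R_n, meaningful for 1 \<le> k \<le> n. *)
definition kth_largest :: "nat \<Rightarrow> nat \<Rightarrow> (nat \<Rightarrow> real) \<Rightarrow> real" where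
  "kth_largest n k R = rev (sort (map R [1..<Suc n])) ! (k - 1)"

definition scaling_est :: "(nat \<Rightarrow> 'a \<Rightarrow> real ^ 'd::finite) \<Rightarrow> nat \<Rightarrow> nat \<Rightarrow> 'd set \<Rightarrow> 'a \<Rightarrow> real" where
  "scaling_est Xs n k h x =
     real CARD('d) / real k *
       (\<Sum>l=1..n. max_sq h (angle (Xs l x)) *
          of_bool (norm (Xs l x) \<ge> kth_largest n k (\<lambda>m. norm (Xs m x))))"

definition S_M_est ::
  "(nat \<Rightarrow> 'a \<Rightarrow> real ^ 'd::{finite,linorder}) \<Rightarrow> nat \<Rightarrow> nat \<Rightarrow> 'a \<Rightarrow> real ^ 'd scaling_index" where
  "S_M_est Xs n k x = (\<chi> q. scaling_est Xs n k (index_set q) x)"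

definition W_M :: "'a measure \<Rightarrow> ('a \<Rightarrow> real ^ 'd::{finite,linorder})
    \<Rightarrow> real ^ 'd scaling_index ^ 'd scaling_index" where
  "W_M M X = (let Var = prob_space.variance (norm_spectral_measure M X); d = real CARD('d) in
     (\<chi> p q.
        if p = q then d\<^sup>2 * Var (max_sq (index_set p))
        else d\<^sup>2 / 2 *
          (Var (\<lambda>w. max_sq (index_set p) w + max_sq (index_set q) w)
           - Var (max_sq (index_set p)) - Var (max_sq (index_set q)))))"

definition covar :: "'a measure \<Rightarrow> ('a \<Rightarrow> real) \<Rightarrow> ('a \<Rightarrow> real) \<Rightarrow> real" where
  "covar M U V = (\<integral>x. (U x - (\<integral>y. U y \<partial>M)) * (V x - (\<integral>y. V y \<partial>M)) \<partial>M)"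

definition conv_in_distr ::
  "'a measure \<Rightarrow> (nat \<Rightarrow> 'a \<Rightarrow> 'b::metric_space) \<Rightarrow> 'b measure \<Rightarrow> bool" where
  "conv_in_distr M Y N \<longleftrightarrow>
     (\<forall>g :: 'b \<Rightarrow> real. continuous_on UNIV g \<and> bounded (range g)
        \<longrightarrow> (\<lambda>n. \<integral>x. g (Y n x) \<partial>M) \<longlonglongrightarrow> (\<integral>y. g y \<partial>N))"

(* Defined through the characteristic function, so that degenerate normal laws are included. *)
definition is_normal :: "(real ^ 'm) measure \<Rightarrow> real ^ 'm \<Rightarrow> real ^ 'm ^ 'm \<Rightarrow> bool" where
  "is_normal N m W \<longleftrightarrow>
     prob_space N \<and> sets N = sets borel \<and> transpose W = W \<and>
     (\<forall>u. (\<integral>y. exp (\<i> * complex_of_real (u \<bullet> y)) \<partial>N)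
            = exp (\<i> * complex_of_real (u \<bullet> m) - complex_of_real (u \<bullet> (W *v u)) / 2))"

definition iid_copies :: "'a measure \<Rightarrow> ('a \<Rightarrow> real ^ 'd::finite) \<Rightarrow> (nat \<Rightarrow> 'a \<Rightarrow> real ^ 'd) \<Rightarrow> bool" where
  "iid_copies M X Xs \<longleftrightarrow>
     prob_space.indep_vars M (\<lambda>_. borel) Xs {1..} \<and>
     (\<forall>l\<ge>1. distr M borel (Xs l) = distr M borel X)"

(* The threshold b_m t^(-1/2) with b_m = sqrt m; it equals \<infinity> at t = 0 for m \<ge> 1. *)
definition threshold :: "nat \<Rightarrow> real \<Rightarrow> ereal" where
  "threshold m t = ereal (sqrt (real m)) / ereal (sqrt t)"

(* One minus the distribution function, extended to \<infinity>. *)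
definition surv :: "'a measure \<Rightarrow> ('a \<Rightarrow> real) \<Rightarrow> ereal \<Rightarrow> real" where
  "surv M R u = 1 - measure M {x \<in> space M. ereal (R x) \<le> u}"

(* The centred tail expectation assumed to vanish locally uniformly in t; X1 stands for X_1,
   Ht for the normalized spectral measure. *)
definition tail_bias ::
  "'a measure \<Rightarrow> ('a \<Rightarrow> real ^ 'd::finite) \<Rightarrow> (real ^ 'd) measure \<Rightarrow> (real ^ 'd \<Rightarrow> real)
     \<Rightarrow> nat \<Rightarrow> nat \<Rightarrow> real \<Rightarrow> real" where
  "tail_bias M X1 Ht f n k t =
     sqrt (real k) *
       (real n / real k *
          (\<integral>x. f (angle (X1 x)) * of_bool (ereal (norm (X1 x)) \<ge> threshold (n div k) t) \<partial>M)
        - (\<integral>w. f w \<partial>Ht) * (real n / real k) * surv M (\<lambda>x. norm (X1 x)) (threshold (n div k) t))"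

end

theory Submission
  imports Defs
begin

text \<open>
  Given the observation with the \<open>k\<close>-th largest norm, the \<open>k - 1\<close> observations above it are independent with
  the law of \<open>X\<close> conditioned on a larger norm. Summing over the index of the \<open>k\<close>-th largest observation and
  the set of indices above it turns the expectation of any product \<open>\<Prod> \<psi>(X\<^sub>l)\<close> over the \<open>k\<close> largest
  observations into a single integral against the law of \<open>X\<close>. For \<open>\<psi> = exp (\<zeta> f / sqrt k)\<close> a second-order
  expansion shows that the integrand tends to \<open>exp (\<zeta>\<^sup>2 Var f / 2)\<close>, uniformly as long as the tail probability
  at the \<open>k\<close>-th largest norm is of order \<open>k / n\<close>: the bias assumption removes the first-order term and regular
  variation identifies the second-order one. The complementary event has probability exponentially small in
  \<open>k\<close>, which beats the trivial bound \<open>exp (C sqrt k)\<close> on the integrand.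

  Imaginary \<open>\<zeta>\<close> yields the characteristic function of the rescaled error, hence asymptotic normality. Real
  \<open>\<zeta>\<close> yields bounded moment generating functions, hence bounded fourth moments, so that variances and
  covariances converge as well.

  By independence the spectral measure of \<open>Z\<close> is the sum of the point masses at the unit vectors, and that of
  \<open>X\<close> is its weighted image under the max-linear map, a discrete measure supported by the normalized columns
  of the coefficient matrix. On the unit sphere the squared components sum to 1, so the indicator of the
  singletons lies in the kernel of \<open>W_M\<close>.
\<close>

section \<open>Max-linear representation\<close>

text \<open>The radius above which observations enter the estimator is random and depends on all of
  them. Fixing the value of the k-th largest norm first removes this dependence, and then only the
  tail probability G at that value matters. G has a beta law, and no concentration of G around k/n
  is needed: the bias assumption is uniform over compact sets of t, so every G within a constant
  factor of k/n serves equally well. The factor 8 comes from moments of the beta law. Multiplication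
  by a power of G shifts its parameters; a shift by k costs at most (2k/n)^k, and against (8k/n)^k
  this leaves 4^(-k). The lower side uses a shift by k div 2. This 8 in turn determines the interval
  [0, 16] in which the bias assumption is applied. Ties would spoil both the count k and the
  decomposition, so the norm of X is shown to have no atoms. Convergence in distribution alone says
  nothing about variances; the fourth moments supply the uniform control. Since the spectral measure
  is discrete, a normal vector with covariance \<open>W_M\<close> is a finite combination of
  independent standard normal variables.\<close>

lemma borel_measurable_vecI:
  fixes f :: "'a \<Rightarrow> real ^ 'n"
  assumes "\<And>i. (\<lambda>x. f x $ i) \<in> borel_measurable M"
  shows "f \<in> borel_measurable M"
  by (subst borel_measurable_euclidean_space) (auto simp: Basis_vec_def inner_axis assms)

definition max_linear :: "real ^ 'd ^ 'd \<Rightarrow> real ^ 'd \<Rightarrow> real ^ 'd::finite" where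
  "max_linear A z = (\<chi> i. Max (range (\<lambda>j. A $ i $ j * z $ j)))"

lemma max_linear_ge: "A $ i $ j * z $ j \<le> max_linear A z $ i"
  by (simp add: max_linear_def)

lemma max_linear_attained: obtains j where "max_linear A z $ i = A $ i $ j * z $ j"
proof -
  have "Max (range (\<lambda>j. A $ i $ j * z $ j)) \<in> range (\<lambda>j. A $ i $ j * z $ j)" by (rule Max_in) auto
  then obtain j where "Max (range (\<lambda>j. A $ i $ j * z $ j)) = A $ i $ j * z $ j" by blast
  then show ?thesis using that[of j] by (simp add: max_linear_def)
qed

lemma path_weight_single: "path_weight c [j] = c j j"
  by (simp add: path_weight_def)

lemma path_weight_snoc:
  assumes "q \<noteq> []"
  shows "path_weight c (q @ [i]) = path_weight c q * c i (last q)"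
proof -
  obtain n where n: "length q = Suc n" using assms by (cases q) auto
  have "(\<Prod>m<length (q @ [i]) - 1. c ((q @ [i]) ! Suc m) ((q @ [i]) ! m))
      = (\<Prod>m<n. c ((q @ [i]) ! Suc m) ((q @ [i]) ! m)) * c i (last q)"
    using n assms by (simp add: nth_append last_conv_nth)
  also have "(\<Prod>m<n. c ((q @ [i]) ! Suc m) ((q @ [i]) ! m)) = (\<Prod>m<n. c (q ! Suc m) (q ! m))"
    using n by (intro prod.cong) (auto simp: nth_append)
  finally show ?thesis using n assms by (simp add: path_weight_def mult.assoc)
qed

section \<open>Paths in a finite acyclic graph and the recursion for the coefficients\<close>

context
  fixes E :: "('d::finite \<times> 'd) set" and c :: "'d \<Rightarrow> 'd \<Rightarrow> real"
  assumes acyclic: "acyclic E" and pos: "\<And>i k. k \<in> pa E i \<union> {i} \<Longrightarrow> 0 < c i k"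
begin

lemma path_trancl: "p \<in> paths E j i \<Longrightarrow> (j, i) \<in> E\<^sup>+"
proof (induction p arbitrary: i rule: rev_induct)
  case (snoc x q)
  then have q: "q \<noteq> []" "hd q = j" "x = i" "successively (\<lambda>u v. (u, v) \<in> E) q" "(last q, i) \<in> E"
    by (auto simp: paths_def successively_append_iff hd_append)
  show ?case
  proof (cases "length q = 1")
    case True
    then have "q = [j]" using q by (cases q) auto
    then show ?thesis using q by auto
  next
    case False
    then have "2 \<le> length q" using q(1) by (cases q) (auto simp: Suc_le_eq)
    then have "q \<in> paths E j (last q)" using q by (auto simp: paths_def)
    then show ?thesis using snoc.IH q by (blast intro: trancl_into_trancl)
  qed
qed (simp add: paths_def)

lemma trancl_path: "(j, i) \<in> E\<^sup>+ \<Longrightarrow> \<exists>p. p \<in> paths E j i"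
proof (induction rule: trancl_induct)
  case (base y)
  then show ?case by (intro exI[of _ "[j, y]"]) (simp add: paths_def)
next
  case (step y z)
  then obtain p where "p \<in> paths E j y" by auto
  then show ?case using step
    by (intro exI[of _ "p @ [z]"]) (auto simp: paths_def successively_append_iff hd_append)
qed

text \<open>Any two positions of a walk are related by the transitive closure, so a repeated node
  would close a cycle. This bounds the length of a path and makes the maximum in
  \<open>ml_coeff\<close> a maximum over a finite set.\<close>

lemma successively_distinct: "successively (\<lambda>u v. (u, v) \<in> E) p \<Longrightarrow> distinct p"
proof -
  assume "successively (\<lambda>u v. (u, v) \<in> E) p"
  then have "successively (\<lambda>u v. (u, v) \<in> E\<^sup>+) p" by (rule successively_mono) auto
  then have "sorted_wrt (\<lambda>u v. (u, v) \<in> E\<^sup>+) p"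
    by (subst (asm) successively_conv_sorted_wrt) (auto simp: transp_def intro: trancl_trans)
  then have "(p ! m, p ! n) \<in> E\<^sup>+" if "m < n" "n < length p" for m n
    using that unfolding sorted_wrt_iff_nth_less by blast
  then have "p ! m \<noteq> p ! n" if "m < n" "n < length p" for m n
    using that acyclic unfolding acyclic_def by metis
  then show ?thesis unfolding distinct_conv_nth by (metis linorder_neqE_nat)
qed

lemma finite_paths: "finite (paths E j i)"
proof (rule finite_subset)
  show "paths E j i \<subseteq> {p. set p \<subseteq> UNIV \<and> length p \<le> CARD('d)}"
    using successively_distinct by (auto simp: paths_def) (metis card_mono distinct_card finite subset_UNIV)
  show "finite {p :: 'd list. set p \<subseteq> UNIV \<and> length p \<le> CARD('d)}" by (rule finite_lists_length_le) simp
qed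

lemma ml_coeff_diag: "ml_coeff E c $ i $ i = c i i"
  by (simp add: ml_coeff_def)

lemma ml_coeff_path_le: "p \<in> paths E j i \<Longrightarrow> path_weight c p \<le> ml_coeff E c $ i $ j"
proof -
  assume p: "p \<in> paths E j i"
  then have "(j, i) \<in> E\<^sup>+" by (rule path_trancl)
  then have "j \<noteq> i" "j \<in> an E i" using acyclic by (auto simp: acyclic_def an_def)
  then show ?thesis using p finite_paths by (simp add: ml_coeff_def)
qed

lemma ml_coeff_attained:
  assumes "j \<in> an E i"
  obtains p where "p \<in> paths E j i" "ml_coeff E c $ i $ j = path_weight c p"
proof -
  have "(j, i) \<in> E\<^sup>+" using assms by (simp add: an_def)
  then have "j \<noteq> i" "paths E j i \<noteq> {}" using acyclic trancl_path by (auto simp: acyclic_def)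
  then have "Max (path_weight c ` paths E j i) \<in> path_weight c ` paths E j i" by (intro Max_in) (auto simp: finite_paths)
  then show ?thesis using that \<open>j \<noteq> i\<close> assms by (auto simp: ml_coeff_def)
qed

text \<open>One half of the max-times recursion for the coefficients: appending the edge to an
  optimal path ending in \<open>k\<close> gives a path ending in \<open>i\<close>. The second
  alternative covers the nodes \<open>j\<close> from which \<open>k\<close> cannot be
  reached.\<close>

lemma ml_coeff_edge_le:
  assumes k: "(k, i) \<in> E"
  shows "c i k * ml_coeff E c $ k $ j \<le> ml_coeff E c $ i $ j \<or> ml_coeff E c $ k $ j = 0"
proof -
  have cik: "0 < c i k" using pos[of k i] k by (simp add: pa_def)
  consider "j = k" | "j \<noteq> k" "j \<in> an E k" | "j \<noteq> k" "j \<notin> an E k" by blast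
  then show ?thesis
  proof cases
    case 1
    then have "[k, i] \<in> paths E j i" using k by (simp add: paths_def)
    from ml_coeff_path_le[OF this] show ?thesis
      using 1 path_weight_snoc[of "[k]" c i] by (simp add: path_weight_single ml_coeff_diag mult.commute)
  next
    case 2
    obtain p where p: "p \<in> paths E j k" "ml_coeff E c $ k $ j = path_weight c p" by (rule ml_coeff_attained[OF 2(2)])
    then have "p @ [i] \<in> paths E j i" "p \<noteq> []" "last p = k" using k by (auto simp: paths_def successively_append_iff hd_append)
    then show ?thesis using ml_coeff_path_le[of "p @ [i]" j i] path_weight_snoc[of p c i] p by (simp add: mult.commute)
  next
    case 3
    then show ?thesis by (simp add: ml_coeff_def)
  qed
qed

text \<open>The other half of the recursion: cutting the last edge off an optimal path. If that edge
  is the whole path, the list \<open>[j]\<close> remains, whose weight is the diagonal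
  coefficient.\<close>

lemma ml_coeff_last_edge:
  assumes "j \<noteq> i"
  shows "ml_coeff E c $ i $ j = 0 \<or> (\<exists>k. (k, i) \<in> E \<and> ml_coeff E c $ i $ j \<le> c i k * ml_coeff E c $ k $ j)"
proof (cases "j \<in> an E i")
  case True
  then obtain p where p: "p \<in> paths E j i" "ml_coeff E c $ i $ j = path_weight c p" by (rule ml_coeff_attained)
  define q where "q = butlast p"
  have "p \<noteq> []" using p by (auto simp: paths_def)
  then have pq: "p = q @ [i]" using p append_butlast_last_id[of p] by (auto simp: paths_def q_def)
  then have q: "q \<noteq> []" "hd q = j" "successively (\<lambda>u v. (u, v) \<in> E) q" "(last q, i) \<in> E"
    using p by (auto simp: paths_def successively_append_iff hd_append)
  have cik: "0 < c i (last q)" using pos[of "last q" i] q by (simp add: pa_def)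
  have "path_weight c q \<le> ml_coeff E c $ last q $ j"
  proof (cases "length q = 1")
    case True
    then have "q = [j]" using q by (cases q) auto
    then show ?thesis by (simp add: path_weight_single ml_coeff_diag)
  next
    case False
    then have "2 \<le> length q" using q(1) by (cases q) (auto simp: Suc_le_eq)
    then show ?thesis using q by (intro ml_coeff_path_le) (auto simp: paths_def)
  qed
  then have "path_weight c p \<le> c i (last q) * ml_coeff E c $ last q $ j"
    using cik path_weight_snoc[OF q(1), of c i] pq by (simp add: mult.commute)
  then show ?thesis using p q by metis
next
  case False
  then show ?thesis using assms by (simp add: ml_coeff_def)
qed

lemma path_weight_pos: "successively (\<lambda>u v. (u, v) \<in> E) p \<Longrightarrow> p \<noteq> [] \<Longrightarrow> 0 < path_weight c p"
  unfolding path_weight_def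
proof (intro mult_pos_pos prod_pos)
  show "0 < c (hd p) (hd p)" using pos by simp
  fix m assume p: "successively (\<lambda>u v. (u, v) \<in> E) p" "m \<in> {..<length p - 1}"
  then have "(p ! m, p ! Suc m) \<in> E" by (auto simp: successively_conv_nth)
  then show "0 < c (p ! Suc m) (p ! m)" using pos by (simp add: pa_def)
qed

lemma ml_coeff_nonneg: "0 \<le> ml_coeff E c $ i $ j"
proof (cases "j \<in> an E i")
  case True
  then obtain p where p: "p \<in> paths E j i" "ml_coeff E c $ i $ j = path_weight c p" by (rule ml_coeff_attained)
  then have "successively (\<lambda>u v. (u, v) \<in> E) p" "p \<noteq> []" by (auto simp: paths_def)
  from path_weight_pos[OF this] show ?thesis using p by simp
next
  case False
  then show ?thesis using pos[of i i] by (simp add: ml_coeff_def)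
qed

lemma ml_coeff_diag_pos: "0 < ml_coeff E c $ i $ i"
  using pos by (simp add: ml_coeff_diag)

lemma wf_edges: "wf E"
  using acyclic by (intro finite_acyclic_wf) auto

text \<open>Well-founded induction along the edges; the two inequalities at \<open>i\<close> are the
  two halves of the recursion for the coefficients. Nonnegativity of \<open>z\<close> allows
  inequalities between coefficients to be multiplied by \<open>z $ j\<close> and keeps zero
  coefficients from exceeding the maximum.\<close>

lemma ml_recursion_solution:
  assumes rec: "\<And>i. X $ i = Max (insert (c i i * z $ i) ((\<lambda>k. c i k * X $ k) ` pa E i))"
    and z: "\<And>i. 0 \<le> z $ i"
  shows "X = max_linear (ml_coeff E c) z"
proof -
  have "X $ i = max_linear (ml_coeff E c) z $ i" for i
    using wf_edges
  proof (induction i rule: wf_induct_rule)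
    case (less i)
    have fin: "finite (insert (c i i * z $ i) ((\<lambda>k. c i k * X $ k) ` pa E i))" by simp
    have X0: "c i i * z $ i \<le> X $ i" unfolding rec[of i] using fin by (intro Max_ge) auto
    have X1: "c i k * X $ k \<le> X $ i" if "(k, i) \<in> E" for k
      unfolding rec[of i] using fin that by (intro Max_ge) (auto simp: pa_def)
    have ci: "0 < c i i" using pos by simp
    have ge: "ml_coeff E c $ i $ j * z $ j \<le> X $ i" for j
    proof (cases "j = i")
      case True
      then show ?thesis using X0 by (simp add: ml_coeff_diag)
    next
      case False
      from ml_coeff_last_edge[OF this] show ?thesis
      proof
        assume "ml_coeff E c $ i $ j = 0"
        moreover have "0 \<le> c i i * z $ i" using ci z by simp
        ultimately show ?thesis using X0 by simp
      next
        assume "\<exists>k. (k, i) \<in> E \<and> ml_coeff E c $ i $ j \<le> c i k * ml_coeff E c $ k $ j"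
        then obtain k where k: "(k, i) \<in> E" "ml_coeff E c $ i $ j \<le> c i k * ml_coeff E c $ k $ j" by auto
        have cik: "0 < c i k" using pos[of k i] k by (simp add: pa_def)
        have "ml_coeff E c $ i $ j * z $ j \<le> c i k * (ml_coeff E c $ k $ j * z $ j)"
          using mult_right_mono[OF k(2) z] by (simp add: mult.assoc)
        also have "\<dots> \<le> c i k * X $ k" using cik less[OF k(1)] max_linear_ge[of "ml_coeff E c" k j z] by simp
        also have "\<dots> \<le> X $ i" by (rule X1[OF k(1)])
        finally show ?thesis .
      qed
    qed
    show ?case
    proof (rule antisym)
      show "max_linear (ml_coeff E c) z $ i \<le> X $ i" using ge by (metis max_linear_attained)
      have nonneg: "0 \<le> max_linear (ml_coeff E c) z $ i"
        using max_linear_ge[of "ml_coeff E c" i i z] ml_coeff_nonneg[of i i] z[of i] by (meson mult_nonneg_nonneg order_trans)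
      have "X $ i \<in> insert (c i i * z $ i) ((\<lambda>k. c i k * X $ k) ` pa E i)" unfolding rec[of i] using fin by (intro Max_in) auto
      then show "X $ i \<le> max_linear (ml_coeff E c) z $ i"
      proof
        assume "X $ i = c i i * z $ i"
        then show ?thesis using max_linear_ge[of "ml_coeff E c" i i z] by (simp add: ml_coeff_diag)
      next
        assume "X $ i \<in> (\<lambda>k. c i k * X $ k) ` pa E i"
        then obtain k where k: "(k, i) \<in> E" "X $ i = c i k * X $ k" by (auto simp: pa_def)
        obtain j where j: "max_linear (ml_coeff E c) z $ k = ml_coeff E c $ k $ j * z $ j" by (rule max_linear_attained)
        have X: "X $ i = (c i k * ml_coeff E c $ k $ j) * z $ j" using k(2) less[OF k(1)] j by simp
        from ml_coeff_edge_le[OF k(1), of j] show ?thesis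
        proof
          assume "c i k * ml_coeff E c $ k $ j \<le> ml_coeff E c $ i $ j"
          from mult_right_mono[OF this z[of j]] show ?thesis using X max_linear_ge[of "ml_coeff E c" i j z] by simp
        next
          assume "ml_coeff E c $ k $ j = 0"
          then show ?thesis using X nonneg by simp
        qed
      qed
    qed
  qed
  then show ?thesis by (simp add: vec_eq_iff)
qed

lemma ml_recursion_measurable:
  assumes rec: "\<And>x i. x \<in> space M \<Longrightarrow> X x $ i = Max (insert (c i i * Z x $ i) ((\<lambda>k. c i k * X x $ k) ` pa E i))"
    and Z: "\<And>i. (\<lambda>x. Z x $ i) \<in> borel_measurable M"
  shows "(X :: 'a \<Rightarrow> real ^ 'd) \<in> borel_measurable M"
proof -
  have "(\<lambda>x. X x $ i) \<in> borel_measurable M" for i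
    using wf_edges
  proof (induction i rule: wf_induct_rule)
    case (less i)
    \<comment> \<open>The option type puts the innovation and the parents into one indexed family,
      as the measurability of a finite maximum requires.\<close>
    define f where "f k x = (case k of None \<Rightarrow> c i i * Z x $ i | Some k \<Rightarrow> c i k * X x $ k)" for k x
    have "(\<lambda>x. Max ((\<lambda>k. f k x) ` insert None (Some ` pa E i))) \<in> borel_measurable M"
    proof (rule borel_measurable_Max)
      fix k assume "k \<in> insert None (Some ` pa E i)"
      then show "f k \<in> borel_measurable M"
        using less Z by (auto simp: f_def[abs_def] pa_def)
    qed auto
    moreover have "X x $ i = Max ((\<lambda>k. f k x) ` insert None (Some ` pa E i))" if "x \<in> space M" for x
      using rec[OF that, of i] by (simp add: f_def image_image)
    ultimately show ?case by (simp cong: measurable_cong)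
  qed
  then show ?thesis by (rule borel_measurable_vecI)
qed

end

section \<open>Levy continuity in Euclidean space and moments\<close>

text \<open>Finite linear combinations of characters: their integrals converge by the very
  hypothesis of the continuity theorem, and they form an algebra that contains the polynomials in
  the sines of the coordinates, which is where Stone-Weierstrass enters.\<close>

inductive trig_polynomial :: "('b::real_inner \<Rightarrow> complex) \<Rightarrow> bool" where
  zero: "trig_polynomial (\<lambda>_. 0)"
| add: "trig_polynomial h \<Longrightarrow> trig_polynomial (\<lambda>x. a * iexp (u \<bullet> x) + h x)"

lemma trig_polynomial_iexp: "trig_polynomial (\<lambda>x. a * iexp (u \<bullet> x))"
  using trig_polynomial.add[OF trig_polynomial.zero, of a u] by simp

lemma trig_polynomial_const: "trig_polynomial (\<lambda>_. a)"
  using trig_polynomial_iexp[of a 0] by simp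

lemma trig_polynomial_add:
  assumes "trig_polynomial f" "trig_polynomial g"
  shows "trig_polynomial (\<lambda>x. f x + g x)"
  using assms by (induction rule: trig_polynomial.induct) (auto simp: add.assoc intro: trig_polynomial.add)

lemma trig_polynomial_cmult_iexp:
  assumes "trig_polynomial f"
  shows "trig_polynomial (\<lambda>x. b * iexp (v \<bullet> x) * f x)"
  using assms
proof induction
  case zero
  then show ?case using trig_polynomial.zero by simp
next
  case (add h a u)
  have "b * iexp (v \<bullet> x) * (a * iexp (u \<bullet> x) + h x)
      = (b * a) * iexp ((v + u) \<bullet> x) + b * iexp (v \<bullet> x) * h x" for x
    by (simp add: algebra_simps exp_add inner_add_left)
  then show ?case using trig_polynomial.add[OF add.IH, of "b * a" "v + u"] by simp
qed

lemma trig_polynomial_mult: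
  assumes "trig_polynomial f" "trig_polynomial g"
  shows "trig_polynomial (\<lambda>x. f x * g x)"
  using assms
  by (induction rule: trig_polynomial.induct)
     (auto simp: distrib_right intro!: trig_polynomial_add trig_polynomial_cmult_iexp trig_polynomial.zero)

lemma trig_polynomial_sum:
  "finite A \<Longrightarrow> (\<And>i. i \<in> A \<Longrightarrow> trig_polynomial (f i)) \<Longrightarrow> trig_polynomial (\<lambda>x. \<Sum>i\<in>A. f i x)"
  by (induction rule: finite_induct) (auto intro: trig_polynomial.zero trig_polynomial_add)

lemma trig_polynomial_sin: "trig_polynomial (\<lambda>x. complex_of_real (sin (u \<bullet> x)))"
proof -
  have "complex_of_real (sin (u \<bullet> x)) = (-\<i>/2) * iexp (u \<bullet> x) + (\<i>/2) * iexp ((-u) \<bullet> x)" for x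
    by (simp add: complex_eq_iff Re_exp Im_exp)
  then show ?thesis
    using trig_polynomial_add[OF trig_polynomial_iexp trig_polynomial_iexp, of "-\<i>/2" u "\<i>/2" "-u"] by simp
qed

text \<open>A linear form of the vector of sines is a combination of sines of linear forms; sums and
  products stay in the algebra.\<close>

lemma trig_polynomial_of_polynomial:
  fixes p :: "real ^ 'm \<Rightarrow> real"
  assumes "real_polynomial_function p"
  shows "trig_polynomial (\<lambda>x. complex_of_real (p (\<chi> i. sin (a * x $ i))))"
  using assms
proof induction
  case (linear f)
  interpret bounded_linear f by fact
  have "f (\<chi> i. sin (a * x $ i)) = (\<Sum>i\<in>UNIV. f (axis i 1) * sin ((a *\<^sub>R axis i 1) \<bullet> x))" for x :: "real ^ 'm"
  proof -
    have "f (\<chi> i. sin (a * x $ i)) = f (\<Sum>i\<in>UNIV. sin (a * x $ i) *\<^sub>R axis i 1)"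
      by (rule arg_cong[of _ _ f]) (simp add: vec_eq_iff axis_def if_distrib cong: if_cong)
    also have "\<dots> = (\<Sum>i\<in>UNIV. f (axis i 1) * sin ((a *\<^sub>R axis i 1) \<bullet> x))"
      by (simp add: sum scale inner_axis' mult.commute)
    finally show ?thesis .
  qed
  then show ?case
    by (auto intro!: trig_polynomial_sum trig_polynomial_mult trig_polynomial_const trig_polynomial_sin
      simp del: inner_scaleR_left)
next
  case (const c)
  then show ?case by (rule trig_polynomial_const)
next
  case (add f g)
  then show ?case by (simp add: trig_polynomial_add)
next
  case (mult f g)
  then show ?case by (simp add: trig_polynomial_mult)
qed

lemma trig_polynomial_measurable: "trig_polynomial (f :: real ^ 'm \<Rightarrow> complex) \<Longrightarrow> f \<in> borel_measurable borel"
  by (induction rule: trig_polynomial.induct) auto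

lemma trig_polynomial_bounded: "trig_polynomial f \<Longrightarrow> \<exists>C. \<forall>x. norm (f x) \<le> C"
proof (induction rule: trig_polynomial.induct)
  case (add h a u)
  then obtain C where C: "\<And>x. norm (h x) \<le> C" by auto
  have "norm (a * iexp (u \<bullet> x) + h x) \<le> norm a + C" for x
    by (rule order_trans[OF norm_triangle_ineq]) (use C[of x] in \<open>simp add: norm_mult\<close>)
  then show ?case by blast
qed auto

lemma trig_polynomial_tendsto:
  fixes Y :: "nat \<Rightarrow> 'a \<Rightarrow> real ^ 'm"
  assumes M: "prob_space M" and N: "prob_space N" and sN: "sets N = sets borel"
    and Y: "\<And>n. Y n \<in> borel_measurable M"
    and conv: "\<And>u. (\<lambda>n. \<integral>x. iexp (u \<bullet> Y n x) \<partial>M) \<longlonglongrightarrow> (\<integral>y. iexp (u \<bullet> y) \<partial>N)"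
    and f: "trig_polynomial f"
  shows "(\<lambda>n. \<integral>x. f (Y n x) \<partial>M) \<longlonglongrightarrow> (\<integral>y. f y \<partial>N)"
  using f
proof induction
  case zero
  then show ?case by simp
next
  case (add h a u)
  interpret M: prob_space M by fact
  interpret N: prob_space N by fact
  note [measurable_cong] = sN
  note [measurable] = Y trig_polynomial_measurable[OF add.hyps]
  obtain C where C: "\<And>x. norm (h x) \<le> C" using trig_polynomial_bounded[OF add.hyps] by auto
  have "(\<integral>x. a * iexp (u \<bullet> Y n x) + h (Y n x) \<partial>M)
      = a * (\<integral>x. iexp (u \<bullet> Y n x) \<partial>M) + (\<integral>x. h (Y n x) \<partial>M)" for n
    using M.integrable_const_bound[of "\<lambda>x. a * iexp (u \<bullet> Y n x)" "norm a"]
      M.integrable_const_bound[of "\<lambda>x. h (Y n x)" C]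
    by (simp add: norm_mult C)
  moreover have "(\<integral>x. a * iexp (u \<bullet> x) + h x \<partial>N)
      = a * (\<integral>x. iexp (u \<bullet> x) \<partial>N) + (\<integral>x. h x \<partial>N)"
    using N.integrable_const_bound[of "\<lambda>x. a * iexp (u \<bullet> x)" "norm a"] N.integrable_const_bound[of h C]
    by (simp add: norm_mult C)
  ultimately show ?case by (auto intro!: tendsto_intros add.IH conv)
qed

text \<open>Replacing \<open>x\<close> by \<open>arcsin (sin (a x)) / a\<close> in each coordinate makes \<open>g\<close> a continuous function of the sines
  without changing it on the box, so that the approximation is bounded on the whole space.\<close>

lemma trig_polynomial_approx:
  fixes g :: "real ^ 'm \<Rightarrow> real"
  assumes cont: "continuous_on UNIV g" and bdd: "\<And>x. \<bar>g x\<bar> \<le> B" and L: "0 < L" and e: "0 < e"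
  obtains p where "trig_polynomial (\<lambda>x. complex_of_real (p x))"
    and "\<And>x. \<bar>p x\<bar> \<le> B + e"
    and "\<And>x. (\<forall>i. \<bar>x $ i\<bar> \<le> L) \<Longrightarrow> \<bar>p x - g x\<bar> \<le> e"
proof -
  \<comment> \<open>This scale maps the interval from \<open>- L\<close> to \<open>L\<close> onto
    the interval from - pi/2 to pi/2, where \<open>arcsin\<close> inverts
    \<open>sin\<close>.\<close>
  define a where "a = pi / (2 * L)"
  have a: "0 < a" using L by (simp add: a_def)
  define G where "G y = g (\<chi> i. arcsin (y $ i) / a)" for y :: "real ^ 'm"
  define K :: "(real ^ 'm) set" where "K = cbox (\<chi> i. -1) (\<chi> i. 1)"
  have K: "y \<in> K \<longleftrightarrow> (\<forall>i. -1 \<le> y $ i \<and> y $ i \<le> 1)" for y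
    by (simp add: K_def mem_box_cart)
  have "continuous_on K G" unfolding G_def
    using a by (intro continuous_on_compose2[OF cont] continuous_intros) (auto simp: K)
  moreover have "compact K" by (simp add: K_def)
  ultimately obtain q where q: "real_polynomial_function q" "\<And>y. y \<in> K \<Longrightarrow> \<bar>G y - q y\<bar> < e"
    using Stone_Weierstrass_real_polynomial_function[OF _ _ e] by metis
  define s where "s x = (\<chi> i. sin (a * x $ i))" for x :: "real ^ 'm"
  have sK: "s x \<in> K" for x by (simp add: K s_def)
  show ?thesis
  proof
    show "trig_polynomial (\<lambda>x. complex_of_real (q (s x)))"
      unfolding s_def by (rule trig_polynomial_of_polynomial[OF q(1)])
    show "\<bar>q (s x)\<bar> \<le> B + e" for x
      using q(2)[OF sK, of x] bdd[of "\<chi> i. arcsin (s x $ i) / a"] unfolding G_def by linarith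
    show "\<bar>q (s x) - g x\<bar> \<le> e" if x: "\<forall>i. \<bar>x $ i\<bar> \<le> L" for x
    proof -
      have "arcsin (s x $ i) / a = x $ i" for i
      proof -
        have "\<bar>a * x $ i\<bar> \<le> a * L" using x a by (simp add: abs_mult mult_left_mono)
        also have "a * L = pi / 2" using L by (simp add: a_def)
        finally have "arcsin (sin (a * x $ i)) = a * x $ i" by (intro arcsin_sin) auto
        then show ?thesis using a by (simp add: s_def)
      qed
      then have "G (s x) = g x" by (simp add: G_def)
      then show ?thesis using q(2)[OF sK, of x] by linarith
    qed
  qed
qed

text \<open>The source of tightness: Markov's inequality for the squares and a union bound over the
  coordinates.\<close>

lemma (in prob_space) Markov_sq_component:
  fixes Y :: "'a \<Rightarrow> real ^ 'm"
  assumes [measurable]: "Y \<in> borel_measurable M"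
    and int: "\<And>i. integrable M (\<lambda>x. (Y x $ i)\<^sup>2)" and bd: "\<And>i. expectation (\<lambda>x. (Y x $ i)\<^sup>2) \<le> C" and L: "0 < L"
  shows "prob {x \<in> space M. \<not> (\<forall>i. \<bar>Y x $ i\<bar> \<le> L)} \<le> real CARD('m) * C / L\<^sup>2"
proof -
  have "prob {x \<in> space M. \<not> (\<forall>i. \<bar>Y x $ i\<bar> \<le> L)} \<le> prob (\<Union>i\<in>UNIV. {x \<in> space M. L\<^sup>2 \<le> (Y x $ i)\<^sup>2})"
  proof (rule finite_measure_mono)
    show "{x \<in> space M. \<not> (\<forall>i. \<bar>Y x $ i\<bar> \<le> L)} \<subseteq> (\<Union>i\<in>UNIV. {x \<in> space M. L\<^sup>2 \<le> (Y x $ i)\<^sup>2})"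
    proof (rule subsetI)
      fix x assume "x \<in> {x \<in> space M. \<not> (\<forall>i. \<bar>Y x $ i\<bar> \<le> L)}"
      then obtain i where x: "x \<in> space M" and "\<not> \<bar>Y x $ i\<bar> \<le> L" by auto
      then have "L\<^sup>2 \<le> (Y x $ i)\<^sup>2" using L abs_le_square_iff[of L "Y x $ i"] by simp
      then show "x \<in> (\<Union>i\<in>UNIV. {x \<in> space M. L\<^sup>2 \<le> (Y x $ i)\<^sup>2})" using x by blast
    qed
  qed measurable
  also have "\<dots> \<le> (\<Sum>i\<in>UNIV. prob {x \<in> space M. L\<^sup>2 \<le> (Y x $ i)\<^sup>2})"
    by (intro finite_measure_subadditive_finite) auto
  also have "\<dots> \<le> (\<Sum>i\<in>(UNIV::'m set). C / L\<^sup>2)"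
  proof (rule sum_mono)
    fix i
    have "prob {x \<in> space M. L\<^sup>2 \<le> (Y x $ i)\<^sup>2} \<le> expectation (\<lambda>x. (Y x $ i)\<^sup>2) / L\<^sup>2"
      using integral_Markov_inequality_measure[OF int[of i], of "space M" "L\<^sup>2"] L by simp
    also have "\<dots> \<le> C / L\<^sup>2" using bd L by (simp add: divide_right_mono)
    finally show "prob {x \<in> space M. L\<^sup>2 \<le> (Y x $ i)\<^sup>2} \<le> C / L\<^sup>2" .
  qed
  finally show ?thesis by simp
qed

lemma (in prob_space) expectation_diff_le_off_set:
  fixes f g :: "'a \<Rightarrow> real"
  assumes [measurable]: "f \<in> borel_measurable M" "g \<in> borel_measurable M" "Measurable.pred M P"
    and "\<And>x. \<bar>f x\<bar> \<le> B1" "\<And>x. \<bar>g x\<bar> \<le> B2" "\<And>x. P x \<Longrightarrow> \<bar>f x - g x\<bar> \<le> e" "0 \<le> e"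
  shows "\<bar>expectation f - expectation g\<bar> \<le> e + (B1 + B2) * prob {x \<in> space M. \<not> P x}"
proof -
  have i: "integrable M f" "integrable M g"
    using integrable_const_bound[of f B1] integrable_const_bound[of g B2] assms(4,5) by auto
  have i2: "integrable M (\<lambda>x. indicat_real {x \<in> space M. \<not> P x} x)"
    by (auto intro!: integrable_real_indicator simp: emeasure_eq_measure)
  have "\<bar>expectation f - expectation g\<bar> = \<bar>expectation (\<lambda>x. f x - g x)\<bar>"
    using i by simp
  also have "\<dots> \<le> expectation (\<lambda>x. \<bar>f x - g x\<bar>)"
    using integral_norm_bound[of M "\<lambda>x. f x - g x"] by simp
  also have "\<dots> \<le> expectation (\<lambda>x. e + (B1 + B2) * indicat_real {x \<in> space M. \<not> P x} x)"
  proof (rule integral_mono)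
    fix x assume "x \<in> space M"
    then show "\<bar>f x - g x\<bar> \<le> e + (B1 + B2) * indicat_real {x \<in> space M. \<not> P x} x"
      using assms(4)[of x] assms(5)[of x] assms(6)[of x] assms(7)
      by (cases "P x") auto
  qed (use i i2 in auto)
  also have "\<dots> = e + (B1 + B2) * prob {x \<in> space M. \<not> P x}"
    using i2 by (simp add: prob_space)
  finally show ?thesis .
qed

text \<open>Bounded second moments give tightness directly. On a large box \<open>g\<close> is close
  to a trigonometric polynomial, whose integrals converge; off the box both functions are bounded,
  and the box carries nearly all the mass of \<open>N\<close> and of \<open>Y n\<close> for all
  large \<open>n\<close>.\<close>

theorem levy_continuity_vec:
  fixes Y :: "nat \<Rightarrow> 'a \<Rightarrow> real ^ 'm"
  assumes M: "prob_space M" and N: "prob_space N" and sN: "sets N = sets borel"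
    and Y: "\<And>n. Y n \<in> borel_measurable M"
    and conv: "\<And>u. (\<lambda>n. \<integral>x. iexp (u \<bullet> Y n x) \<partial>M) \<longlonglongrightarrow> (\<integral>y. iexp (u \<bullet> y) \<partial>N)"
    and int: "\<And>n i. integrable M (\<lambda>x. (Y n x $ i)\<^sup>2)"
    and bd: "\<And>i. eventually (\<lambda>n. (\<integral>x. (Y n x $ i)\<^sup>2 \<partial>M) \<le> C) sequentially"
  shows "conv_in_distr M Y N"
  unfolding conv_in_distr_def
proof safe
  fix g :: "real ^ 'm \<Rightarrow> real"
  assume g: "continuous_on UNIV g" and "bounded (range g)"
  then obtain B where B: "\<And>x. \<bar>g x\<bar> \<le> B" by (auto simp: bounded_iff)
  have B0: "0 \<le> B" using B[of 0] by simp
  interpret M: prob_space M by fact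
  interpret N: prob_space N by fact
  note [measurable_cong] = sN
  have gm[measurable]: "g \<in> borel_measurable borel" using g by (rule borel_measurable_continuous_onI)
  note [measurable] = Y
  define C' where "C' = max C 0"
  \<comment> \<open>Bounds the sum of the masses off the box under \<open>N\<close> and under any
    late \<open>Y n\<close>. Replacing \<open>C\<close> by \<open>C'\<close> makes it visibly
    nonnegative.\<close>
  define T where "T L = real CARD('m) * C' / L\<^sup>2 + measure N {x \<in> space N. \<not> (\<forall>i. \<bar>x $ i\<bar> \<le> L)}" for L
  have "(\<lambda>L. measure N {x \<in> space N. \<not> (\<forall>i. \<bar>x $ i\<bar> \<le> real L)}) \<longlonglongrightarrow> measure N (\<Inter>L. {x \<in> space N. \<not> (\<forall>i. \<bar>x $ i\<bar> \<le> real L)})"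
  proof (rule N.finite_Lim_measure_decseq)
    show "range (\<lambda>L. {x \<in> space N. \<not> (\<forall>i. \<bar>x $ i\<bar> \<le> real L)}) \<subseteq> N.events" by auto
    show "decseq (\<lambda>L. {x \<in> space N. \<not> (\<forall>i. \<bar>x $ i\<bar> \<le> real L)})"
      by (auto simp: decseq_def) (meson le_trans of_nat_le_iff order_trans)
  qed
  moreover have "(\<Inter>L. {x \<in> space N. \<not> (\<forall>i. \<bar>x $ i\<bar> \<le> real L)}) = {}"
  proof -
    have "\<exists>L. \<forall>i. \<bar>x $ i\<bar> \<le> real L" for x :: "real ^ 'm"
    proof -
      obtain L where "norm x \<le> real L" using real_arch_simple by blast
      then show ?thesis using component_le_norm_cart[of x] order_trans by blast
    qed
    then show ?thesis by blast
  qed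
  moreover have "(\<lambda>L. real CARD('m) * C' / (real L)\<^sup>2) \<longlonglongrightarrow> 0" by real_asymp
  ultimately have T0: "(\<lambda>L. T (real L)) \<longlonglongrightarrow> 0"
    unfolding T_def by (auto intro: tendsto_add_zero)
  show "(\<lambda>n. \<integral>x. g (Y n x) \<partial>M) \<longlonglongrightarrow> (\<integral>y. g y \<partial>N)"
  proof (rule LIMSEQ_I)
    fix r :: real assume r: "0 < r"
    \<comment> \<open>The bound 1 turns \<open>(B + e) + B\<close> into at most
      \<open>2 * B + 1\<close>; the bound \<open>r / 8\<close> lets the two approximations on the
      box cost \<open>r / 4\<close> together. The mass off the box and the convergence of the
      polynomial integrals cost another \<open>r / 4\<close> each.\<close>
    define e where "e = min 1 (r / 8)"
    have e: "0 < e" "e \<le> 1" "e \<le> r / 8" using r by (auto simp: e_def)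
    have "eventually (\<lambda>L. T (real L) < r / (4 * (2 * B + 1)) \<and> 0 < L) sequentially"
      using order_tendstoD(2)[OF T0, of "r / (4 * (2 * B + 1))"] r B0
      by (intro eventually_conj eventually_gt_at_top) auto
    then obtain L :: nat where L: "T (real L) < r / (4 * (2 * B + 1))" "0 < L"
      by (auto simp: eventually_sequentially)
    obtain p where p: "trig_polynomial (\<lambda>x. complex_of_real (p x))" "\<And>x. \<bar>p x\<bar> \<le> B + e"
      "\<And>x. (\<forall>i. \<bar>x $ i\<bar> \<le> real L) \<Longrightarrow> \<bar>p x - g x\<bar> \<le> e"
      using trig_polynomial_approx[OF g B, of "real L" e] L e by auto
    have pm[measurable]: "p \<in> borel_measurable borel"
      using measurable_compose[OF trig_polynomial_measurable[OF p(1)] borel_measurable_Re] by simp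
    have "(\<lambda>n. \<integral>x. complex_of_real (p (Y n x)) \<partial>M) \<longlonglongrightarrow> (\<integral>y. complex_of_real (p y) \<partial>N)"
      by (rule trig_polynomial_tendsto[OF M N sN Y conv p(1)])
    then have "(\<lambda>n. \<integral>x. p (Y n x) \<partial>M) \<longlonglongrightarrow> (\<integral>y. p y \<partial>N)"
      by (simp add: tendsto_of_real_iff)
    then have "eventually (\<lambda>n. \<bar>(\<integral>x. p (Y n x) \<partial>M) - (\<integral>y. p y \<partial>N)\<bar> < r / 4) sequentially"
      using r by (auto dest!: tendstoD[where e="r/4"] simp: dist_real_def)
    moreover have "eventually (\<lambda>n. \<forall>i. (\<integral>x. (Y n x $ i)\<^sup>2 \<partial>M) \<le> C) sequentially"
      using bd by (simp add: eventually_all_finite)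
    ultimately have "eventually (\<lambda>n. norm ((\<integral>x. g (Y n x) \<partial>M) - (\<integral>y. g y \<partial>N)) < r) sequentially"
    proof eventually_elim
      case (elim n)
      have "\<bar>(\<integral>x. p (Y n x) \<partial>M) - (\<integral>x. g (Y n x) \<partial>M)\<bar>
          \<le> e + ((B + e) + B) * M.prob {x \<in> space M. \<not> (\<forall>i. \<bar>Y n x $ i\<bar> \<le> real L)}"
        by (rule M.expectation_diff_le_off_set) (use p B e in auto)
      also have "M.prob {x \<in> space M. \<not> (\<forall>i. \<bar>Y n x $ i\<bar> \<le> real L)} \<le> real CARD('m) * C' / (real L)\<^sup>2"
        using elim(2) L by (intro M.Markov_sq_component[OF Y int]) (auto simp: C'_def intro: le_max_iff_disj[THEN iffD2])
      finally have 1: "\<bar>(\<integral>x. p (Y n x) \<partial>M) - (\<integral>x. g (Y n x) \<partial>M)\<bar>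
          \<le> e + ((B + e) + B) * (real CARD('m) * C' / (real L)\<^sup>2)" using B0 e by (simp add: mult_left_mono)
      have 2: "\<bar>(\<integral>x. p x \<partial>N) - (\<integral>x. g x \<partial>N)\<bar>
          \<le> e + ((B + e) + B) * N.prob {x \<in> space N. \<not> (\<forall>i. \<bar>x $ i\<bar> \<le> real L)}"
        by (rule N.expectation_diff_le_off_set) (use p B e in auto)
      have "((B + e) + B) * T (real L) \<le> (2 * B + 1) * T (real L)"
        by (rule mult_right_mono) (use e B0 in \<open>auto simp: T_def C'_def\<close>)
      also have "\<dots> < r / 4" using L B0 by (simp add: field_simps)
      finally have 3: "((B + e) + B) * (real CARD('m) * C' / (real L)\<^sup>2)
         + ((B + e) + B) * N.prob {x \<in> space N. \<not> (\<forall>i. \<bar>x $ i\<bar> \<le> real L)} < r / 4"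
        by (simp add: T_def distrib_left)
      show ?case using 1 2 3 elim(1) e r unfolding real_norm_def by linarith
    qed
    then show "\<exists>no. \<forall>n\<ge>no. norm ((\<integral>x. g (Y n x) \<partial>M) - (\<integral>y. g y \<partial>N)) < r"
      by (simp add: eventually_sequentially)
  qed
qed

text \<open>With y = |x|/2, squaring y^2/2 <= exp y gives x^4/64 <= exp |x|. It converts bounds on
  moment generating functions at 1 and -1 into a bound on fourth moments.\<close>

lemma power4_le_exp: "x ^ 4 \<le> 64 * (exp x + exp (- x))" for x :: real
proof -
  have "(\<bar>x\<bar> / 2)\<^sup>2 / 2 \<le> exp (\<bar>x\<bar> / 2)"
    using exp_lower_Taylor_quadratic[of "\<bar>x\<bar> / 2"] by simp
  then have "((\<bar>x\<bar> / 2)\<^sup>2 / 2)\<^sup>2 \<le> (exp (\<bar>x\<bar> / 2))\<^sup>2" by (intro power_mono) auto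
  also have "(exp (\<bar>x\<bar> / 2))\<^sup>2 = exp \<bar>x\<bar>" by (simp flip: exp_of_nat_mult)
  also have "exp \<bar>x\<bar> \<le> exp x + exp (- x)" by (cases "0 \<le> x") auto
  finally show ?thesis by (simp add: power_divide)
qed

lemma abs_sin_diff_le: "\<bar>sin x - x\<bar> \<le> x\<^sup>2 / 2" for x :: real
proof -
  have "\<bar>Im (iexp x - (\<Sum>k\<le>1. (\<i> * x) ^ k / fact k))\<bar> \<le> \<bar>x\<bar> ^ Suc 1 / fact (Suc 1)"
    by (rule order_trans[OF abs_Im_le_cmod iexp_approx1])
  then show ?thesis by (simp add: Im_exp power2_eq_square)
qed

text \<open>The linear and cubic Taylor terms of \<open>iexp\<close> are imaginary, so the real part
  is controlled by the remainder of order four; doubling 1/4! gives 1/12.\<close>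

lemma abs_cos_diff_le: "\<bar>2 * (1 - cos x) - x\<^sup>2\<bar> \<le> x ^ 4 / 12" for x :: real
proof -
  have "\<bar>Re (iexp x - (\<Sum>k\<le>3. (\<i> * x) ^ k / fact k))\<bar> \<le> \<bar>x\<bar> ^ Suc 3 / fact (Suc 3)"
    by (rule order_trans[OF abs_Re_le_cmod iexp_approx1])
  moreover have "{..3} = {0,1,2,3::nat}" by auto
  ultimately show ?thesis
    by (simp add: Re_exp power2_eq_square fact_numeral power3_eq_cube power4_eq_xxxx abs_if split: if_splits)
qed

text \<open>Difference quotients of the characteristic function at 0 approximate the moments: sin (h
  U) / h differs from U by at most h U^2 / 2, and 2 (1 - cos (h U)) / h^2 from U^2 by at most h^2
  U^4 / 12. The fourth-moment bound makes both errors small uniformly in n, so h can be fixed before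
  n grows.\<close>

lemma tendsto_moments_of_char:
  fixes U :: "nat \<Rightarrow> 'a \<Rightarrow> real"
  assumes M: "prob_space M" and U[measurable]: "\<And>n. U n \<in> borel_measurable M"
    and bounded: "\<And>n. \<exists>B. \<forall>x. \<bar>U n x\<bar> \<le> B"
    and conv: "\<And>h::real. (\<lambda>n. \<integral>x. iexp (h * U n x) \<partial>M) \<longlonglongrightarrow> complex_of_real (exp (- (h\<^sup>2 * s) / 2))"
    and moment4: "eventually (\<lambda>n. (\<integral>x. U n x ^ 4 \<partial>M) \<le> C) sequentially"
  shows "(\<lambda>n. \<integral>x. U n x \<partial>M) \<longlonglongrightarrow> 0" "(\<lambda>n. \<integral>x. (U n x)\<^sup>2 \<partial>M) \<longlonglongrightarrow> s"
proof -
  interpret prob_space M by fact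
  have int: "integrable M (\<lambda>x. f (U n x))" if f: "continuous_on UNIV f" for f :: "real \<Rightarrow> real" and n
  proof -
    obtain B where B: "\<And>x. \<bar>U n x\<bar> \<le> B" using bounded by blast
    have "bounded (f ` {-B..B})"
      using f by (intro compact_imp_bounded compact_continuous_image) (auto intro: continuous_on_subset)
    then obtain C where C: "\<And>y. y \<in> {-B..B} \<Longrightarrow> norm (f y) \<le> C" unfolding bounded_iff by blast
    have [measurable]: "f \<in> borel_measurable borel" using f by (rule borel_measurable_continuous_onI)
    show ?thesis
      by (intro integrable_const_bound[where B=C] AE_I2 C) (use B in \<open>auto simp: abs_le_iff minus_le_iff\<close>)
  qed
  have [measurable]: "(\<lambda>x. iexp (h * U n x)) \<in> borel_measurable M" for h n by measurable
  have cint: "integrable M (\<lambda>x. iexp (h * U n x))" for h n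
    by (rule integrable_const_bound[where B=1]) auto
  have ReIm: "(\<integral>x. iexp (h * U n x) \<partial>M) = Complex (\<integral>x. cos (h * U n x) \<partial>M) (\<integral>x. sin (h * U n x) \<partial>M)" for h n
    using integral_Re[OF cint] integral_Im[OF cint]
    by (simp add: complex_eq_iff Re_exp Im_exp)
  have cos_lim: "(\<lambda>n. \<integral>x. cos (h * U n x) \<partial>M) \<longlonglongrightarrow> exp (- (h\<^sup>2 * s) / 2)"
    and sin_lim: "(\<lambda>n. \<integral>x. sin (h * U n x) \<partial>M) \<longlonglongrightarrow> 0" for h
    using tendsto_Re[OF conv[of h]] tendsto_Im[OF conv[of h]] unfolding ReIm by simp_all
  have C0: "0 \<le> C"
  proof -
    obtain n where "(\<integral>x. U n x ^ 4 \<partial>M) \<le> C" using moment4 by (auto simp: eventually_sequentially)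
    moreover have "0 \<le> (\<integral>x. U n x ^ 4 \<partial>M)" by (intro integral_nonneg_AE) auto
    ultimately show ?thesis by linarith
  qed
  have moment2: "eventually (\<lambda>n. (\<integral>x. (U n x)\<^sup>2 \<partial>M) \<le> 1 + C) sequentially"
    using moment4
  proof eventually_elim
    case (elim n)
    have "(\<integral>x. (U n x)\<^sup>2 \<partial>M) \<le> (\<integral>x. 1 + U n x ^ 4 \<partial>M)"
    proof (rule integral_mono)
      show "(U n x)\<^sup>2 \<le> 1 + U n x ^ 4" for x
      proof -
        have "0 \<le> ((U n x)\<^sup>2 - 1 / 2)\<^sup>2" by simp
        then show ?thesis by (simp add: power2_diff) (simp add: power2_eq_square power4_eq_xxxx)
      qed
    qed (auto intro!: int[of "\<lambda>y. y\<^sup>2"] int[of "\<lambda>y. 1 + y ^ 4"] continuous_intros)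
    also have "\<dots> = 1 + (\<integral>x. U n x ^ 4 \<partial>M)"
      by (subst Bochner_Integration.integral_add) (auto intro!: int[of "\<lambda>y. y ^ 4"] continuous_intros simp: prob_space)
    finally show ?case using elim by simp
  qed
  show "(\<lambda>n. \<integral>x. U n x \<partial>M) \<longlonglongrightarrow> 0"
  proof (rule LIMSEQ_I)
    fix r :: real assume r: "0 < r"
    \<comment> \<open>Makes the error bound h/2 * (1 + C) equal to r/2.\<close>
    define h where "h = r / (1 + C)"
    have h: "0 < h" using r C0 by (simp add: h_def)
    have "(\<lambda>n. (\<integral>x. sin (h * U n x) \<partial>M) / h) \<longlonglongrightarrow> 0 / h"
      by (intro tendsto_intros sin_lim) (use h in auto)
    then have "eventually (\<lambda>n. \<bar>(\<integral>x. sin (h * U n x) \<partial>M) / h\<bar> < r / 2) sequentially"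
      using r by (auto dest!: tendstoD[where e="r/2"])
    then have "eventually (\<lambda>n. norm ((\<integral>x. U n x \<partial>M) - 0) < r) sequentially"
      using moment2
    proof eventually_elim
      case (elim n)
      have "\<bar>(\<integral>x. sin (h * U n x) \<partial>M) / h - (\<integral>x. U n x \<partial>M)\<bar> = \<bar>\<integral>x. sin (h * U n x) / h - U n x \<partial>M\<bar>"
        using h by (subst Bochner_Integration.integral_diff)
          (auto intro!: int[of "\<lambda>y. sin (h * y) / h"] int[of "\<lambda>y. y"] continuous_intros)
      also have "\<dots> \<le> (\<integral>x. \<bar>sin (h * U n x) / h - U n x\<bar> \<partial>M)"
        using integral_norm_bound[of M "\<lambda>x. sin (h * U n x) / h - U n x"] by simp
      also have "\<dots> \<le> (\<integral>x. h / 2 * (U n x)\<^sup>2 \<partial>M)"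
      proof (rule integral_mono)
        show "\<bar>sin (h * U n x) / h - U n x\<bar> \<le> h / 2 * (U n x)\<^sup>2" for x
        proof -
          have "sin (h * U n x) / h - U n x = (sin (h * U n x) - h * U n x) / h"
            using h by (simp add: diff_divide_distrib)
          then have "\<bar>sin (h * U n x) / h - U n x\<bar> = \<bar>sin (h * U n x) - h * U n x\<bar> / h"
            using h by simp
          also have "\<dots> \<le> ((h * U n x)\<^sup>2 / 2) / h" using h by (intro divide_right_mono abs_sin_diff_le) auto
          also have "\<dots> = h / 2 * (U n x)\<^sup>2" using h by (simp add: power2_eq_square)
          finally show ?thesis .
        qed
      qed (use h in \<open>auto intro!: int[of "\<lambda>y. h * y\<^sup>2 / 2"] int[of "\<lambda>y. \<bar>sin (h * y) / h - y\<bar>"] continuous_intros\<close>)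
      also have "\<dots> \<le> h / 2 * (1 + C)" using elim(2) h by (simp add: mult_left_mono)
      also have "\<dots> = r / 2" using C0 by (simp add: h_def field_simps)
      finally show ?case using elim(1) unfolding real_norm_def by linarith
    qed
    then show "\<exists>no. \<forall>n\<ge>no. norm ((\<integral>x. U n x \<partial>M) - 0) < r" by (simp add: eventually_sequentially)
  qed
  show "(\<lambda>n. \<integral>x. (U n x)\<^sup>2 \<partial>M) \<longlonglongrightarrow> s"
  proof (rule LIMSEQ_I)
    fix r :: real assume r: "0 < r"
    \<comment> \<open>The second difference quotient of the limiting characteristic function tends
      to \<open>s\<close> as \<open>h\<close> tends to 0, so some fixed \<open>h\<close> serves for
      this limit and for the fourth-moment error at once.\<close>
    have l1: "((\<lambda>h. 2 * (1 - exp (- (h\<^sup>2 * s) / 2)) / h\<^sup>2) \<longlongrightarrow> s) (at_right 0)" by real_asymp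
    have l2: "((\<lambda>h. h\<^sup>2 * C / 12) \<longlongrightarrow> 0) (at_right 0)" by real_asymp
    have "eventually (\<lambda>h. \<bar>2 * (1 - exp (- (h\<^sup>2 * s) / 2)) / h\<^sup>2 - s\<bar> < r / 3 \<and> \<bar>h\<^sup>2 * C / 12\<bar> < r / 3 \<and> 0 < h) (at_right 0)"
      using tendstoD[OF l1, of "r/3"] tendstoD[OF l2, of "r/3"] r
      by (intro eventually_conj eventually_at_right_less) (auto simp: dist_real_def)
    then obtain h where h: "\<bar>2 * (1 - exp (- (h\<^sup>2 * s) / 2)) / h\<^sup>2 - s\<bar> < r / 3" "\<bar>h\<^sup>2 * C / 12\<bar> < r / 3" "0 < h"
      using eventually_happens'[of "at_right (0::real)"] by (auto simp: trivial_limit_at_right_real)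
    have "(\<lambda>n. 2 * (1 - (\<integral>x. cos (h * U n x) \<partial>M)) / h\<^sup>2) \<longlonglongrightarrow> 2 * (1 - exp (- (h\<^sup>2 * s) / 2)) / h\<^sup>2"
      by (intro tendsto_intros cos_lim) (use h in auto)
    then have "eventually (\<lambda>n. \<bar>2 * (1 - (\<integral>x. cos (h * U n x) \<partial>M)) / h\<^sup>2 - 2 * (1 - exp (- (h\<^sup>2 * s) / 2)) / h\<^sup>2\<bar> < r / 3) sequentially"
      using r by (auto dest!: tendstoD[where e="r/3"] simp: dist_real_def)
    then have "eventually (\<lambda>n. norm ((\<integral>x. (U n x)\<^sup>2 \<partial>M) - s) < r) sequentially"
      using moment4
    proof eventually_elim
      case (elim n)
      have "2 * (1 - (\<integral>x. cos (h * U n x) \<partial>M)) / h\<^sup>2 = (\<integral>x. 2 * (1 - cos (h * U n x)) / h\<^sup>2 \<partial>M)"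
      proof -
        have "integrable M (\<lambda>x. cos (h * U n x))" by (auto intro!: int[of "\<lambda>y. cos (h * y)"] continuous_intros)
        then show ?thesis by (simp add: prob_space)
      qed
      then have "\<bar>2 * (1 - (\<integral>x. cos (h * U n x) \<partial>M)) / h\<^sup>2 - (\<integral>x. (U n x)\<^sup>2 \<partial>M)\<bar>
          = \<bar>\<integral>x. 2 * (1 - cos (h * U n x)) / h\<^sup>2 - (U n x)\<^sup>2 \<partial>M\<bar>"
        using h by (subst Bochner_Integration.integral_diff)
          (auto intro!: int[of "\<lambda>y. (2 - 2 * cos (h * y)) / h\<^sup>2"] int[of "\<lambda>y. y\<^sup>2"] continuous_intros
            simp del: Bochner_Integration.integral_divide_zero)
      also have "\<dots> \<le> (\<integral>x. \<bar>2 * (1 - cos (h * U n x)) / h\<^sup>2 - (U n x)\<^sup>2\<bar> \<partial>M)"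
        using integral_norm_bound[of M "\<lambda>x. 2 * (1 - cos (h * U n x)) / h\<^sup>2 - (U n x)\<^sup>2"] by simp
      also have "\<dots> \<le> (\<integral>x. h\<^sup>2 / 12 * U n x ^ 4 \<partial>M)"
      proof (rule integral_mono)
        show "\<bar>2 * (1 - cos (h * U n x)) / h\<^sup>2 - (U n x)\<^sup>2\<bar> \<le> h\<^sup>2 / 12 * U n x ^ 4" for x
        proof -
          have "2 * (1 - cos (h * U n x)) / h\<^sup>2 - (U n x)\<^sup>2 = (2 * (1 - cos (h * U n x)) - (h * U n x)\<^sup>2) / h\<^sup>2"
            using h by (simp add: diff_divide_distrib power_mult_distrib)
          then have "\<bar>2 * (1 - cos (h * U n x)) / h\<^sup>2 - (U n x)\<^sup>2\<bar> = \<bar>2 * (1 - cos (h * U n x)) - (h * U n x)\<^sup>2\<bar> / h\<^sup>2"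
            by simp
          also have "\<dots> \<le> ((h * U n x) ^ 4 / 12) / h\<^sup>2" by (intro divide_right_mono abs_cos_diff_le) auto
          also have "\<dots> = h\<^sup>2 / 12 * U n x ^ 4" using h by (simp add: power2_eq_square power4_eq_xxxx)
          finally show ?thesis .
        qed
      qed (use h in \<open>auto intro!: int[of "\<lambda>y. h\<^sup>2 * y ^ 4 / 12"] int[of "\<lambda>y. \<bar>(2 - 2 * cos (h * y)) / h\<^sup>2 - y\<^sup>2\<bar>"] continuous_intros\<close>)
      also have "\<dots> \<le> h\<^sup>2 / 12 * C" using elim(2) h by (simp add: mult_left_mono)
      also have "\<dots> < r / 3" using h(2) by (simp add: abs_less_iff mult.commute)
      finally show ?case using elim(1) h(1) unfolding real_norm_def by linarith
    qed
    then show "\<exists>no. \<forall>n\<ge>no. norm ((\<integral>x. (U n x)\<^sup>2 \<partial>M) - s) < r" by (simp add: eventually_sequentially)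
  qed
qed

lemma std_normal_char: "(\<integral>x. iexp (t * x) \<partial>std_normal_distribution) = complex_of_real (exp (- t\<^sup>2 / 2))"
  using fun_cong[OF char_std_normal_distribution, of t] by (simp add: char_def)

text \<open>The image of independent standard normal variables under the linear map with columns
  \<open>v i\<close>. With one column for each atom of the spectral measure it gives the limit law
  without any square root of a matrix.\<close>

lemma gaussian_combination:
  fixes v :: "'d::finite \<Rightarrow> real ^ 'm"
  obtains N where "prob_space N" "sets N = sets (borel :: (real ^ 'm) measure)"
    "\<And>u. (\<integral>y. iexp (u \<bullet> y) \<partial>N) = complex_of_real (exp (- (\<Sum>i\<in>UNIV. (u \<bullet> v i)\<^sup>2) / 2))"
proof
  define P where "P = PiM (UNIV :: 'd set) (\<lambda>_. std_normal_distribution)"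
  interpret product_prob_space "\<lambda>_::'d. std_normal_distribution" UNIV
    by (simp add: product_prob_space_def product_prob_space_axioms_def product_sigma_finite_def
        prob_space_normal_density prob_space_imp_sigma_finite)
  define f where "f g = (\<Sum>i\<in>UNIV. g i *\<^sub>R v i)" for g :: "'d \<Rightarrow> real"
  have fm[measurable]: "f \<in> borel_measurable P"
    unfolding f_def P_def by (intro borel_measurable_sum borel_measurable_scaleR) (auto cong: measurable_cong_sets)
  show "prob_space (distr P borel f)"
    unfolding P_def by (rule prob_space_distr) (use fm in \<open>simp add: P_def\<close>)
  show "sets (distr P borel f) = sets borel" by simp
  fix u :: "real ^ 'm"
  have "(\<integral>y. iexp (u \<bullet> y) \<partial>distr P borel f) = (\<integral>g. iexp (u \<bullet> f g) \<partial>P)"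
    by (rule integral_distr) auto
  also have "\<dots> = (\<integral>g. (\<Prod>i\<in>UNIV. iexp ((u \<bullet> v i) * g i)) \<partial>P)"
    by (simp add: f_def inner_sum_right exp_sum sum_distrib_left mult.commute)
  also have "\<dots> = (\<Prod>i\<in>UNIV. \<integral>x. iexp ((u \<bullet> v i) * x) \<partial>std_normal_distribution)"
    unfolding P_def
    by (rule product_integral_prod) (auto intro!: finite_measure.integrable_const_bound[where B=1] prob_space.finite_measure prob_space_normal_density)
  also have "\<dots> = complex_of_real (exp (- (\<Sum>i\<in>UNIV. (u \<bullet> v i)\<^sup>2) / 2))"
  proof -
    have "exp (- (\<Sum>i\<in>UNIV. (u \<bullet> v i)\<^sup>2) / 2) = (\<Prod>i\<in>UNIV. exp (- (u \<bullet> v i)\<^sup>2 / 2))"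
      by (subst exp_sum[symmetric]) (simp_all add: sum_divide_distrib sum_negf)
    then show ?thesis unfolding std_normal_char by simp
  qed
  finally show "(\<integral>y. iexp (u \<bullet> y) \<partial>distr P borel f) = complex_of_real (exp (- (\<Sum>i\<in>UNIV. (u \<bullet> v i)\<^sup>2) / 2))" .
qed

section \<open>The largest observations of an independent sample\<close>

text \<open>Sorting does not change how many sample values exceed \<open>v\<close>, and in a
  decreasing list these values form an initial segment. The lemma replaces the order statistic by a
  condition on ranks; position \<open>k - 1\<close> of the list holds the k-th largest value because
  lists are indexed from 0.\<close>

lemma ge_kth_largest_iff:
  assumes k: "1 \<le> k" "k \<le> n"
  shows "kth_largest n k R \<le> v \<longleftrightarrow> card {m \<in> {1..n}. v < R m} < k"
proof -
  define ys where "ys = rev (sort (map R [1..<Suc n]))"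
  have len: "length ys = n" by (simp add: ys_def)
  have "card {m \<in> {1..n}. v < R m} = card (set (filter (\<lambda>m. v < R m) [1..<Suc n]))"
    by (rule arg_cong[of _ _ card]) auto
  also have "\<dots> = length (filter (\<lambda>m. v < R m) [1..<Suc n])" by (intro distinct_card distinct_filter) simp
  also have "\<dots> = length (filter (\<lambda>y. v < y) (map R [1..<Suc n]))" by (simp add: filter_map comp_def)
  also have "\<dots> = size (filter_mset (\<lambda>y. v < y) (mset (map R [1..<Suc n])))" by (simp only: mset_filter[symmetric] size_mset)
  also have "\<dots> = size (filter_mset (\<lambda>y. v < y) (mset ys))" by (simp add: ys_def)
  also have "\<dots> = length (filter (\<lambda>y. v < y) ys)" by (simp only: mset_filter[symmetric] size_mset)
  also have "\<dots> = card {i. i < n \<and> v < ys ! i}" by (simp add: length_filter_conv_card len)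
  finally have card: "card {m \<in> {1..n}. v < R m} = card {i. i < n \<and> v < ys ! i}" .
  have mono: "ys ! j \<le> ys ! i" if "i \<le> j" "j < n" for i j
    using that len unfolding ys_def by (simp add: rev_nth sorted_nth_mono)
  show ?thesis
  proof (cases "ys ! (k - 1) \<le> v")
    case True
    have "{i. i < n \<and> v < ys ! i} \<subseteq> {..<k - 1}"
    proof
      fix i assume "i \<in> {i. i < n \<and> v < ys ! i}"
      then have "i < n" "v < ys ! i" by auto
      then show "i \<in> {..<k - 1}" using mono[of "k - 1" i] True by (auto simp: not_less[symmetric])
    qed
    then have "card {i. i < n \<and> v < ys ! i} \<le> k - 1" using card_mono[of "{..<k - 1}"] by fastforce
    then show ?thesis using True k card by (simp add: kth_largest_def ys_def)
  next
    case False
    have "{..<k} \<subseteq> {i. i < n \<and> v < ys ! i}"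
      using mono[of _ "k - 1"] False k by (auto simp: not_le intro: less_le_trans)
    then have "k \<le> card {i. i < n \<and> v < ys ! i}" using card_mono[of "{i. i < n \<and> v < ys ! i}" "{..<k}"] by simp
    then show ?thesis using False k card by (simp add: kth_largest_def ys_def)
  qed
qed

definition above :: "'i set \<Rightarrow> ('i \<Rightarrow> real) \<Rightarrow> real \<Rightarrow> 'i set" where
  "above I r v = {m \<in> I. v < r m}"

text \<open>Candidates \<open>(j, S)\<close> for the index of the k-th largest observation and the
  set of indices above it.\<close>

definition top_pairs :: "'i set \<Rightarrow> nat \<Rightarrow> ('i \<times> 'i set) set" where
  "top_pairs I k = (SIGMA j:I. {S. S \<subseteq> I - {j} \<and> card S = k - 1})"

lemma finite_top_pairs: "finite I \<Longrightarrow> finite (top_pairs I k)"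
  by (auto simp: top_pairs_def intro!: finite_SigmaI)

lemma card_top_pairs: "finite I \<Longrightarrow> card (top_pairs I k) = card I * (card I - 1 choose (k - 1))"
  by (simp add: top_pairs_def card_SigmaI n_subsets)

text \<open>The number of elements above \<open>l\<close> strictly decreases as \<open>r l\<close>
  grows, so the rank is injective; it takes values in a set with as many elements as
  \<open>I\<close>.\<close>

lemma bij_betw_rank:
  assumes I: "finite I" and inj: "inj_on r I"
  shows "bij_betw (\<lambda>l. card (above I r (r l))) I {..<card I}"
proof -
  have mono: "card (above I r (r l)) < card (above I r (r l'))" if "l \<in> I" "l' \<in> I" "r l' < r l" for l l'
  proof (rule psubset_card_mono)
    show "finite (above I r (r l'))" using I by (simp add: above_def)
    have "l \<in> above I r (r l')" "l \<notin> above I r (r l)" using that by (auto simp: above_def)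
    moreover have "above I r (r l) \<subseteq> above I r (r l')" using that by (auto simp: above_def)
    ultimately show "above I r (r l) \<subset> above I r (r l')" by blast
  qed
  have inj_rank: "inj_on (\<lambda>l. card (above I r (r l))) I"
  proof (rule inj_onI)
    fix l l' assume l: "l \<in> I" "l' \<in> I" "card (above I r (r l)) = card (above I r (r l'))"
    then have "r l = r l'" using mono[of l l'] mono[of l' l] by (cases "r l" "r l'" rule: linorder_cases) auto
    then show "l = l'" using inj l by (auto dest: inj_onD)
  qed
  then have "card ((\<lambda>l. card (above I r (r l))) ` I) = card {..<card I}" by (simp add: card_image)
  moreover have "(\<lambda>l. card (above I r (r l))) ` I \<subseteq> {..<card I}"
  proof safe
    fix l assume "l \<in> I"
    then have "above I r (r l) \<subset> I" by (auto simp: above_def)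
    then show "card (above I r (r l)) < card I" using I by (rule psubset_card_mono[rotated])
  qed
  ultimately have "(\<lambda>l. card (above I r (r l))) ` I = {..<card I}" by (simp add: card_subset_eq)
  then show ?thesis using inj_rank by (simp add: bij_betw_def)
qed

lemma ex_rank:
  assumes I: "finite I" and inj: "inj_on r I" and k: "1 \<le> k" "k \<le> card I"
  obtains j where "j \<in> I" "card (above I r (r j)) = k - 1"
proof -
  have "k - 1 \<in> (\<lambda>l. card (above I r (r l))) ` I"
    using bij_betw_rank[OF I inj] k by (auto simp: bij_betw_def)
  then show ?thesis using that by force
qed

lemma card_top:
  assumes I: "finite I" and inj: "inj_on r I" and k: "k \<le> card I"
  shows "card {l \<in> I. card (above I r (r l)) < k} = k"
proof -
  have bij: "inj_on (\<lambda>l. card (above I r (r l))) I" "(\<lambda>l. card (above I r (r l))) ` I = {..<card I}"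
    using bij_betw_rank[OF I inj] by (auto simp: bij_betw_def)
  have "(\<lambda>l. card (above I r (r l))) ` {l \<in> I. card (above I r (r l)) < k} = {..<k}"
  proof safe
    fix m assume "m < k"
    then have "m \<in> (\<lambda>l. card (above I r (r l))) ` I" unfolding bij(2) using k by simp
    then show "m \<in> (\<lambda>l. card (above I r (r l))) ` {l \<in> I. card (above I r (r l)) < k}" using \<open>m < k\<close> by blast
  qed
  moreover have "inj_on (\<lambda>l. card (above I r (r l))) {l \<in> I. card (above I r (r l)) < k}"
    by (rule inj_on_subset[OF bij(1)]) auto
  ultimately show ?thesis by (metis card_image card_lessThan)
qed

text \<open>Without ties exactly one pair has a nonzero term, namely the true index of rank
  \<open>k - 1\<close> with the true set above it. On the right-hand side each factor other than
  \<open>f j\<close> involves only \<open>r j\<close> and one further index, which is the form in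
  which independence can be used.\<close>

lemma prod_top_eq_sum:
  fixes f :: "'i \<Rightarrow> 'c :: comm_semiring_1"
  assumes I: "finite I" and inj: "inj_on r I" and k: "1 \<le> k" "k \<le> card I"
  shows "(\<Prod>l\<in>I. if card (above I r (r l)) < k then f l else 1)
    = (\<Sum>(j, S)\<in>top_pairs I k. f j * (\<Prod>l\<in>I - {j}. if l \<in> S then f l * of_bool (r j < r l) else of_bool (r l < r j)))"
proof -
  obtain j where j: "j \<in> I" "card (above I r (r j)) = k - 1" using ex_rank[OF assms] by blast
  define S where "S = above I r (r j)"
  have S: "S \<subseteq> I - {j}" "card S = k - 1" "finite S" using j I by (auto simp: S_def above_def)
  have rank: "card (above I r (r l)) < k \<longleftrightarrow> l \<in> insert j S" if "l \<in> I" for l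
  proof (cases "r l" "r j" rule: linorder_cases)
    case less
    then have "insert j S \<subseteq> above I r (r l)" using j by (auto simp: S_def above_def)
    then have "card (insert j S) \<le> card (above I r (r l))" using I by (intro card_mono) (auto simp: above_def)
    moreover have "card (insert j S) = k" using S k by (subst card_insert_disjoint) auto
    ultimately show ?thesis using less by (auto simp: S_def above_def)
  next
    case equal
    then have "l = j" using inj that j by (auto dest: inj_onD)
    then show ?thesis using j k by simp
  next
    case greater
    then have "above I r (r l) \<subseteq> S" by (auto simp: S_def above_def)
    then have "card (above I r (r l)) \<le> k - 1" using S by (metis card_mono)
    then show ?thesis using greater k that by (auto simp: S_def above_def)
  qed
  have "(\<Sum>(j', S')\<in>top_pairs I k. f j' * (\<Prod>l\<in>I - {j'}. if l \<in> S' then f l * of_bool (r j' < r l) else of_bool (r l < r j')))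
     = (\<Sum>p\<in>top_pairs I k. if p = (j, S) then f j * (\<Prod>l\<in>S. f l) else 0)"
  proof (rule sum.cong[OF refl], safe, goal_cases)
    case (1 j' S')
    then have p: "j' \<in> I" "S' \<subseteq> I - {j'}" "card S' = k - 1" by (auto simp: top_pairs_def)
    show ?case
    proof (cases "(j', S') = (j, S)")
      case True
      have "(\<Prod>l\<in>I - {j}. if l \<in> S then f l * of_bool (r j < r l) else of_bool (r l < r j)) = (\<Prod>l\<in>I - {j}. if l \<in> S then f l else 1)"
      proof (rule prod.cong[OF refl])
        fix l assume l: "l \<in> I - {j}"
        then have "r l \<noteq> r j" using inj j by (auto dest: inj_onD)
        then show "(if l \<in> S then f l * of_bool (r j < r l) else of_bool (r l < r j)) = (if l \<in> S then f l else 1)"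
          using l by (auto simp: S_def above_def)
      qed
      also have "\<dots> = (\<Prod>l\<in>S. f l)" using S I by (subst prod.inter_restrict[symmetric]) (auto intro!: prod.cong)
      finally have "(\<Prod>l\<in>I - {j}. if l \<in> S then f l * of_bool (r j < r l) else of_bool (r l < r j)) = (\<Prod>l\<in>S. f l)" .
      moreover have "j' = j" "S' = S" using True by auto
      ultimately show ?thesis by (simp only: if_True refl)
    next
      case False
      \<comment> \<open>If no factor vanished, \<open>S'\<close> would be exactly the set above
        \<open>r j'\<close>; since it has \<open>k - 1\<close> elements, \<open>j'\<close> would
        have the same rank as \<open>j\<close>, and the pairs would coincide.\<close>
      have "\<exists>l\<in>I - {j'}. (if l \<in> S' then f l * of_bool (r j' < r l) else of_bool (r l < r j')) = 0"
      proof (rule ccontr)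
        assume "\<not> ?thesis"
        then have nz: "(if l \<in> S' then f l * of_bool (r j' < r l) else of_bool (r l < r j')) \<noteq> 0" if "l \<in> I - {j'}" for l
          using that by blast
        have "r j' < r l" if "l \<in> S'" for l using nz[of l] that subsetD[OF p(2), of l] by (auto simp: of_bool_def split: if_splits)
        moreover have "r l < r j'" if "l \<in> I - {j'}" "l \<notin> S'" for l using nz[of l] that by (auto simp: of_bool_def split: if_splits)
        ultimately have S': "S' = above I r (r j')" using p by (force simp: above_def)
        have "j' = j"
        proof (rule ccontr)
          assume "j' \<noteq> j"
          then consider "r j < r j'" | "r j' < r j" using inj p j by (metis inj_onD linorder_neqE)
          then show False
          proof cases
            case 1
            then have "insert j' S' \<subseteq> S" using p by (auto simp: S' S_def above_def)
            then have "card (insert j' S') \<le> card S" using S by (intro card_mono)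
            moreover have "card (insert j' S') = Suc (card S')" using p I by (subst card_insert_disjoint) (auto intro: finite_subset)
            ultimately show False using p S by simp
          next
            case 2
            then have "insert j S \<subseteq> S'" using j by (auto simp: S' S_def above_def)
            then have "card (insert j S) \<le> card S'" using p I by (intro card_mono) (auto intro: finite_subset)
            moreover have "card (insert j S) = Suc (card S)" using S by (subst card_insert_disjoint) auto
            ultimately show False using p S by simp
          qed
        qed
        then show False using False S' S_def by simp
      qed
      then have "(\<Prod>l\<in>I - {j'}. if l \<in> S' then f l * of_bool (r j' < r l) else of_bool (r l < r j')) = 0"
        using I by (intro prod_zero) auto
      then show ?thesis using False by auto
    qed
  qed
  also have "\<dots> = f j * (\<Prod>l\<in>S. f l)"
    using finite_top_pairs[OF I] j S by (subst sum.delta) (auto simp: top_pairs_def)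
  also have "\<dots> = (\<Prod>l\<in>insert j S. f l)" using S by (subst prod.insert) auto
  also have "\<dots> = (\<Prod>l\<in>I. if l \<in> insert j S then f l else 1)"
    using S I j by (subst prod.inter_restrict[symmetric]) (auto intro!: prod.cong)
  also have "\<dots> = (\<Prod>l\<in>I. if card (above I r (r l)) < k then f l else 1)"
    using rank by (intro prod.cong) auto
  finally show ?thesis by simp
qed

section \<open>Integrals of products over the largest observations\<close>

context prob_space begin

text \<open>For a pair of indices, integrating over the coordinate \<open>i\<close> first leaves a
  single level of \<open>r\<close>, which is a null set.\<close>

lemma AE_inj_on_PiM:
  assumes r[measurable]: "r \<in> borel_measurable M" and atomless: "\<And>t::real. prob {x \<in> space M. r x = t} = 0"
    and I: "finite I"
  shows "AE w in PiM I (\<lambda>_. M). inj_on (\<lambda>l. r (w l)) I"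
proof -
  interpret P: product_prob_space "\<lambda>_. M" I by unfold_locales
  have "AE w in PiM I (\<lambda>_. M). r (w i) \<noteq> r (w j)" if ij: "i \<in> I" "j \<in> I" "i \<noteq> j" for i j
  proof -
    define B where "B = {w \<in> space (PiM I (\<lambda>_. M)). r (w i) = r (w j)}"
    have [measurable]: "(\<lambda>w. w i) \<in> measurable (PiM I (\<lambda>_. M)) M" "(\<lambda>w. w j) \<in> measurable (PiM I (\<lambda>_. M)) M"
      using ij by (auto intro: measurable_component_singleton)
    have B: "B \<in> sets (PiM I (\<lambda>_. M))" unfolding B_def by measurable
    have ins: "insert i (I - {i}) = I" using ij by auto
    have "measure (PiM I (\<lambda>_. M)) B = (\<integral>w. indicat_real B w \<partial>PiM I (\<lambda>_. M))" using B by simp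
    also have "\<dots> = (\<integral>w. \<integral>y. indicat_real B (w(i := y)) \<partial>M \<partial>PiM (I - {i}) (\<lambda>_. M))"
      using P.product_integral_insert[of "I - {i}" i "indicat_real B"] I B ins
      by (simp add: integrable_real_indicator P.P.emeasure_eq_measure)
    also have "\<dots> = (\<integral>w. 0 \<partial>PiM (I - {i}) (\<lambda>_. M))"
    proof (rule Bochner_Integration.integral_cong[OF refl])
      fix w assume w: "w \<in> space (PiM (I - {i}) (\<lambda>_. M))"
      have "(\<integral>y. indicat_real B (w(i := y)) \<partial>M) = (\<integral>y. indicat_real {y \<in> space M. r y = r (w j)} y \<partial>M)"
      proof (rule Bochner_Integration.integral_cong[OF refl])
        fix y assume y: "y \<in> space M"
        have "w(i := y) \<in> space (PiM I (\<lambda>_. M))"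
          using w y ij by (auto simp: space_PiM PiE_iff extensional_def)
        then show "indicat_real B (w(i := y)) = indicat_real {y \<in> space M. r y = r (w j)} y"
          using y ij by (auto simp: B_def indicator_def)
      qed
      also have "\<dots> = 0" using atomless by simp
      finally show "(\<integral>y. indicat_real B (w(i := y)) \<partial>M) = 0" .
    qed
    finally have "measure (PiM I (\<lambda>_. M)) B = 0" by simp
    then have "emeasure (PiM I (\<lambda>_. M)) B = 0" by (simp add: P.P.emeasure_eq_measure)
    then show ?thesis using B by (intro AE_I[of _ _ B]) (auto simp: B_def)
  qed
  then have "AE w in PiM I (\<lambda>_. M). \<forall>i\<in>I. \<forall>j\<in>I. i \<noteq> j \<longrightarrow> r (w i) \<noteq> r (w j)"
    using I by (auto simp: AE_finite_all)
  then show ?thesis by eventually_elim (auto simp: inj_on_def)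
qed

text \<open>The coordinate \<open>j\<close> is held fixed and the others are integrated out: the
  product then splits into one tail integral for each index in \<open>S\<close> and one probability
  for each of the \<open>card I - 1 - card S\<close> remaining indices.\<close>

lemma integral_top_pair:
  fixes \<psi> :: "'a \<Rightarrow> complex" and r :: "'a \<Rightarrow> real"
  assumes r[measurable]: "r \<in> borel_measurable M" and \<psi>[measurable]: "\<psi> \<in> borel_measurable M"
    and bd: "\<And>x. norm (\<psi> x) \<le> C" and I: "finite I" and p: "j \<in> I" "S \<subseteq> I - {j}"
  shows "(\<integral>w. \<psi> (w j) * (\<Prod>l\<in>I - {j}. if l \<in> S then \<psi> (w l) * of_bool (r (w j) < r (w l)) else of_bool (r (w l) < r (w j)))
            \<partial>PiM I (\<lambda>_. M))
    = (\<integral>x. \<psi> x * (\<integral>y. \<psi> y * of_bool (r x < r y) \<partial>M) ^ card S * complex_of_real (prob {y \<in> space M. r y < r x}) ^ (card I - 1 - card S) \<partial>M)"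
    (is "?L = ?R")
    and "integrable (PiM I (\<lambda>_. M)) (\<lambda>w. \<psi> (w j) * (\<Prod>l\<in>I - {j}. if l \<in> S then \<psi> (w l) * of_bool (r (w j) < r (w l)) else of_bool (r (w l) < r (w j))))"
    (is "integrable _ ?T")
proof -
  interpret P: product_prob_space "\<lambda>_. M" I by unfold_locales
  have C0: "0 \<le> C" using bd order_trans norm_ge_zero by blast
  have C1: "0 \<le> max C 1" by simp
  have fm: "(\<lambda>w. if l \<in> S then \<psi> (w l) * of_bool (r (w j) < r (w l)) else of_bool (r (w l) < r (w j))) \<in> borel_measurable (PiM I (\<lambda>_. M))"
    if "l \<in> I" for l
  proof -
    have lj: "(\<lambda>w. w l) \<in> measurable (PiM I (\<lambda>_. M)) M" "(\<lambda>w. w j) \<in> measurable (PiM I (\<lambda>_. M)) M"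
      using that p by (auto intro: measurable_component_singleton)
    note comp = measurable_compose[OF lj(1) r] measurable_compose[OF lj(2) r] measurable_compose[OF lj(1) \<psi>]
    have "(\<lambda>w. \<psi> (w l) * (if r (w j) < r (w l) then 1 else 0)) \<in> borel_measurable (PiM I (\<lambda>_. M))"
      "(\<lambda>w. (if r (w l) < r (w j) then 1 else 0) :: complex) \<in> borel_measurable (PiM I (\<lambda>_. M))"
      by (intro borel_measurable_times measurable_If borel_measurable_const comp(3)
          borel_measurable_less[OF comp(1,2)] borel_measurable_less[OF comp(2,1)])+
    then show ?thesis by (cases "l \<in> S") (simp_all add: of_bool_def)
  qed
  have bdT: "norm (?T w) \<le> C * (max C 1) ^ card (I - {j})" for w
    unfolding norm_mult
  proof (rule mult_mono)
    have "norm (\<Prod>l\<in>I - {j}. if l \<in> S then \<psi> (w l) * of_bool (r (w j) < r (w l)) else of_bool (r (w l) < r (w j))) \<le> (\<Prod>l\<in>I - {j}. max C 1)"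
      unfolding prod_norm[symmetric]
      by (rule prod_mono) (auto simp: norm_mult of_bool_def le_max_iff_disj bd)
    then show "norm (\<Prod>l\<in>I - {j}. if l \<in> S then \<psi> (w l) * of_bool (r (w j) < r (w l)) else of_bool (r (w l) < r (w j))) \<le> (max C 1) ^ card (I - {j})"
      by simp
  qed (use bd C0 in auto)
  have "?T \<in> borel_measurable (PiM I (\<lambda>_. M))"
    using p by (intro borel_measurable_times borel_measurable_prod fm) auto
  then show int: "integrable (PiM I (\<lambda>_. M)) ?T"
    by (intro P.P.integrable_const_bound[OF AE_I2[OF bdT]])
  have UN: "{j} \<union> (I - {j}) = I" using p by auto
  have "?L = (\<integral>x. \<integral>y. ?T (merge {j} (I - {j}) (x, y)) \<partial>PiM (I - {j}) (\<lambda>_. M) \<partial>PiM {j} (\<lambda>_. M))"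
    using P.product_integral_fold[of "{j}" "I - {j}" ?T] I int unfolding UN by auto
  also have "\<dots> = (\<integral>x. (\<lambda>z. \<psi> z * (\<integral>y. \<psi> y * of_bool (r z < r y) \<partial>M) ^ card S * complex_of_real (prob {y \<in> space M. r y < r z}) ^ (card I - 1 - card S)) (x j) \<partial>PiM {j} (\<lambda>_. M))"
  proof (rule Bochner_Integration.integral_cong[OF refl])
    fix x assume "x \<in> space (PiM {j} (\<lambda>_. M))"
    have "(\<integral>y. ?T (merge {j} (I - {j}) (x, y)) \<partial>PiM (I - {j}) (\<lambda>_. M))
      = (\<integral>y. \<psi> (x j) * (\<Prod>l\<in>I - {j}. if l \<in> S then \<psi> (y l) * of_bool (r (x j) < r (y l)) else of_bool (r (y l) < r (x j))) \<partial>PiM (I - {j}) (\<lambda>_. M))"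
      by (intro Bochner_Integration.integral_cong[OF refl] arg_cong2[of _ _ _ _ "(*)"] prod.cong) (auto simp: merge_def)
    also have "\<dots> = \<psi> (x j) * (\<integral>y. (\<Prod>l\<in>I - {j}. (\<lambda>l y. if l \<in> S then \<psi> y * of_bool (r (x j) < r y) else of_bool (r y < r (x j))) l (y l)) \<partial>PiM (I - {j}) (\<lambda>_. M))"
      by simp
    also have "(\<integral>y. (\<Prod>l\<in>I - {j}. (\<lambda>l y. if l \<in> S then \<psi> y * of_bool (r (x j) < r y) else of_bool (r y < r (x j))) l (y l)) \<partial>PiM (I - {j}) (\<lambda>_. M))
       = (\<Prod>l\<in>I - {j}. \<integral>y. (if l \<in> S then \<psi> y * of_bool (r (x j) < r y) else of_bool (r y < r (x j))) \<partial>M)"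
    proof (rule P.product_integral_prod)
      show "integrable M (\<lambda>y. if l \<in> S then \<psi> y * of_bool (r (x j) < r y) else of_bool (r y < r (x j)))" for l
        by (rule integrable_const_bound[where B="max C 1"]) (auto simp: norm_mult of_bool_def le_max_iff_disj bd)
    qed (use I in auto)
    also have "\<dots> = (\<Prod>l\<in>I - {j}. if l \<in> S then (\<integral>y. \<psi> y * of_bool (r (x j) < r y) \<partial>M) else complex_of_real (prob {y \<in> space M. r y < r (x j)}))"
    proof (rule prod.cong[OF refl])
      fix l
      have "(\<integral>y. of_bool (r y < r (x j)) \<partial>M) = (\<integral>y. complex_of_real (indicat_real {y \<in> space M. r y < r (x j)} y) \<partial>M)"
        by (intro Bochner_Integration.integral_cong) (auto simp: indicator_def)
      also have "\<dots> = complex_of_real (prob {y \<in> space M. r y < r (x j)})"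
        by (subst integral_complex_of_real) simp
      finally show "(\<integral>y. (if l \<in> S then \<psi> y * of_bool (r (x j) < r y) else of_bool (r y < r (x j))) \<partial>M) =
        (if l \<in> S then (\<integral>y. \<psi> y * of_bool (r (x j) < r y) \<partial>M) else complex_of_real (prob {y \<in> space M. r y < r (x j)}))"
        by simp
    qed
    also have "\<dots> = (\<integral>y. \<psi> y * of_bool (r (x j) < r y) \<partial>M) ^ card S * complex_of_real (prob {y \<in> space M. r y < r (x j)}) ^ (card I - 1 - card S)"
    proof -
      have 1: "(I - {j}) \<inter> S = S" and 2: "(I - {j}) \<inter> - S = I - {j} - S" using p by auto
      have "card (I - {j} - S) = card I - 1 - card S"
        using p I finite_subset[OF p(2)] by (subst card_Diff_subset) auto
      then show ?thesis using I by (subst prod.If_cases) (simp_all add: 1 2)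
    qed
    finally show "(\<integral>y. ?T (merge {j} (I - {j}) (x, y)) \<partial>PiM (I - {j}) (\<lambda>_. M))
      = (\<lambda>z. \<psi> z * (\<integral>y. \<psi> y * of_bool (r z < r y) \<partial>M) ^ card S * complex_of_real (prob {y \<in> space M. r y < r z}) ^ (card I - 1 - card S)) (x j)"
      by (simp add: mult.assoc)
  qed
  also have "\<dots> = ?R"
    by (rule P.product_integral_singleton) measurable
  finally show "?L = ?R" .
qed

text \<open>By symmetry every pair \<open>(j, S)\<close> contributes the same integral, so the sum
  over pairs becomes their number times this integral.\<close>

theorem integral_prod_top:
  fixes \<psi> :: "'a \<Rightarrow> complex"
  assumes r[measurable]: "r \<in> borel_measurable M" and atomless: "\<And>t::real. prob {x \<in> space M. r x = t} = 0"
    and \<psi>[measurable]: "\<psi> \<in> borel_measurable M" and bd: "\<And>x. norm (\<psi> x) \<le> C"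
    and I: "finite I" and k: "1 \<le> k" "k \<le> card I"
  shows "(\<integral>w. (\<Prod>l\<in>I. if card (above I (\<lambda>m. r (w m)) (r (w l))) < k then \<psi> (w l) else 1) \<partial>PiM I (\<lambda>_. M))
    = of_nat (card I * (card I - 1 choose (k - 1)))
        * (\<integral>x. \<psi> x * (\<integral>y. \<psi> y * of_bool (r x < r y) \<partial>M) ^ (k - 1) * complex_of_real (prob {y \<in> space M. r y < r x}) ^ (card I - k) \<partial>M)"
proof -
  define T where "T = (\<lambda>(j, S) w. \<psi> (w j) * (\<Prod>l\<in>I - {j}. if l \<in> S then \<psi> (w l) * of_bool (r (w j) < r (w l)) else of_bool (r (w l) < r (w j))))"
  have T: "integrable (PiM I (\<lambda>_. M)) (T p)" 
    "(\<integral>w. T p w \<partial>PiM I (\<lambda>_. M)) = (\<integral>x. \<psi> x * (\<integral>y. \<psi> y * of_bool (r x < r y) \<partial>M) ^ (k - 1) * complex_of_real (prob {y \<in> space M. r y < r x}) ^ (card I - k) \<partial>M)"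
    if "p \<in> top_pairs I k" for p
  proof -
    obtain j S where p: "p = (j, S)" "j \<in> I" "S \<subseteq> I - {j}" "card S = k - 1" using \<open>p \<in> top_pairs I k\<close> by (auto simp: top_pairs_def)
    show "integrable (PiM I (\<lambda>_. M)) (T p)"
      using integral_top_pair(2)[OF r \<psi> bd I p(2,3)] by (simp add: T_def p)
    have "card I - 1 - card S = card I - k" using p k by simp
    then show "(\<integral>w. T p w \<partial>PiM I (\<lambda>_. M)) = (\<integral>x. \<psi> x * (\<integral>y. \<psi> y * of_bool (r x < r y) \<partial>M) ^ (k - 1) * complex_of_real (prob {y \<in> space M. r y < r x}) ^ (card I - k) \<partial>M)"
      using integral_top_pair(1)[OF r \<psi> bd I p(2,3)] p(4) by (simp add: T_def p(1))
  qed
  have [measurable]: "(\<lambda>w. w l) \<in> measurable (PiM I (\<lambda>_. M)) M" if "l \<in> I" for l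
    using that by (rule measurable_component_singleton)
  have card: "real (card (above I (\<lambda>m. r (w m)) v)) = (\<Sum>m\<in>I. of_bool (v < r (w m)))" for w v
    using I by (simp add: above_def of_bool_def sum.If_cases Int_def)
  have cm: "(\<lambda>w. if card (above I (\<lambda>m. r (w m)) (r (w l))) < k then \<psi> (w l) else 1) \<in> borel_measurable (PiM I (\<lambda>_. M))" if "l \<in> I" for l
  proof -
    have "Measurable.pred (PiM I (\<lambda>_. M)) (\<lambda>w. real (card (above I (\<lambda>m. r (w m)) (r (w l)))) < real k)"
      unfolding card using that by measurable
    then have [measurable]: "Measurable.pred (PiM I (\<lambda>_. M)) (\<lambda>w. card (above I (\<lambda>m. r (w m)) (r (w l))) < k)" by simp
    show ?thesis using that by measurable
  qed
  have "(\<integral>w. (\<Prod>l\<in>I. if card (above I (\<lambda>m. r (w m)) (r (w l))) < k then \<psi> (w l) else 1) \<partial>PiM I (\<lambda>_. M))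
     = (\<integral>w. (\<Sum>p\<in>top_pairs I k. T p w) \<partial>PiM I (\<lambda>_. M))"
  proof (rule integral_cong_AE)
    show "AE w in PiM I (\<lambda>_. M). (\<Prod>l\<in>I. if card (above I (\<lambda>m. r (w m)) (r (w l))) < k then \<psi> (w l) else 1) = (\<Sum>p\<in>top_pairs I k. T p w)"
      using AE_inj_on_PiM[OF r atomless I]
      by eventually_elim (simp add: T_def prod_top_eq_sum[OF I _ k] case_prod_unfold)
  qed (use T cm in \<open>auto intro!: borel_measurable_prod borel_measurable_sum borel_measurable_integrable\<close>)
  also have "\<dots> = (\<Sum>p\<in>top_pairs I k. \<integral>w. T p w \<partial>PiM I (\<lambda>_. M))" by (rule Bochner_Integration.integral_sum) (rule T)
  also have "\<dots> = of_nat (card (top_pairs I k)) * (\<integral>x. \<psi> x * (\<integral>y. \<psi> y * of_bool (r x < r y) \<partial>M) ^ (k - 1) * complex_of_real (prob {y \<in> space M. r y < r x}) ^ (card I - k) \<partial>M)"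
    using T(2) by simp
  finally show ?thesis using card_top_pairs[OF I] by simp
qed

end

section \<open>Powers of complex numbers close to 1\<close>

lemma norm_power_diff_le:
  fixes x y :: complex
  assumes "norm x \<le> c" "norm y \<le> c"
  shows "norm (x ^ m - y ^ m) \<le> real m * c ^ (m - 1) * norm (x - y)"
proof (induction m)
  case (Suc m)
  have c: "0 \<le> c" using assms norm_ge_zero order_trans by blast
  have "x ^ Suc m - y ^ Suc m = x * (x ^ m - y ^ m) + (x - y) * y ^ m" by (simp add: algebra_simps)
  then have "norm (x ^ Suc m - y ^ Suc m) \<le> norm x * norm (x ^ m - y ^ m) + norm (x - y) * norm y ^ m"
    by (metis norm_mult norm_power norm_triangle_ineq)
  also have "\<dots> \<le> c * (real m * c ^ (m - 1) * norm (x - y)) + norm (x - y) * c ^ m"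
    by (intro add_mono mult_mono power_mono Suc.IH assms mult_left_mono mult_nonneg_nonneg) (use c in auto)
  also have "\<dots> = real (Suc m) * c ^ (Suc m - 1) * norm (x - y)"
    by (cases m) (simp_all add: algebra_simps)
  finally show ?case .
qed simp

text \<open>Comparison of the m-th powers of 1 + b and exp b: the bases differ by O(|b|^2) and |b|
  is of order 1/m, so the powers differ by O(1/m). No complex logarithm is involved. The filter is
  arbitrary because the lemma is applied along pairs of a sample size and a point.\<close>

lemma tendsto_one_plus_power:
  fixes b :: "'x \<Rightarrow> complex" and m :: "'x \<Rightarrow> nat"
  assumes m: "filterlim m at_top F" and b: "((\<lambda>x. of_nat (m x) * b x) \<longlongrightarrow> z) F"
  shows "((\<lambda>x. (1 + b x) ^ m x) \<longlongrightarrow> exp z) F"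
proof -
  have rm: "filterlim (\<lambda>x. real (m x)) at_top F" by (rule filterlim_compose[OF filterlim_real_sequentially m])
  have inv: "((\<lambda>x. 1 / real (m x)) \<longlongrightarrow> 0) F" by (rule tendsto_divide_0[OF tendsto_const]) (rule filterlim_at_top_imp_at_infinity[OF rm])
  have pos: "eventually (\<lambda>x. 0 < m x) F" using m by (rule eventually_compose_filterlim[OF eventually_gt_at_top])
  have b0: "((\<lambda>x. norm (b x)) \<longlongrightarrow> 0) F"
  proof -
    have "((\<lambda>x. norm (of_nat (m x) * b x) * (1 / real (m x))) \<longlongrightarrow> norm z * 0) F"
      by (intro tendsto_intros b inv)
    then have "((\<lambda>x. norm (of_nat (m x) * b x) * (1 / real (m x))) \<longlongrightarrow> 0) F" by simp
    then show ?thesis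
      by (rule Lim_transform_eventually) (use pos in eventually_elim, simp add: norm_mult)
  qed
  define D where "D x = exp (norm (of_nat (m x) * b x)) * (exp (norm (b x)) * (norm (of_nat (m x) * b x))\<^sup>2 * (1 / real (m x)))" for x
  have "(D \<longlongrightarrow> exp (norm z) * (exp 0 * (norm z)\<^sup>2 * 0)) F"
    unfolding D_def by (intro tendsto_intros b inv b0)
  then have D: "(D \<longlongrightarrow> 0) F" by simp
  have "((\<lambda>x. (1 + b x) ^ m x - exp (of_nat (m x) * b x)) \<longlongrightarrow> 0) F"
  proof (rule Lim_null_comparison[OF _ D])
    show "eventually (\<lambda>x. norm ((1 + b x) ^ m x - exp (of_nat (m x) * b x)) \<le> D x) F"
      using pos
    proof eventually_elim
      case (elim x)
      have 1: "norm (1 + b x) \<le> exp (norm (b x))"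
        using norm_triangle_ineq[of 1 "b x"] exp_ge_add_one_self[of "norm (b x)"] unfolding norm_one by linarith
      have 2: "norm (exp (b x)) \<le> exp (norm (b x))" by (rule norm_exp)
      have "norm ((1 + b x) ^ m x - exp (b x) ^ m x)
         \<le> real (m x) * exp (norm (b x)) ^ (m x - 1) * norm (1 + b x - exp (b x))"
        by (rule norm_power_diff_le[OF 1 2])
      also have "\<dots> \<le> real (m x) * exp (norm (b x)) ^ m x * (exp (norm (b x)) * (norm (b x))\<^sup>2)"
      proof (intro mult_mono power_increasing)
        show "norm (1 + b x - exp (b x)) \<le> exp (norm (b x)) * (norm (b x))\<^sup>2"
          using Taylor_exp_field[of "b x" 1] by (simp add: norm_minus_commute power2_eq_square)
      qed auto
      also have "exp (norm (b x)) ^ m x = exp (norm (of_nat (m x) * b x))"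
        by (simp add: norm_mult exp_of_nat_mult)
      also have "real (m x) * exp (norm (of_nat (m x) * b x)) * (exp (norm (b x)) * (norm (b x))\<^sup>2) = D x"
        using elim by (simp add: D_def norm_mult power_mult_distrib) (simp add: power2_eq_square)
      finally show ?case by (simp add: exp_of_nat_mult)
    qed
  qed
  from tendsto_add[OF this tendsto_exp[OF b]] show ?thesis by simp
qed

section \<open>The beta law of the tail probability at the k-th largest value\<close>

context prob_space begin

definition tail :: "('a \<Rightarrow> real) \<Rightarrow> real \<Rightarrow> real" where
  "tail r t = prob {x \<in> space M. t < r x}"

text \<open>The density, with respect to the law of a single observation, of the observation whose \<open>r\<close>-value is
  the \<open>k\<close>-th largest of \<open>n\<close> independent ones.\<close>

definition order_density :: "('a \<Rightarrow> real) \<Rightarrow> nat \<Rightarrow> nat \<Rightarrow> 'a \<Rightarrow> real" where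
  "order_density r n k x = real (n * (n - 1 choose (k - 1))) * tail r (r x) ^ (k - 1) * (1 - tail r (r x)) ^ (n - k)"

lemma tail_bounds: "0 \<le> tail r t" "tail r t \<le> 1" by (auto simp: tail_def)

lemma tail_antimono: "r \<in> borel_measurable M \<Longrightarrow> s \<le> t \<Longrightarrow> tail r t \<le> tail r s"
  unfolding tail_def by (intro finite_measure_mono) auto

lemma order_density_nonneg: "0 \<le> order_density r n k x"
  by (simp add: order_density_def tail_bounds)

lemma tail_measurable[measurable]: "r \<in> borel_measurable M \<Longrightarrow> (\<lambda>t. tail r t) \<in> borel_measurable borel"
  using borel_measurable_uminus[OF borel_measurable_mono, of "\<lambda>t. - tail r t"] by (auto simp: mono_def intro: tail_antimono)

lemma order_density_measurable[measurable]:
  assumes r: "r \<in> borel_measurable M"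
  shows "order_density r n k \<in> borel_measurable M"
proof -
  note [measurable] = measurable_compose[OF r tail_measurable[OF r]]
  show ?thesis unfolding order_density_def[abs_def] by measurable
qed

lemma order_density_integrable: 
  assumes [measurable]: "r \<in> borel_measurable M" and f[measurable]: "f \<in> borel_measurable M" and bd: "\<And>x. norm (f x) \<le> C"
  shows "integrable M (\<lambda>x. order_density r n k x *\<^sub>R (f x :: 'b::{banach, second_countable_topology}))"
proof (rule integrable_const_bound[where B="real (n * (n - 1 choose (k - 1))) * C"])
  show "AE x in M. norm (order_density r n k x *\<^sub>R f x) \<le> real (n * (n - 1 choose (k - 1))) * C"
  proof (rule AE_I2)
    fix x
    have "tail r (r x) ^ (k - 1) * (1 - tail r (r x)) ^ (n - k) \<le> 1 * 1"
      by (intro mult_mono power_le_one) (auto simp: tail_bounds)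
    then have "order_density r n k x \<le> real (n * (n - 1 choose (k - 1)))"
      unfolding order_density_def mult.assoc[of "real _"] by (intro mult_left_le) auto
    then show "norm (order_density r n k x *\<^sub>R f x) \<le> real (n * (n - 1 choose (k - 1))) * C"
      using bd[of x] by (auto simp: order_density_nonneg intro!: mult_mono)
  qed
qed measurable

context
  fixes r :: "'a \<Rightarrow> real"
  assumes r[measurable]: "r \<in> borel_measurable M" and atomless: "\<And>t. prob {x \<in> space M. r x = t} = 0"
begin

lemma prob_less_eq: "prob {x \<in> space M. r x < t} = 1 - tail r t"
proof -
  have "{x \<in> space M. r x < t} \<union> {x \<in> space M. r x = t} = space M - {x \<in> space M. t < r x}" by auto
  then have "prob ({x \<in> space M. r x < t} \<union> {x \<in> space M. r x = t}) = 1 - tail r t"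
    by (simp add: tail_def prob_compl)
  moreover have "prob ({x \<in> space M. r x < t} \<union> {x \<in> space M. r x = t}) = prob {x \<in> space M. r x < t} + prob {x \<in> space M. r x = t}"
    by (intro finite_measure_Union) auto
  ultimately show ?thesis using atomless by simp
qed

text \<open>Each tail integral of \<open>\<psi>\<close> is written as a conditional mean times the
  tail probability; the powers of the latter go into the density. Where the tail vanishes the tail
  integral vanishes as well, so the convention for division by 0 is harmless.\<close>

lemma integral_prod_top_density:
  fixes \<psi> :: "'a \<Rightarrow> complex"
  assumes \<psi>[measurable]: "\<psi> \<in> borel_measurable M" and bd: "\<And>x. norm (\<psi> x) \<le> C"
    and I: "finite I" and k: "1 \<le> k" "k \<le> card I"
  shows "(\<integral>w. (\<Prod>l\<in>I. if card (above I (\<lambda>m. r (w m)) (r (w l))) < k then \<psi> (w l) else 1) \<partial>PiM I (\<lambda>_. M))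
    = (\<integral>x. order_density r (card I) k x *\<^sub>R (\<psi> x * ((\<integral>y. \<psi> y * of_bool (r x < r y) \<partial>M) / tail r (r x)) ^ (k - 1)) \<partial>M)"
proof -
  have A0: "(\<integral>y. \<psi> y * of_bool (t < r y) \<partial>M) = 0" if "tail r t = 0" for t
  proof -
    have "emeasure M {x \<in> space M. t < r x} = 0" using that by (simp add: tail_def emeasure_eq_measure)
    then have "AE x in M. x \<notin> {x \<in> space M. t < r x}" by (intro AE_not_in) (auto simp: null_sets_def)
    then have "AE x in M. \<psi> x * of_bool (t < r x) = 0" by (rule AE_mp) (auto intro!: AE_I2 simp: of_bool_def)
    moreover have "(\<lambda>x. \<psi> x * (if t < r x then 1 else 0)) \<in> borel_measurable M" by measurable
    ultimately show ?thesis by (subst integral_cong_AE[of _ _ "\<lambda>_. 0"]) (auto simp: of_bool_def)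
  qed
  have eq: "(\<integral>y. \<psi> y * of_bool (r x < r y) \<partial>M) = (\<integral>y. \<psi> y * of_bool (r x < r y) \<partial>M) / tail r (r x) * tail r (r x)" for x
    using A0[of "r x"] by (cases "tail r (r x) = 0") auto
  have "(\<integral>w. (\<Prod>l\<in>I. if card (above I (\<lambda>m. r (w m)) (r (w l))) < k then \<psi> (w l) else 1) \<partial>PiM I (\<lambda>_. M))
    = (\<integral>x. of_nat (card I * (card I - 1 choose (k - 1))) * (\<psi> x * (\<integral>y. \<psi> y * of_bool (r x < r y) \<partial>M) ^ (k - 1) * complex_of_real (prob {y \<in> space M. r y < r x}) ^ (card I - k)) \<partial>M)"
    using integral_prod_top[OF r atomless \<psi> bd I k] by simp
  also have "\<dots> = (\<integral>x. order_density r (card I) k x *\<^sub>R (\<psi> x * ((\<integral>y. \<psi> y * of_bool (r x < r y) \<partial>M) / tail r (r x)) ^ (k - 1)) \<partial>M)"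
  proof (rule Bochner_Integration.integral_cong[OF refl])
    fix x
    have "(\<integral>y. \<psi> y * of_bool (r x < r y) \<partial>M) ^ (k - 1) = ((\<integral>y. \<psi> y * of_bool (r x < r y) \<partial>M) / tail r (r x)) ^ (k - 1) * complex_of_real (tail r (r x)) ^ (k - 1)"
      by (subst eq) (rule power_mult_distrib)
    then show "of_nat (card I * (card I - 1 choose (k - 1))) * (\<psi> x * (\<integral>y. \<psi> y * of_bool (r x < r y) \<partial>M) ^ (k - 1) * complex_of_real (prob {y \<in> space M. r y < r x}) ^ (card I - k))
      = order_density r (card I) k x *\<^sub>R (\<psi> x * ((\<integral>y. \<psi> y * of_bool (r x < r y) \<partial>M) / tail r (r x)) ^ (k - 1))"
      by (simp add: order_density_def prob_less_eq scaleR_conv_of_real ac_simps)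
  qed
  finally show ?thesis .
qed

text \<open>The product formula for the constant function 1, which spares the computation of a beta
  integral.\<close>

lemma integral_order_density:
  assumes k: "1 \<le> k" "k \<le> n"
  shows "(\<integral>x. order_density r n k x \<partial>M) = 1"
proof -
  interpret P: product_prob_space "\<lambda>_. M" "{..<n}" by unfold_locales
  have "(\<integral>w. (\<Prod>l\<in>{..<n}. if card (above {..<n} (\<lambda>m. r (w m)) (r (w l))) < k then (\<lambda>_. 1 :: complex) (w l) else 1) \<partial>PiM {..<n} (\<lambda>_. M)) = 1"
    using P.P.prob_space by simp
  then have "1 = (\<integral>x. of_nat (n * (n - 1 choose (k - 1))) * (1 * (\<integral>y. 1 * of_bool (r x < r y) \<partial>M) ^ (k - 1) * complex_of_real (prob {y \<in> space M. r y < r x}) ^ (n - k)) \<partial>M)"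
    using integral_prod_top[OF r atomless, of "\<lambda>_. 1" 1 "{..<n}" k] k by simp
  also have "\<dots> = (\<integral>x. complex_of_real (order_density r n k x) \<partial>M)"
  proof (rule Bochner_Integration.integral_cong[OF refl])
    fix x
    have "(\<integral>y. 1 * of_bool (r x < r y) \<partial>M) = (\<integral>y. complex_of_real (indicat_real {y \<in> space M. r x < r y} y) \<partial>M)"
      by (intro Bochner_Integration.integral_cong) (auto simp: indicator_def)
    also have "\<dots> = complex_of_real (tail r (r x))"
      by (subst integral_complex_of_real) (simp add: tail_def)
    finally show "of_nat (n * (n - 1 choose (k - 1))) * (1 * (\<integral>y. 1 * of_bool (r x < r y) \<partial>M) ^ (k - 1) * complex_of_real (prob {y \<in> space M. r y < r x}) ^ (n - k))
      = complex_of_real (order_density r n k x)"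
      by (simp add: order_density_def prob_less_eq ac_simps)
  qed
  also have "\<dots> = complex_of_real (\<integral>x. order_density r n k x \<partial>M)" by (rule integral_complex_of_real)
  finally show ?thesis by (metis of_real_eq_1_iff)
qed

text \<open>As a function of G = \<open>tail r (r x)\<close> this is the beta density with
  parameters k and n - k + 1. A further factor G raises the first parameter by one, which amounts to
  passing from (n, k) to (n + 1, k + 1).\<close>

lemma tail_times_order_density:
  assumes k: "1 \<le> k" "k \<le> n"
  shows "tail r (r x) * order_density r n k x = real k / real (n + 1) * order_density r (n + 1) (k + 1) x"
proof -
  have "k * (n choose k) = n * (n - 1 choose (k - 1))" using k by (simp add: times_binomial_minus1_eq)
  then have *: "real k * real (n choose k) = real (n * (n - 1 choose (k - 1)))" by (metis of_nat_mult)
  have pk: "tail r (r x) ^ k = tail r (r x) * tail r (r x) ^ (k - 1)" using k by (cases k) auto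
  have o1: "order_density r n k x = real k * real (n choose k) * tail r (r x) ^ (k - 1) * (1 - tail r (r x)) ^ (n - k)"
    by (simp only: order_density_def *)
  have o2: "order_density r (n + 1) (k + 1) x = real (n + 1) * real (n choose k) * tail r (r x) ^ k * (1 - tail r (r x)) ^ (n - k)"
    by (simp add: order_density_def distrib_right)
  have cancel: "real k / real (n + 1) * (real (n + 1) * real (n choose k) * y * z) = real k * real (n choose k) * y * z" for y z :: real
  proof -
    have "real k / real (n + 1) * real (n + 1) = real k" by simp
    then show ?thesis by (metis mult.assoc)
  qed
  show ?thesis unfolding o1 o2 cancel pk by (simp only: ac_simps)
qed

text \<open>The product is the j-th moment of the beta law, as integration over \<open>x\<close>
  shows.\<close>

lemma tail_power_order_density:
  assumes k: "1 \<le> k" "k \<le> n"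
  shows "tail r (r x) ^ j * order_density r n k x = (\<Prod>i<j. real (k + i) / real (n + 1 + i)) * order_density r (n + j) (k + j) x"
proof (induction j)
  case (Suc j)
  have "tail r (r x) ^ Suc j * order_density r n k x = tail r (r x) * (tail r (r x) ^ j * order_density r n k x)" by simp
  also have "\<dots> = (\<Prod>i<j. real (k + i) / real (n + 1 + i)) * (tail r (r x) * order_density r (n + j) (k + j) x)"
    unfolding Suc.IH by simp
  also have "\<dots> = (\<Prod>i<Suc j. real (k + i) / real (n + 1 + i)) * order_density r (n + Suc j) (k + Suc j) x"
    using k by (subst tail_times_order_density) (auto simp: ac_simps)
  finally show ?case .
qed simp

text \<open>Markov's inequality for the k-th moment. For i < k each factor (k + i) / (n + 1 + i) of
  the moment is at most 2k/n, and (2k/n)^k against the threshold power (8k/n)^k leaves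
  (1/4)^k.\<close>

lemma order_density_tail_large:
  assumes k: "1 \<le> k" "k \<le> n"
  shows "(\<integral>x. order_density r n k x * of_bool (8 * real k < real n * tail r (r x)) \<partial>M) \<le> (1 / 4) ^ k"
proof -
  have "order_density r n k x * of_bool (8 * real k < real n * tail r (r x)) \<le> (1 / 4) ^ k * order_density r (n + k) (k + k) x" for x
  proof (cases "8 * real k < real n * tail r (r x)")
    case True
    have "1 \<le> (real n * tail r (r x) / (8 * real k)) ^ k"
      using True k by (intro one_le_power) auto
    then have "order_density r n k x \<le> (real n * tail r (r x) / (8 * real k)) ^ k * order_density r n k x"
      using mult_right_mono[OF _ order_density_nonneg] by fastforce
    also have "\<dots> = (real n / (8 * real k)) ^ k * (tail r (r x) ^ k * order_density r n k x)"
      by (simp add: power_divide power_mult_distrib)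
    also have "\<dots> = (real n / (8 * real k)) ^ k * (\<Prod>i<k. real (k + i) / real (n + 1 + i)) * order_density r (n + k) (k + k) x"
      by (simp add: tail_power_order_density[OF k])
    also have "(\<Prod>i<k. real (k + i) / real (n + 1 + i)) \<le> (\<Prod>i<k. 2 * real k / real n)"
      using k by (intro prod_mono conjI frac_le) auto
    also have "(real n / (8 * real k)) ^ k * (\<Prod>i<k. 2 * real k / real n) = (1 / 4) ^ k"
      using k by (simp flip: power_mult_distrib)
    finally show ?thesis using True by (simp add: mult_left_mono mult_right_mono order_density_nonneg)
  next
    case False
    then show ?thesis by (simp add: order_density_nonneg)
  qed
  moreover have "integrable M (\<lambda>x. order_density r n k x * (if 8 * real k < real n * tail r (r x) then 1 else 0))"
    using order_density_integrable[OF r, of "\<lambda>x. if 8 * real k < real n * tail r (r x) then 1 else 0 :: real" 1] by simp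
  moreover have "integrable M (\<lambda>x. (1 / 4) ^ k * order_density r (n + k) (k + k) x)"
    using order_density_integrable[OF r, of "\<lambda>x. 1 :: real" 1] by simp
  ultimately have "(\<integral>x. order_density r n k x * of_bool (8 * real k < real n * tail r (r x)) \<partial>M) \<le> (\<integral>x. (1 / 4) ^ k * order_density r (n + k) (k + k) x \<partial>M)"
    by (intro integral_mono) (auto simp: of_bool_def)
  also have "\<dots> = (1 / 4) ^ k" using k by (simp add: integral_order_density)
  finally show ?thesis .
qed

text \<open>The same argument with a negative moment: the density for (n, k) is compared with the
  one for (n - j, k - j). On the event the j-th power of the tail is below (k / (8n))^j, while the
  constant of the shift is at least ((k - j) / n)^j.\<close>

lemma order_density_tail_small:
  assumes k: "1 \<le> k" "k \<le> n"
  shows "(\<integral>x. order_density r n k x * of_bool (8 * real n * tail r (r x) < real k) \<partial>M) \<le> (1 / 4) ^ (k div 2)"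
proof -
  \<comment> \<open>Half of \<open>k\<close>, so that \<open>k - j\<close> remains at least 1 and
    \<open>k\<close> is at most \<open>2 * (k - j)\<close>; this 2 against the 8 gives the ratio
    1/4.\<close>
  define j where "j = k div 2"
  define p where "p = (\<Prod>i<j. real (k - j + i) / real (n - j + 1 + i))"
  have kj: "1 \<le> k - j" "k - j \<le> n - j" "n - j + j = n" "k - j + j = k" "real k \<le> 2 * real (k - j)" using k by (auto simp: j_def)
  have p: "(real (k - j) / real n) ^ j \<le> p"
  proof -
    have "(\<Prod>i<j. real (k - j) / real n) \<le> p"
      unfolding p_def using kj k by (intro prod_mono conjI frac_le) auto
    then show ?thesis by simp
  qed
  have "order_density r n k x * of_bool (8 * real n * tail r (r x) < real k) \<le> (1 / 4) ^ j * order_density r (n - j) (k - j) x" for x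
  proof (cases "8 * real n * tail r (r x) < real k")
    case True
    have "(real (k - j) / real n) ^ j * order_density r n k x \<le> p * order_density r n k x"
      by (intro mult_right_mono p order_density_nonneg)
    also have "\<dots> = tail r (r x) ^ j * order_density r (n - j) (k - j) x"
      using tail_power_order_density[OF kj(1,2), of x j] unfolding kj(3,4) p_def by simp
    also have "\<dots> \<le> (real k / (8 * real n)) ^ j * order_density r (n - j) (k - j) x"
      using True k by (intro mult_right_mono power_mono order_density_nonneg) (auto simp: tail_bounds field_simps)
    also have "\<dots> \<le> (2 * real (k - j) / (8 * real n)) ^ j * order_density r (n - j) (k - j) x"
      using kj by (intro mult_right_mono power_mono divide_right_mono order_density_nonneg) auto
    also have "\<dots> = (real (k - j) / real n) ^ j * ((1 / 4) ^ j * order_density r (n - j) (k - j) x)"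
      by (simp add: power_divide power_mult_distrib)
    finally show ?thesis using True kj k by (simp add: mult_le_cancel_left_pos)
  next
    case False
    then show ?thesis by (simp add: order_density_nonneg)
  qed
  moreover have "integrable M (\<lambda>x. order_density r n k x * (if 8 * real n * tail r (r x) < real k then 1 else 0))"
    using order_density_integrable[OF r, of "\<lambda>x. if 8 * real n * tail r (r x) < real k then 1 else 0 :: real" 1] by simp
  moreover have "integrable M (\<lambda>x. (1 / 4) ^ j * order_density r (n - j) (k - j) x)"
    using order_density_integrable[OF r, of "\<lambda>x. 1 :: real" 1] by simp
  ultimately have "(\<integral>x. order_density r n k x * of_bool (8 * real n * tail r (r x) < real k) \<partial>M) \<le> (\<integral>x. (1 / 4) ^ j * order_density r (n - j) (k - j) x \<partial>M)"
    by (intro integral_mono) (auto simp: of_bool_def)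
  also have "\<dots> = (1 / 4) ^ j" using kj by (simp add: integral_order_density)
  finally show ?thesis by (simp add: j_def)
qed

end

end

section \<open>Limits of exponential functionals of the largest observations\<close>

lemma measurable_of_bool[measurable]:
  "Measurable.pred M P \<Longrightarrow> (\<lambda>x. of_bool (P x) :: 'b :: {zero_neq_one, topological_space}) \<in> borel_measurable M"
  unfolding of_bool_def by measurable

lemma norm_integral_le_integral:
  fixes f :: "'a \<Rightarrow> 'b::{banach, second_countable_topology}"
  assumes "integrable M f" "integrable M g" "\<And>x. x \<in> space M \<Longrightarrow> norm (f x) \<le> g x"
  shows "norm (\<integral>x. f x \<partial>M) \<le> (\<integral>x. g x \<partial>M)"
  by (rule order_trans[OF integral_norm_bound integral_mono]) (use assms in auto)

lemma integral_linear_combination: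
  fixes u v w :: "'a \<Rightarrow> real"
  assumes "integrable M u" "integrable M v" "integrable M w"
  shows "(\<integral>x. a * u x + b * v x + c * w x \<partial>M) = a * (\<integral>x. u x \<partial>M) + b * (\<integral>x. v x \<partial>M) + c * (\<integral>x. w x \<partial>M)"
  using assms by simp

context prob_space begin

context
  fixes r :: "'a \<Rightarrow> real"
  assumes r[measurable]: "r \<in> borel_measurable M" and atomless: "\<And>t. prob {x \<in> space M. r x = t} = 0"
begin

lemma integral_of_bool_tail: "(\<integral>y. of_bool (t < r y) \<partial>M) = tail r t" "(\<integral>y. of_bool (t < r y) \<partial>M) = complex_of_real (tail r t)"
proof -
  have "(\<integral>y. of_bool (t < r y) \<partial>M) = (\<integral>y. indicat_real {y \<in> space M. t < r y} y \<partial>M)"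
    by (intro Bochner_Integration.integral_cong) (auto simp: indicator_def)
  then show "(\<integral>y. of_bool (t < r y) \<partial>M) = tail r t" by (simp add: tail_def)
  have "(\<integral>y. of_bool (t < r y) \<partial>M) = (\<integral>y. complex_of_real (of_bool (t < r y)) \<partial>M)"
    by (intro Bochner_Integration.integral_cong) (auto simp: of_bool_def)
  also have "\<dots> = complex_of_real (\<integral>y. of_bool (t < r y) \<partial>M)" by (rule integral_complex_of_real)
  finally show "(\<integral>y. of_bool (t < r y) \<partial>M) = complex_of_real (tail r t)" using \<open>(\<integral>y. of_bool (t < r y) \<partial>M) = tail r t\<close> by simp
qed

lemma norm_integral_tail_le:
  fixes g :: "'a \<Rightarrow> complex"
  assumes g[measurable]: "g \<in> borel_measurable M" and bd: "\<And>x. norm (g x) \<le> C"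
  shows "norm (\<integral>y. g y * of_bool (t < r y) \<partial>M) \<le> C * tail r t"
proof -
  have "norm (\<integral>y. g y * of_bool (t < r y) \<partial>M) \<le> (\<integral>y. C * of_bool (t < r y) \<partial>M)"
  proof (rule norm_integral_le_integral)
    show "integrable M (\<lambda>y. g y * of_bool (t < r y))"
      by (rule integrable_const_bound[where B=C]) (use order_trans[OF norm_ge_zero bd] in \<open>auto simp: norm_mult bd of_bool_def\<close>)
    show "integrable M (\<lambda>y. C * of_bool (t < r y))"
      by (rule integrable_const_bound[where B="\<bar>C\<bar>"]) (auto simp: of_bool_def)
  qed (auto simp: norm_mult of_bool_def bd)
  also have "\<dots> = C * tail r t" by (simp add: integral_of_bool_tail)
  finally show ?thesis .
qed

text \<open>After multiplication by k, the Taylor terms of exp at \<zeta> f / sqrt k carry the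
  factors sqrt k, 1 and, for the remainder, 1 / sqrt k. The remainder bound depends on
  \<open>f\<close> only through \<open>B\<close>, hence is uniform in the threshold
  \<open>t\<close>.\<close>

lemma exp_tail_expansion:
  fixes \<zeta> :: complex and k :: nat
  assumes f[measurable]: "f \<in> borel_measurable M" and bd: "\<And>x. \<bar>f x\<bar> \<le> B" and k: "1 \<le> k" and pos: "0 < tail r t"
  shows "norm (of_nat k * ((\<integral>y. exp (\<zeta> * complex_of_real (f y / sqrt (real k))) * of_bool (t < r y) \<partial>M) / tail r t - 1)
     - (\<zeta> * complex_of_real (sqrt (real k) * (\<integral>y. f y * of_bool (t < r y) \<partial>M) / tail r t)
        + \<zeta>\<^sup>2 / 2 * complex_of_real ((\<integral>y. (f y)\<^sup>2 * of_bool (t < r y) \<partial>M) / tail r t)))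
     \<le> exp (norm \<zeta> * B) * (norm \<zeta> * B) ^ 3 / sqrt (real k)"
proof -
  have B0: "0 \<le> B" using bd order_trans abs_ge_zero by blast
  define s where "s = sqrt (real k)"
  have s: "1 \<le> s" "s\<^sup>2 = real k" using k by (auto simp: s_def)
  define w where "w y = \<zeta> * complex_of_real (f y / s)" for y
  define R where "R y = exp (w y) - (1 + w y + (w y)\<^sup>2 / 2)" for y
  have [measurable]: "w \<in> borel_measurable M" "R \<in> borel_measurable M" unfolding w_def[abs_def] R_def[abs_def] by measurable
  have bw: "norm (w y) \<le> norm \<zeta> * B / s" for y
    using bd[of y] s by (simp add: w_def norm_mult norm_divide mult_left_mono divide_right_mono)
  have bw': "norm (w y) \<le> norm \<zeta> * B" for y
  proof -
    have "norm \<zeta> * B / s \<le> norm \<zeta> * B / 1" using s B0 by (intro divide_left_mono) auto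
    then show ?thesis using bw[of y] by simp
  qed
  have bR: "norm (R y) \<le> exp (norm \<zeta> * B) * (norm \<zeta> * B / s) ^ 3" for y
  proof -
    have "norm (R y) \<le> exp (norm (w y)) * norm (w y) ^ Suc 2 / fact 2"
      using Taylor_exp_field[of "w y" 2] by (simp add: R_def atMost_nat_numeral fact_numeral add.commute add.left_commute)
    also have "\<dots> \<le> exp (norm (w y)) * norm (w y) ^ 3" by (simp add: fact_numeral eval_nat_numeral)
    also have "\<dots> \<le> exp (norm \<zeta> * B) * (norm \<zeta> * B / s) ^ 3"
      by (intro mult_mono power_mono bw) (use bw' in auto)
    finally show ?thesis .
  qed
  have i1: "integrable M (\<lambda>y. of_bool (t < r y) :: complex)"
    by (rule integrable_const_bound[where B=1]) (auto simp: of_bool_def)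
  have i2: "integrable M (\<lambda>y. f y * of_bool (t < r y))"
    by (rule integrable_const_bound[where B=B]) (use B0 in \<open>auto simp: of_bool_def bd\<close>)
  have i3: "integrable M (\<lambda>y. (f y)\<^sup>2 * of_bool (t < r y))"
    by (rule integrable_const_bound[where B="B\<^sup>2"]) (use B0 bd in \<open>auto simp: of_bool_def abs_le_square_iff[symmetric]\<close>)
  have i4: "integrable M (\<lambda>y. R y * of_bool (t < r y))"
    by (rule integrable_const_bound[where B="exp (norm \<zeta> * B) * (norm \<zeta> * B / s) ^ 3"])
      (use bR B0 s in \<open>auto simp: of_bool_def norm_mult\<close>)
  have c2: "(\<integral>y. w y * of_bool (t < r y) \<partial>M) = \<zeta> / s * complex_of_real (\<integral>y. f y * of_bool (t < r y) \<partial>M)"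
    and ci2: "integrable M (\<lambda>y. w y * of_bool (t < r y))"
  proof -
    have eq: "w y * of_bool (t < r y) = \<zeta> / s * complex_of_real (f y * of_bool (t < r y))" for y by (simp add: w_def)
    show "(\<integral>y. w y * of_bool (t < r y) \<partial>M) = \<zeta> / s * complex_of_real (\<integral>y. f y * of_bool (t < r y) \<partial>M)"
      unfolding eq integral_mult_right_zero integral_complex_of_real ..
    show "integrable M (\<lambda>y. w y * of_bool (t < r y))" unfolding eq by (intro integrable_mult_right integrable_of_real i2)
  qed
  have c3: "(\<integral>y. (w y)\<^sup>2 / 2 * of_bool (t < r y) \<partial>M) = \<zeta>\<^sup>2 / (2 * s\<^sup>2) * complex_of_real (\<integral>y. (f y)\<^sup>2 * of_bool (t < r y) \<partial>M)"
    and ci3: "integrable M (\<lambda>y. (w y)\<^sup>2 / 2 * of_bool (t < r y))"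
  proof -
    have eq: "(w y)\<^sup>2 / 2 * of_bool (t < r y) = \<zeta>\<^sup>2 / (2 * s\<^sup>2) * complex_of_real ((f y)\<^sup>2 * of_bool (t < r y))" for y
      by (simp add: w_def power_mult_distrib power_divide)
    show "(\<integral>y. (w y)\<^sup>2 / 2 * of_bool (t < r y) \<partial>M) = \<zeta>\<^sup>2 / (2 * s\<^sup>2) * complex_of_real (\<integral>y. (f y)\<^sup>2 * of_bool (t < r y) \<partial>M)"
      unfolding eq integral_mult_right_zero integral_complex_of_real ..
    show "integrable M (\<lambda>y. (w y)\<^sup>2 / 2 * of_bool (t < r y))" unfolding eq by (intro integrable_mult_right integrable_of_real i3)
  qed
  have "(\<integral>y. exp (w y) * of_bool (t < r y) \<partial>M)
     = (\<integral>y. of_bool (t < r y) + w y * of_bool (t < r y) + (w y)\<^sup>2 / 2 * of_bool (t < r y) + R y * of_bool (t < r y) \<partial>M)"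
    by (intro Bochner_Integration.integral_cong) (auto simp: R_def algebra_simps)
  also have "\<dots> = complex_of_real (tail r t) + \<zeta> / s * complex_of_real (\<integral>y. f y * of_bool (t < r y) \<partial>M)
      + \<zeta>\<^sup>2 / (2 * s\<^sup>2) * complex_of_real (\<integral>y. (f y)\<^sup>2 * of_bool (t < r y) \<partial>M) + (\<integral>y. R y * of_bool (t < r y) \<partial>M)"
    using i1 ci2 ci3 i4
    by (simp only: Bochner_Integration.integral_add Bochner_Integration.integrable_add c2 c3 integral_of_bool_tail)
  finally have A: "(\<integral>y. exp (w y) * of_bool (t < r y) \<partial>M) = \<dots>" .
  have ks: "complex_of_real s * complex_of_real s = of_nat k" 
    using s by (metis of_real_mult of_real_of_nat_eq power2_eq_square)
  have s0: "complex_of_real s \<noteq> 0" "complex_of_real (tail r t) \<noteq> 0" using s pos by auto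
  have "of_nat k * ((\<integral>y. exp (w y) * of_bool (t < r y) \<partial>M) / tail r t - 1)
     - (\<zeta> * complex_of_real (s * (\<integral>y. f y * of_bool (t < r y) \<partial>M) / tail r t)
        + \<zeta>\<^sup>2 / 2 * complex_of_real ((\<integral>y. (f y)\<^sup>2 * of_bool (t < r y) \<partial>M) / tail r t))
     = of_nat k * (\<integral>y. R y * of_bool (t < r y) \<partial>M) / tail r t"
    unfolding A ks[symmetric] using s0 by (simp add: field_simps power2_eq_square)
  also have "norm \<dots> \<le> real k * (exp (norm \<zeta> * B) * (norm \<zeta> * B / s) ^ 3 * tail r t) / tail r t"
  proof -
    have "norm (\<integral>y. R y * of_bool (t < r y) \<partial>M) \<le> exp (norm \<zeta> * B) * (norm \<zeta> * B / s) ^ 3 * tail r t"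
      by (rule norm_integral_tail_le) (use bR in auto)
    from divide_right_mono[OF mult_left_mono[OF this, of "real k"], of "tail r t"] pos
    show ?thesis by (simp only: norm_mult norm_divide norm_of_nat norm_of_real abs_of_pos)
  qed
  also have "\<dots> = exp (norm \<zeta> * B) * (norm \<zeta> * B) ^ 3 / s"
    using pos s(1) unfolding s(2)[symmetric] by (simp add: power_divide power2_eq_square power3_eq_cube)
  finally show ?thesis by (simp add: w_def s_def)
qed

lemma exp_sqrt_times_geometric: "(\<lambda>m. (exp (a * sqrt (real m)) + e) * (3 * (1 / 2) ^ m)) \<longlonglongrightarrow> 0"
proof -
  \<comment> \<open>A positive coefficient above \<open>a\<close> settles the signs in the growth
    comparison.\<close>
  define b where "b = \<bar>a\<bar> + 1"
  have b: "0 < b" by (simp add: b_def)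
  have 1: "(\<lambda>m. exp (b * sqrt (real m)) * (3 * (1 / 2) ^ m)) \<longlonglongrightarrow> 0" using b by real_asymp
  have 2: "(\<lambda>m. exp (a * sqrt (real m)) * (3 * (1 / 2) ^ m)) \<longlonglongrightarrow> 0"
    by (rule tendsto_sandwich[OF _ _ tendsto_const 1]) (auto intro!: always_eventually mult_right_mono simp: b_def)
  have 3: "(\<lambda>m. e * (3 * (1 / 2) ^ m)) \<longlonglongrightarrow> 0" by real_asymp
  show ?thesis using tendsto_add[OF 2 3] by (simp add: distrib_right)
qed

text \<open>\<open>bias\<close> and \<open>var\<close> control the coefficients of \<zeta> and of
  half its square in \<open>exp_tail_expansion\<close>, and only on the window \<open>good\<close>.
  The window is so wide that it misses the k-th largest value with probability decaying
  geometrically in \<open>k n\<close>.\<close>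

theorem tendsto_integral_exp_top:
  fixes \<zeta> :: complex and k :: "nat \<Rightarrow> nat" and f :: "'a \<Rightarrow> real"
  defines "good n x \<equiv> real (k n) \<le> 8 * real n * tail r (r x) \<and> real n * tail r (r x) \<le> 8 * real (k n)"
  assumes f[measurable]: "f \<in> borel_measurable M" and bd: "\<And>x. \<bar>f x\<bar> \<le> B"
    and k_large: "filterlim k at_top sequentially" and k_le: "eventually (\<lambda>n. k n \<le> n) sequentially"
    and bias: "\<And>e. 0 < e \<Longrightarrow> eventually (\<lambda>n. \<forall>x\<in>space M. good n x \<longrightarrow>
        \<bar>sqrt (real (k n)) * (\<integral>y. f y * of_bool (r x < r y) \<partial>M) / tail r (r x)\<bar> < e) sequentially"
    and var: "\<And>e. 0 < e \<Longrightarrow> eventually (\<lambda>n. \<forall>x\<in>space M. good n x \<longrightarrow>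
        \<bar>(\<integral>y. (f y)\<^sup>2 * of_bool (r x < r y) \<partial>M) / tail r (r x) - s\<bar> < e) sequentially"
  shows "(\<lambda>n. \<integral>w. (\<Prod>l\<in>{1..n}. if card (above {1..n} (\<lambda>m. r (w m)) (r (w l))) < k n
                then exp (\<zeta> * complex_of_real (f (w l) / sqrt (real (k n)))) else 1) \<partial>PiM {1..n} (\<lambda>_. M))
     \<longlonglongrightarrow> exp (\<zeta>\<^sup>2 / 2 * s)"
proof -
  have B0: "0 \<le> B" using bd order_trans abs_ge_zero by blast
  define z where "z = \<zeta>\<^sup>2 / 2 * complex_of_real s"
  \<comment> \<open>A limit along this filter on pairs (n, x) is a limit in n that is uniform over
    the good points x, as \<open>evF\<close> spells out; uniform statements can then be handled by
    the ordinary rules for limits.\<close>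
  define F where "F = filtercomap fst sequentially \<sqinter> principal {(n, x). x \<in> space M \<and> good n x}"
  have evF: "eventually P F \<longleftrightarrow> eventually (\<lambda>n. \<forall>x\<in>space M. good n x \<longrightarrow> P (n, x)) sequentially" for P
  proof
    assume "eventually P F"
    then obtain Q where Q: "eventually Q sequentially" "\<And>p. Q (fst p) \<Longrightarrow> p \<in> {(n, x). x \<in> space M \<and> good n x} \<Longrightarrow> P p"
      unfolding F_def eventually_inf_principal eventually_filtercomap by blast
    show "eventually (\<lambda>n. \<forall>x\<in>space M. good n x \<longrightarrow> P (n, x)) sequentially"
      using Q(1) by (rule eventually_mono) (use Q(2) in simp)
  next
    assume ev: "eventually (\<lambda>n. \<forall>x\<in>space M. good n x \<longrightarrow> P (n, x)) sequentially"
    show "eventually P F"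
      unfolding F_def eventually_inf_principal eventually_filtercomap
      by (rule exI, rule conjI[OF ev]) auto
  qed
  have fstF: "filterlim fst sequentially F" unfolding F_def by (rule filterlim_mono[OF filterlim_filtercomap order_refl inf_le1])
  have kF: "filterlim (\<lambda>p. k (fst p)) at_top F" by (rule filterlim_compose[OF k_large fstF])
  have k1: "eventually (\<lambda>n. 1 \<le> k n) sequentially" using k_large by (auto simp: filterlim_at_top)
  have k1F: "eventually (\<lambda>p. 1 \<le> k (fst p)) F" using kF by (auto simp: filterlim_at_top)
  have biasF: "((\<lambda>p. sqrt (real (k (fst p))) * (\<integral>y. f y * of_bool (r (snd p) < r y) \<partial>M) / tail r (r (snd p))) \<longlongrightarrow> 0) F"
    using bias by (intro tendstoI) (simp add: evF)
  have varF: "((\<lambda>p. (\<integral>y. (f y)\<^sup>2 * of_bool (r (snd p) < r y) \<partial>M) / tail r (r (snd p))) \<longlongrightarrow> s) F"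
    using var by (intro tendstoI) (simp add: evF dist_real_def)
  define \<psi> where "\<psi> n x = exp (\<zeta> * complex_of_real (f x / sqrt (real (k n))))" for n x
  define b where "b p = (\<integral>y. \<psi> (fst p) y * of_bool (r (snd p) < r y) \<partial>M) / tail r (r (snd p)) - 1" for p
  have [measurable]: "\<psi> n \<in> borel_measurable M" for n unfolding \<psi>_def[abs_def] by measurable
  have posF: "eventually (\<lambda>p. 0 < tail r (r (snd p))) F"
    unfolding evF using k1
  proof eventually_elim
    case (elim n)
    show ?case
    proof safe
      fix x assume "good n x"
      then have "tail r (r x) \<noteq> 0" using elim by (auto simp: good_def)
      then show "0 < tail r (r (snd (n, x)))" using tail_bounds(1)[of r "r x"] by simp
    qed
  qed
  define C where "C = exp (norm \<zeta> * B) * (norm \<zeta> * B) ^ 3"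
  have sqrtF: "filterlim (\<lambda>p. sqrt (real (k (fst p)))) at_infinity F"
    by (rule filterlim_at_top_imp_at_infinity[OF filterlim_compose[OF sqrt_at_top filterlim_compose[OF filterlim_real_sequentially kF]]])
  then have inv_sqrt: "((\<lambda>p. C / sqrt (real (k (fst p)))) \<longlongrightarrow> 0) F" by (rule tendsto_divide_0[OF tendsto_const])
  have kb: "((\<lambda>p. of_nat (k (fst p)) * b p) \<longlongrightarrow> z) F"
  proof -
    have "((\<lambda>p. of_nat (k (fst p)) * b p
       - (\<zeta> * complex_of_real (sqrt (real (k (fst p))) * (\<integral>y. f y * of_bool (r (snd p) < r y) \<partial>M) / tail r (r (snd p)))
        + \<zeta>\<^sup>2 / 2 * complex_of_real ((\<integral>y. (f y)\<^sup>2 * of_bool (r (snd p) < r y) \<partial>M) / tail r (r (snd p))))) \<longlongrightarrow> 0) F"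
    proof (rule Lim_null_comparison[OF _ inv_sqrt])
      show "eventually (\<lambda>p. norm (of_nat (k (fst p)) * b p
       - (\<zeta> * complex_of_real (sqrt (real (k (fst p))) * (\<integral>y. f y * of_bool (r (snd p) < r y) \<partial>M) / tail r (r (snd p)))
        + \<zeta>\<^sup>2 / 2 * complex_of_real ((\<integral>y. (f y)\<^sup>2 * of_bool (r (snd p) < r y) \<partial>M) / tail r (r (snd p))))) \<le> C / sqrt (real (k (fst p)))) F"
        using k1F posF
      proof eventually_elim
        case (elim p)
        show ?case unfolding b_def \<psi>_def C_def by (rule exp_tail_expansion[OF f bd elim])
      qed
    qed
    moreover have "((\<lambda>p. \<zeta> * complex_of_real (sqrt (real (k (fst p))) * (\<integral>y. f y * of_bool (r (snd p) < r y) \<partial>M) / tail r (r (snd p)))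
        + \<zeta>\<^sup>2 / 2 * complex_of_real ((\<integral>y. (f y)\<^sup>2 * of_bool (r (snd p) < r y) \<partial>M) / tail r (r (snd p)))) \<longlongrightarrow> z) F"
      using tendsto_add[OF tendsto_mult[OF tendsto_const tendsto_of_real[OF biasF]] tendsto_mult[OF tendsto_const tendsto_of_real[OF varF]],
          of \<zeta> "\<zeta>\<^sup>2 / 2"]
      unfolding z_def of_real_0 mult_zero_right add_0_left .
    ultimately show ?thesis by (rule Lim_transform[rotated])
  qed
  \<comment> \<open>Only \<open>k - 1\<close> factors are conditional means. The observation of rank
    \<open>k\<close> itself contributes the separate factor \<open>\<psi>\<close>, which tends to
    1.\<close>
  have k1b: "((\<lambda>p. of_nat (k (fst p) - 1) * b p) \<longlongrightarrow> z) F"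
  proof -
    have "filterlim (\<lambda>p. real (k (fst p))) at_infinity F"
      by (rule filterlim_at_top_imp_at_infinity[OF filterlim_compose[OF filterlim_real_sequentially kF]])
    then have inv: "((\<lambda>p. 1 / real (k (fst p))) \<longlongrightarrow> 0) F" by (rule tendsto_divide_0[OF tendsto_const])
    from tendsto_mult[OF tendsto_of_real[OF tendsto_diff[OF tendsto_const[of 1] inv]] kb]
    have "((\<lambda>p. complex_of_real (1 - 1 / real (k (fst p))) * (of_nat (k (fst p)) * b p)) \<longlongrightarrow> z) F"
      unfolding diff_zero of_real_1 mult_1_left .
    then show ?thesis
    proof (rule Lim_transform_eventually)
      show "eventually (\<lambda>p. complex_of_real (1 - 1 / real (k (fst p))) * (of_nat (k (fst p)) * b p) = of_nat (k (fst p) - 1) * b p) F"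
        using k1F
      proof eventually_elim
        case (elim p)
        then have "(1 - 1 / real (k (fst p))) * real (k (fst p)) = real (k (fst p) - 1)"
          by (simp add: left_diff_distrib)
        from arg_cong[OF this, of complex_of_real]
        have "complex_of_real (1 - 1 / real (k (fst p))) * of_nat (k (fst p)) = of_nat (k (fst p) - 1)"
          unfolding of_real_mult of_real_of_nat_eq .
        then show ?case by (simp only: mult.assoc[symmetric])
      qed
    qed
  qed
  have psi1: "((\<lambda>p. \<psi> (fst p) (snd p)) \<longlongrightarrow> 1) F"
  proof -
    have "((\<lambda>p. \<zeta> * complex_of_real (f (snd p) / sqrt (real (k (fst p))))) \<longlongrightarrow> 0) F"
    proof (rule Lim_null_comparison)
      show "((\<lambda>p. norm \<zeta> * B / sqrt (real (k (fst p)))) \<longlongrightarrow> 0) F"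
        by (rule tendsto_divide_0[OF tendsto_const sqrtF])
      show "eventually (\<lambda>p. norm (\<zeta> * complex_of_real (f (snd p) / sqrt (real (k (fst p))))) \<le> norm \<zeta> * B / sqrt (real (k (fst p)))) F"
        using bd by (intro always_eventually allI) (simp add: norm_mult norm_divide mult_left_mono divide_right_mono)
    qed
    from tendsto_exp[OF this] show ?thesis by (simp add: \<psi>_def)
  qed
  define q where "q n x = \<psi> n x * ((\<integral>y. \<psi> n y * of_bool (r x < r y) \<partial>M) / tail r (r x)) ^ (k n - 1)" for n x
  have "((\<lambda>p. \<psi> (fst p) (snd p) * (1 + b p) ^ (k (fst p) - 1)) \<longlongrightarrow> 1 * exp z) F"
    by (rule tendsto_mult[OF psi1 tendsto_one_plus_power[OF filterlim_compose[OF filterlim_minus_const_nat_at_top kF] k1b]])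
  then have qF: "((\<lambda>p. q (fst p) (snd p)) \<longlongrightarrow> exp z) F" by (simp add: q_def b_def)
  have [measurable]: "q n \<in> borel_measurable M" for n
  proof -
    note [measurable] = measurable_compose[OF r tail_measurable[OF r]]
    show ?thesis unfolding q_def[abs_def] by measurable
  qed
  have bd\<psi>: "norm (\<psi> n x) \<le> exp (norm \<zeta> * B / sqrt (real (k n)))" for n x
  proof -
    have "norm (\<zeta> * complex_of_real (f x / sqrt (real (k n)))) \<le> norm \<zeta> * B / sqrt (real (k n))"
      using bd by (simp add: norm_mult norm_divide mult_left_mono divide_right_mono)
    then show ?thesis unfolding \<psi>_def using order_trans[OF norm_exp] by (metis exp_le_cancel_iff)
  qed
  \<comment> \<open>There are \<open>k n\<close> factors, each at most exp (C / sqrt k), which makes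
    exp (C sqrt k) in total.\<close>
  have bdq: "norm (q n x) \<le> exp (norm \<zeta> * B * sqrt (real (k n)))" if "1 \<le> k n" for n x
  proof -
    have "norm ((\<integral>y. \<psi> n y * of_bool (r x < r y) \<partial>M) / tail r (r x)) \<le> exp (norm \<zeta> * B / sqrt (real (k n)))"
      using norm_integral_tail_le[of "\<psi> n", OF _ bd\<psi>, of "r x"] tail_bounds(1)[of r "r x"]
      by (cases "tail r (r x) = 0") (auto simp: norm_divide divide_le_eq)
    then have "norm (q n x) \<le> exp (norm \<zeta> * B / sqrt (real (k n))) * exp (norm \<zeta> * B / sqrt (real (k n))) ^ (k n - 1)"
      unfolding q_def norm_mult norm_power by (intro mult_mono power_mono bd\<psi>) auto
    also have "\<dots> = exp (norm \<zeta> * B / sqrt (real (k n))) ^ k n" using that by (cases "k n") auto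
    also have "\<dots> = exp (real (k n) * (norm \<zeta> * B / sqrt (real (k n))))" by (rule exp_of_nat_mult[symmetric])
    also have "real (k n) * (norm \<zeta> * B / sqrt (real (k n))) = norm \<zeta> * B * sqrt (real (k n))"
    proof -
      have "real (k n) / sqrt (real (k n)) = sqrt (real (k n))" by (rule real_div_sqrt) simp
      then show ?thesis by (metis mult.commute times_divide_eq_right)
    qed
    finally show ?thesis .
  qed
  \<comment> \<open>The cost of leaving the window: the crude bound on the integrand times the two
    beta tail bounds.\<close>
  define D where "D n = (exp (norm \<zeta> * B * sqrt (real (k n))) + norm (exp z)) * ((1 / 4) ^ k n + (1 / 4) ^ (k n div 2))" for n
  have D0: "D \<longlonglongrightarrow> 0"
  proof (rule tendsto_sandwich)
    show "eventually (\<lambda>n. 0 \<le> D n) sequentially" by (simp add: D_def)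
    show "eventually (\<lambda>n. D n \<le> (exp (norm \<zeta> * B * sqrt (real (k n))) + norm (exp z)) * (3 * (1 / 2) ^ k n)) sequentially"
    proof (intro always_eventually allI)
      fix n
      \<comment> \<open>For odd \<open>k n\<close> the integer division loses one factor 1/2. Hence
        the 2 here and, together with the other tail, the 3.\<close>
      have "(1 / 4 :: real) ^ (k n div 2) = (1 / 2) ^ (2 * (k n div 2))" by (simp add: power_mult power2_eq_square)
      also have "\<dots> \<le> 2 * (1 / 2) ^ k n"
        by (cases "even (k n)") (auto elim!: oddE)
      finally have 1: "(1 / 4 :: real) ^ (k n div 2) \<le> 2 * (1 / 2) ^ k n" .
      have "(1 / 4 :: real) ^ k n \<le> (1 / 2) ^ k n" by (intro power_mono) auto
      then show "D n \<le> (exp (norm \<zeta> * B * sqrt (real (k n))) + norm (exp z)) * (3 * (1 / 2) ^ k n)"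
        unfolding D_def using 1 by (intro mult_left_mono) auto
    qed
    have "((\<lambda>m. (exp (norm \<zeta> * B * sqrt (real m)) + norm (exp z)) * (3 * (1 / 2) ^ m)) \<longlonglongrightarrow> 0)"
      by (rule exp_sqrt_times_geometric)
    from filterlim_compose[OF this k_large]
    show "(\<lambda>n. (exp (norm \<zeta> * B * sqrt (real (k n))) + norm (exp z)) * (3 * (1 / 2) ^ k n)) \<longlonglongrightarrow> 0" .
  qed simp
  have est: "norm ((\<integral>x. order_density r n (k n) x *\<^sub>R q n x \<partial>M) - exp z) \<le> e + D n"
    if kn: "1 \<le> k n" "k n \<le> n" and e: "0 \<le> e" and q: "\<And>x. x \<in> space M \<Longrightarrow> good n x \<Longrightarrow> norm (q n x - exp z) \<le> e" for n e
  proof -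
    let ?w = "order_density r n (k n)"
    define c where "c = exp (norm \<zeta> * B * sqrt (real (k n))) + norm (exp z)"
    have iw: "integrable M ?w" using order_density_integrable[OF r, of "\<lambda>_. 1 :: real" 1] by simp
    have iq: "integrable M (\<lambda>x. ?w x *\<^sub>R q n x)" by (rule order_density_integrable[OF r _ bdq[OF kn(1)]]) measurable
    have ie: "integrable M (\<lambda>x. ?w x *\<^sub>R exp z)" by (rule order_density_integrable[OF r, where C="norm (exp z)"]) auto
    note [measurable] = measurable_compose[OF r tail_measurable[OF r]]
    have i1: "integrable M (\<lambda>x. ?w x * of_bool (8 * real (k n) < real n * tail r (r x)))"
      using order_density_integrable[OF r, of "\<lambda>x. of_bool (8 * real (k n) < real n * tail r (r x)) :: real" 1] by (simp add: of_bool_def)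
    have i2: "integrable M (\<lambda>x. ?w x * of_bool (8 * real n * tail r (r x) < real (k n)))"
      using order_density_integrable[OF r, of "\<lambda>x. of_bool (8 * real n * tail r (r x) < real (k n)) :: real" 1] by (simp add: of_bool_def)
    have eq: "(\<integral>x. ?w x *\<^sub>R q n x \<partial>M) - exp z = (\<integral>x. ?w x *\<^sub>R q n x - ?w x *\<^sub>R exp z \<partial>M)"
      using iq ie iw integral_order_density[OF r atomless kn] by (simp add: integral_scaleR_left)
    have "norm ((\<integral>x. ?w x *\<^sub>R q n x \<partial>M) - exp z) \<le> (\<integral>x. e * ?w x + c * (?w x * of_bool (8 * real (k n) < real n * tail r (r x))) + c * (?w x * of_bool (8 * real n * tail r (r x) < real (k n))) \<partial>M)"
      unfolding eq
    proof (rule norm_integral_le_integral)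
      fix x assume x: "x \<in> space M"
      have n1: "norm (?w x *\<^sub>R q n x - ?w x *\<^sub>R exp z) = ?w x * norm (q n x - exp z)"
        by (simp flip: scaleR_diff_right add: order_density_nonneg)
      have n2: "norm (q n x - exp z) \<le> c"
        using norm_triangle_ineq4[of "q n x" "exp z"] bdq[OF kn(1), of x] unfolding c_def by linarith
      have c0: "0 \<le> c" by (simp add: c_def)
      have "norm (q n x - exp z) \<le> e + c * of_bool (8 * real (k n) < real n * tail r (r x)) + c * of_bool (8 * real n * tail r (r x) < real (k n))"
      proof (cases "good n x")
        case True
        then have "\<not> 8 * real (k n) < real n * tail r (r x)" "\<not> 8 * real n * tail r (r x) < real (k n)"
          unfolding good_def by linarith+
        then show ?thesis using q[OF x True] by (simp only: of_bool_eq)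
      next
        case False
        then have "8 * real (k n) < real n * tail r (r x) \<or> 8 * real n * tail r (r x) < real (k n)" by (auto simp: good_def)
        then have "c \<le> c * of_bool (8 * real (k n) < real n * tail r (r x)) + c * of_bool (8 * real n * tail r (r x) < real (k n))"
          unfolding of_bool_def using c0 by (elim disjE) simp_all
        then show ?thesis using n2 e by linarith
      qed
      from mult_left_mono[OF this order_density_nonneg[of r n "k n" x]]
      show "norm (?w x *\<^sub>R q n x - ?w x *\<^sub>R exp z) \<le> e * ?w x + c * (?w x * of_bool (8 * real (k n) < real n * tail r (r x))) + c * (?w x * of_bool (8 * real n * tail r (r x) < real (k n)))"
        unfolding n1 distrib_left mult.left_commute[of "?w x"] mult.commute[of "?w x" e] .
    qed (intro Bochner_Integration.integrable_diff Bochner_Integration.integrable_add integrable_mult_right iq ie iw i1 i2)+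
    also have "\<dots> = e * (\<integral>x. ?w x \<partial>M) + c * (\<integral>x. ?w x * of_bool (8 * real (k n) < real n * tail r (r x)) \<partial>M) + c * (\<integral>x. ?w x * of_bool (8 * real n * tail r (r x) < real (k n)) \<partial>M)"
      by (rule integral_linear_combination[OF iw i1 i2])
    also have "\<dots> \<le> e * 1 + c * (1 / 4) ^ k n + c * (1 / 4) ^ (k n div 2)"
    proof -
      have "0 \<le> c" by (simp add: c_def)
      then show ?thesis
        unfolding integral_order_density[OF r atomless kn]
        by (intro add_mono order_refl mult_left_mono[OF order_density_tail_large[OF r atomless kn]]
            mult_left_mono[OF order_density_tail_small[OF r atomless kn]])
    qed
    also have "\<dots> = e + D n" by (simp add: D_def c_def distrib_left)
    finally show ?thesis .
  qed
  have lim: "(\<lambda>n. \<integral>x. order_density r n (k n) x *\<^sub>R q n x \<partial>M) \<longlonglongrightarrow> exp z"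
  proof (rule tendstoI)
    fix e :: real assume e: "0 < e"
    have "eventually (\<lambda>p. dist (q (fst p) (snd p)) (exp z) < e / 2) F" using qF e by (intro tendstoD) auto
    then have "eventually (\<lambda>n. \<forall>x\<in>space M. good n x \<longrightarrow> norm (q n x - exp z) < e / 2) sequentially"
      by (simp add: evF dist_norm)
    moreover have "eventually (\<lambda>n. D n < e / 2) sequentially" using D0 e by (intro order_tendstoD) auto
    ultimately show "eventually (\<lambda>n. dist (\<integral>x. order_density r n (k n) x *\<^sub>R q n x \<partial>M) (exp z) < e) sequentially"
      using k1 k_le
    proof eventually_elim
      case (elim n)
      have "norm ((\<integral>x. order_density r n (k n) x *\<^sub>R q n x \<partial>M) - exp z) \<le> e / 2 + D n"
        by (rule est) (use elim e in \<open>auto intro: less_imp_le\<close>)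
      then show ?case using elim by (simp add: dist_norm)
    qed
  qed
  have "eventually (\<lambda>n. (\<integral>x. order_density r n (k n) x *\<^sub>R q n x \<partial>M) =
      (\<integral>w. (\<Prod>l\<in>{1..n}. if card (above {1..n} (\<lambda>m. r (w m)) (r (w l))) < k n
                then \<psi> n (w l) else 1) \<partial>PiM {1..n} (\<lambda>_. M))) sequentially"
    using k1 k_le
  proof eventually_elim
    case (elim n)
    then show ?case
      using integral_prod_top_density[OF r atomless, of "\<psi> n" _ "{1..n}" "k n", OF _ bd\<psi>] by (simp add: q_def)
  qed
  from Lim_transform_eventually[OF lim this] show ?thesis unfolding \<psi>_def z_def .
qed

end

end

section \<open>Regular variation and spectral measures\<close>

lemma scale_measure_eq_density: "scale_measure c N = density N (\<lambda>_. c)"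
  by (rule measure_eqI) (auto simp: emeasure_density_const)

lemma integral_scale_measure:
  fixes f :: "'b \<Rightarrow> real"
  assumes [measurable]: "f \<in> borel_measurable N" and c: "0 \<le> c"
  shows "(\<integral>x. f x \<partial>scale_measure (ennreal c) N) = c * (\<integral>x. f x \<partial>N)"
  unfolding scale_measure_eq_density by (subst integral_density) (use c in auto)

lemma nu2_density_eq: "ennreal (2 / x ^ 3) * indicator {0<..} x = ennreal (2 / x ^ 3 * indicator {0<..} x)" for x :: real
  by (auto simp: indicator_def)

lemma sets_nu2[measurable_cong, simp]: "sets nu2 = sets borel"
  by (simp add: nu2_def)

lemma space_nu2[simp]: "space nu2 = UNIV"
  by (simp add: nu2_def)

lemma integral_nu2:
  fixes f :: "ereal \<Rightarrow> real"
  assumes [measurable]: "f \<in> borel_measurable borel"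
  shows "(\<integral>r. f r \<partial>nu2) = (\<integral>x. (2 / x ^ 3 * indicator {0<..} x) * f (ereal x) \<partial>lborel)"
proof -
  have "(\<integral>r. f r \<partial>nu2) = (\<integral>x. f (ereal x) \<partial>density lborel (\<lambda>x. ennreal (2 / x ^ 3 * indicator {0<..} x)))"
    unfolding nu2_def nu2_density_eq by (rule integral_distr) auto
  also have "\<dots> = (\<integral>x. (2 / x ^ 3 * indicator {0<..} x) * f (ereal x) \<partial>lborel)"
    by (subst integral_density) (auto simp: indicator_def)
  finally show ?thesis .
qed

lemma emeasure_nu2_atLeast:
  assumes a: "0 < a"
  shows "emeasure nu2 {ereal a..} = ennreal (1 / a\<^sup>2)"
proof -
  have "emeasure nu2 {ereal a..} = (\<integral>\<^sup>+x. ennreal (2 / x ^ 3) * indicator {0<..} x * indicator {a..} x \<partial>lborel)"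
    unfolding nu2_def by (subst emeasure_distr) (auto simp: emeasure_density vimage_def indicator_def intro!: nn_integral_cong)
  also have "\<dots> = (\<integral>\<^sup>+x. ennreal (2 / x ^ 3) * indicator {a..} x \<partial>lborel)"
    using a by (intro nn_integral_cong) (auto simp: indicator_def)
  also have "\<dots> = ennreal (0 - (- (1 / a\<^sup>2)))"
  proof (rule nn_integral_FTC_atLeast)
    show "((\<lambda>x. - (1 / x\<^sup>2)) \<longlongrightarrow> (0::real)) at_top" by real_asymp
    fix x assume "a \<le> x"
    then show "((\<lambda>x. - (1 / x\<^sup>2)) has_real_derivative 2 / x ^ 3) (at x)"
      using a by (auto intro!: derivative_eq_intros simp: power2_eq_square power3_eq_cube field_simps)
  qed (use a in auto)
  finally show ?thesis by simp
qed

lemma emeasure_nu2_atMost: "emeasure nu2 {..0} = 0"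
proof -
  have "emeasure nu2 {..0} = (\<integral>\<^sup>+x. ennreal (2 / x ^ 3) * indicator {0<..} x * indicator {..0} x \<partial>lborel)"
    unfolding nu2_def by (subst emeasure_distr) (auto simp: emeasure_density vimage_def indicator_def intro!: nn_integral_cong)
  also have "\<dots> = (\<integral>\<^sup>+x. 0 \<partial>(lborel :: real measure))" by (intro nn_integral_cong) (auto simp: indicator_def)
  finally show ?thesis by simp
qed

lemma ereal_ge_inverse_Suc:
  assumes "0 < r"
  shows "\<exists>n. ereal (1 / real (Suc n)) \<le> r"
proof (cases r)
  case (real x)
  then have "0 < x" using assms by simp
  then obtain n where "1 / real (Suc n) < x" using nat_approx_posE by (metis of_nat_Suc)
  then show ?thesis using real by (auto intro!: exI[of _ n])
qed (use assms in auto)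

lemma sigma_finite_nu2: "sigma_finite_measure nu2"
proof
  show "\<exists>A. countable A \<and> A \<subseteq> sets nu2 \<and> \<Union>A = space nu2 \<and> (\<forall>a\<in>A. emeasure nu2 a \<noteq> \<infinity>)"
  proof (intro exI conjI)
    let ?A = "insert {..0} (range (\<lambda>n. {ereal (1 / real (Suc n))..}))"
    show "countable ?A" by simp
    show "?A \<subseteq> sets nu2" by auto
    have "x \<in> \<Union>?A" for x
    proof (cases "x \<le> 0")
      case False
      then have "0 < x" by simp
      from ereal_ge_inverse_Suc[OF this] show ?thesis by auto
    qed auto
    then show "\<Union>?A = space nu2" by auto
    show "\<forall>a\<in>?A. emeasure nu2 a \<noteq> \<infinity>"
      using emeasure_nu2_atLeast by (auto simp: emeasure_nu2_atMost)
  qed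
qed

text \<open>Homogeneity of \<open>nu2\<close> of order -2, by linear substitution. It is the origin
  of the squares in all limits below.\<close>

lemma integral_nu2_scale:
  fixes f :: "ereal \<Rightarrow> real"
  assumes [measurable]: "f \<in> borel_measurable borel" and a: "0 < a"
  shows "(\<integral>r. f (r * ereal a) \<partial>nu2) = a\<^sup>2 * (\<integral>r. f r \<partial>nu2)"
proof -
  have m: "(\<lambda>r. f (r * ereal a)) \<in> borel_measurable borel" by measurable
  have "(\<integral>r. f r \<partial>nu2) = (\<integral>x. (2 / x ^ 3 * indicator {0<..} x) * f (ereal x) \<partial>lborel)"
    by (rule integral_nu2) measurable
  also have "\<dots> = \<bar>a\<bar> *\<^sub>R (\<integral>x. (2 / (0 + a * x) ^ 3 * indicator {0<..} (0 + a * x)) * f (ereal (0 + a * x)) \<partial>lborel)"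
    by (rule lborel_integral_real_affine) (use a in auto)
  also have "\<dots> = a * (\<integral>x. 1 / a ^ 3 * ((2 / x ^ 3 * indicator {0<..} x) * f (ereal x * ereal a)) \<partial>lborel)"
    using a by (auto intro!: Bochner_Integration.integral_cong simp: indicator_def zero_less_mult_iff power_mult_distrib mult.commute)
  also have "\<dots> = a * (1 / a ^ 3 * (\<integral>r. f (r * ereal a) \<partial>nu2))"
    unfolding integral_nu2[OF m] integral_mult_right_zero times_ereal.simps(1) ..
  also have "\<dots> = (\<integral>r. f (r * ereal a) \<partial>nu2) / a\<^sup>2" using a by (simp add: power2_eq_square power3_eq_cube)
  finally show ?thesis using a by (simp add: field_simps)
qed

section \<open>Test functions on the polar space\<close>

lemma compact_pos_sphere: "compact (pos_sphere :: (real ^ 'd::finite) set)"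
proof -
  have "closed {w :: real ^ 'd. \<forall>i. 0 \<le> w $ i}" by (intro closed_Collect_all closed_Collect_le continuous_intros)
  moreover have "closed {w :: real ^ 'd. norm w = 1}" by (intro closed_Collect_eq continuous_intros)
  moreover have "pos_sphere = {w :: real ^ 'd. \<forall>i. 0 \<le> w $ i} \<inter> {w. norm w = 1}" by (auto simp: pos_sphere_def)
  ultimately have "closed (pos_sphere :: (real ^ 'd) set)" by (metis closed_Int)
  moreover have "bounded (pos_sphere :: (real ^ 'd) set)" by (auto simp: pos_sphere_def bounded_iff)
  ultimately show ?thesis by (simp add: compact_eq_bounded_closed)
qed

lemma pos_sphere_borel[measurable]: "pos_sphere \<in> sets borel"
  by (rule borel_closed[OF compact_imp_closed[OF compact_pos_sphere]])

lemma polar_space_borel: "({0<..} :: ereal set) \<times> (pos_sphere :: (real ^ 'd::finite) set) \<in> sets borel"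
  unfolding borel_prod[symmetric] by (rule pair_measureI) auto

lemma measurable_angle[measurable]: "angle \<in> borel_measurable borel"
  unfolding angle_def[abs_def] by measurable

lemma angle_in_pos_sphere: "y \<noteq> 0 \<Longrightarrow> (\<And>i. 0 \<le> y $ i) \<Longrightarrow> angle y \<in> pos_sphere"
  by (simp add: angle_def pos_sphere_def)

lemma compact_polar: 
  "compact ({ereal b..} \<times> (pos_sphere :: (real ^ 'd::finite) set))"
  by (intro compact_Times compact_pos_sphere compact_Int_closed[OF compact_UNIV closed_atLeast, simplified])

text \<open>Stands for compact support in vague convergence: every compact subset of
  \<open>{0<..} \<times> pos_sphere\<close> lies in one of the compact sets
  \<open>{ereal b..} \<times> pos_sphere\<close> with \<open>0 < b\<close>.\<close>

definition vanishes_below :: "real \<Rightarrow> (ereal \<times> (real ^ 'd::finite) \<Rightarrow> real) \<Rightarrow> bool" where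
  "vanishes_below b g \<longleftrightarrow> (\<forall>x. x \<notin> {ereal b..} \<times> pos_sphere \<longrightarrow> g x = 0)"

lemma polar_function_measurable:
  fixes g :: "ereal \<times> (real ^ 'd::finite) \<Rightarrow> real"
  assumes g: "continuous_on ({0<..} \<times> pos_sphere) g" and b: "0 < b" and z: "vanishes_below b g"
  shows "g \<in> borel_measurable borel"
proof -
  have "(\<lambda>x. if x \<in> {0<..} \<times> pos_sphere then g x else 0) \<in> borel_measurable borel"
    by (intro borel_measurable_continuous_on_if polar_space_borel g continuous_on_const)
  also have "(\<lambda>x. if x \<in> {0<..} \<times> pos_sphere then g x else 0) = g"
  proof
    fix x show "(if x \<in> {0<..} \<times> pos_sphere then g x else 0) = g x"
      using z b by (cases x) (auto simp: vanishes_below_def less_le_trans[of 0 "ereal b"])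
  qed
  finally show ?thesis .
qed

lemma polar_function_bounded:
  fixes g :: "ereal \<times> (real ^ 'd::finite) \<Rightarrow> real"
  assumes g: "continuous_on ({0<..} \<times> pos_sphere) g" and b: "0 < b" and z: "vanishes_below b g"
  obtains C where "\<And>x. \<bar>g x\<bar> \<le> C" "0 \<le> C"
proof -
  have "{ereal b..} \<times> pos_sphere \<subseteq> {0<..} \<times> pos_sphere" using b less_le_trans[of 0 "ereal b"] by auto
  then have "bounded (g ` ({ereal b..} \<times> pos_sphere))"
    using g by (intro compact_imp_bounded compact_continuous_image compact_polar) (rule continuous_on_subset)
  then obtain C where C: "\<And>x. x \<in> {ereal b..} \<times> pos_sphere \<Longrightarrow> \<bar>g x\<bar> \<le> C" by (auto simp: bounded_iff)
  have "\<bar>g x\<bar> \<le> max C 0" for x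
    using C[of x] z by (cases "x \<in> {ereal b..} \<times> pos_sphere") (auto simp: vanishes_below_def simp del: mem_Times_iff split_paired_All)
  then show ?thesis using that[of "max C 0"] by simp
qed

text \<open>Fubini applies because \<open>g\<close> is bounded and lives on radii of at least
  \<open>b\<close>, a set of finite mass under \<open>nu2\<close>.\<close>

lemma integral_nu2_pair:
  fixes g :: "ereal \<times> (real ^ 'd::finite) \<Rightarrow> real"
  assumes g: "continuous_on ({0<..} \<times> pos_sphere) g" and b: "0 < b" and z: "vanishes_below b g"
    and H: "finite_measure H" and sH: "sets H = sets borel"
  shows "(\<integral>x. g x \<partial>(nu2 \<Otimes>\<^sub>M H)) = (\<integral>w. \<integral>r. g (r, w) \<partial>nu2 \<partial>H)"
proof -
  interpret H: finite_measure H by fact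
  interpret nu2: sigma_finite_measure nu2 by (rule sigma_finite_nu2)
  interpret pair_sigma_finite nu2 H by unfold_locales
  note [measurable_cong] = sH
  have sP: "sets (nu2 \<Otimes>\<^sub>M H) = sets borel"
    using sH by (simp add: borel_prod[symmetric] cong: sets_pair_measure_cong)
  obtain C where C: "\<And>x. \<bar>g x\<bar> \<le> C" "0 \<le> C" using polar_function_bounded[OF g b z] by blast
  have "g \<in> borel_measurable borel" by (rule polar_function_measurable[OF g b z])
  then have gm[measurable]: "g \<in> borel_measurable (nu2 \<Otimes>\<^sub>M H)" using sP by (simp cong: measurable_cong_sets)
  have "integrable (nu2 \<Otimes>\<^sub>M H) (\<lambda>x. C * indicat_real ({ereal b..} \<times> space H) x)"
  proof (intro integrable_mult_right integrable_real_indicator)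
    show "{ereal b..} \<times> space H \<in> sets (nu2 \<Otimes>\<^sub>M H)" by (intro pair_measureI) auto
    have "emeasure (nu2 \<Otimes>\<^sub>M H) ({ereal b..} \<times> space H) = emeasure nu2 {ereal b..} * emeasure H (space H)"
      by (rule H.emeasure_pair_measure_Times) auto
    also have "\<dots> < \<infinity>" using b H.emeasure_finite[of "space H"]
      by (simp add: emeasure_nu2_atLeast ennreal_mult_eq_top_iff less_top[symmetric])
    finally show "emeasure (nu2 \<Otimes>\<^sub>M H) ({ereal b..} \<times> space H) < \<infinity>" .
  qed
  then have "integrable (nu2 \<Otimes>\<^sub>M H) g"
  proof (rule Bochner_Integration.integrable_bound)
    have "space H = UNIV" using sets_eq_imp_space_eq[OF sH] by simp
    then show "AE x in nu2 \<Otimes>\<^sub>M H. norm (g x) \<le> norm (C * indicat_real ({ereal b..} \<times> space H) x)"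
      using C z by (intro AE_I2) (auto simp: vanishes_below_def indicator_def)
  qed measurable
  then have "integrable (nu2 \<Otimes>\<^sub>M H) (case_prod (\<lambda>r w. g (r, w)))" by simp
  from integral_snd[OF this] show ?thesis by simp
qed

lemma spectral_measure_ofD:
  fixes g :: "ereal \<times> (real ^ 'd::finite) \<Rightarrow> real"
  assumes Y[measurable]: "Y \<in> borel_measurable M" and spec: "spectral_measure_of M Y H"
    and g: "continuous_on ({0<..} \<times> pos_sphere) g" and b: "0 < b" and z: "vanishes_below b g"
  shows "(\<lambda>n. real n * (\<integral>x. g (ereal (norm (Y x) / sqrt (real n)), angle (Y x)) \<partial>M)) \<longlonglongrightarrow> (\<integral>w. \<integral>r. g (r, w) \<partial>nu2 \<partial>H)"
proof -
  have H: "finite_measure H" "sets H = sets borel" using spec by (auto simp: spectral_measure_of_def)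
  have gm[measurable]: "g \<in> borel_measurable borel" by (rule polar_function_measurable[OF g b z])
  have "{ereal b..} \<times> pos_sphere \<subseteq> {0<..} \<times> (pos_sphere :: (real ^ 'd) set)" using b less_le_trans[of 0 "ereal b"] by auto
  then have "(\<lambda>n. \<integral>x. g x \<partial>scale_measure (of_nat n)
              (distr M borel (\<lambda>x. (ereal (norm (Y x) / sqrt (real n)), angle (Y x))))) \<longlonglongrightarrow> (\<integral>x. g x \<partial>(nu2 \<Otimes>\<^sub>M H))"
    using spec z g compact_polar[of b] unfolding spectral_measure_of_def vague_conv_on_def vanishes_below_def by blast
  moreover have "(\<integral>x. g x \<partial>scale_measure (of_nat n) (distr M borel (\<lambda>x. (ereal (norm (Y x) / sqrt (real n)), angle (Y x)))))
      = real n * (\<integral>x. g (ereal (norm (Y x) / sqrt (real n)), angle (Y x)) \<partial>M)" for n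
  proof -
    have [measurable]: "(\<lambda>x. (ereal (norm (Y x) / sqrt (real n)), angle (Y x))) \<in> borel_measurable M"
      unfolding borel_prod[symmetric] by measurable
    have "(of_nat n :: ennreal) = ennreal (real n)" by (simp add: ennreal_of_nat_eq_real_of_nat)
    then show ?thesis by (simp add: integral_scale_measure integral_distr)
  qed
  ultimately show ?thesis by (simp add: integral_nu2_pair[OF g b z H])
qed

text \<open>A real coordinate for the radius that is continuous up to infinity, where it takes the
  value 0.\<close>

definition recip :: "ereal \<Rightarrow> real" where
  "recip r = real_of_ereal (inverse r)"

lemma continuous_on_recip: "continuous_on {0<..} recip"
proof -
  have "continuous_on {0<..} (inverse :: ereal \<Rightarrow> ereal)"
    by (rule continuous_on_subset[OF continuous_on_inverse_ereal]) auto
  moreover have "continuous_on ((inverse :: ereal \<Rightarrow> ereal) ` {0<..}) real_of_ereal"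
    by (rule continuous_on_subset[OF continuous_on_real]) (auto simp: ereal_inverse_eq_0 less_imp_neq)
  ultimately show ?thesis unfolding recip_def[abs_def] using continuous_on_compose2 by blast
qed

lemma recip_ereal: "recip (ereal x) = inverse x" 
  by (cases "x = 0") (auto simp: recip_def)

lemma recip_measurable[measurable]: "recip \<in> borel_measurable borel"
  unfolding recip_def[abs_def] by measurable

text \<open>Continuous approximation of the indicator of \<open>{1<..}\<close>, as a function of the reciprocal in order to be
  continuous at \<open>\<infinity>\<close>.\<close>

definition ramp :: "real \<Rightarrow> real \<Rightarrow> real" where
  "ramp e y = max 0 (min 1 ((1 - y) * ((1 + e) / e)))"

lemma ramp_bounds: "0 \<le> ramp e y" "ramp e y \<le> 1" by (auto simp: ramp_def)

lemma ramp_eq_0: "0 < e \<Longrightarrow> 1 \<le> y \<Longrightarrow> ramp e y = 0"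
proof -
  assume e: "0 < e" and y: "1 \<le> y"
  then have "(1 - y) * ((1 + e) / e) \<le> 0" by (intro mult_nonpos_nonneg) auto
  then show ?thesis unfolding ramp_def by linarith
qed

lemma ramp_eq_1: "0 < e \<Longrightarrow> y \<le> 1 / (1 + e) \<Longrightarrow> ramp e y = 1"
proof -
  assume e: "0 < e" and y: "y \<le> 1 / (1 + e)"
  have "1 = (1 - 1 / (1 + e)) * ((1 + e) / e)" using e by (simp add: field_simps add_pos_pos less_imp_neq[symmetric])
  also have "\<dots> \<le> (1 - y) * ((1 + e) / e)" using e y by (intro mult_right_mono) auto
  finally show ?thesis by (simp add: ramp_def)
qed

lemma ramp_measurable[measurable]: "ramp e \<in> borel_measurable borel"
  unfolding ramp_def[abs_def] by measurable

lemma ramp_recip_le: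
  assumes e: "0 < e"
  shows "indicat_real {0<..} r * ramp e (recip r) \<le> indicat_real {ereal 1..} r"
proof (cases "ereal 1 \<le> r \<or> r \<le> 0")
  case True
  then show ?thesis
  proof
    assume "ereal 1 \<le> r"
    then have "indicat_real {ereal 1..} r = 1" by simp
    then show ?thesis using ramp_bounds(2)[of e] by (simp add: indicator_def)
  qed simp
next
  case False
  then obtain x where x: "r = ereal x" "0 < x" "x < 1" by (cases r) (auto simp: one_ereal_def)
  then have "1 \<le> recip r" by (simp add: recip_ereal one_le_inverse_iff)
  then show ?thesis by (simp add: ramp_eq_0[OF e])
qed

lemma ramp_recip_ge:
  assumes e: "0 < e" and "r \<noteq> \<infinity>"
  shows "indicat_real {ereal (1 + e)..} r \<le> indicat_real {0<..} r * ramp e (recip r)"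
proof (cases "ereal (1 + e) \<le> r")
  case True
  then obtain x where x: "r = ereal x" "1 + e \<le> x" using assms by (cases r) auto
  then have "inverse x \<le> inverse (1 + e)" using e by (intro le_imp_inverse_le) auto
  then have "ramp e (recip r) = 1" using e by (simp add: x recip_ereal ramp_eq_1 inverse_eq_divide)
  then show ?thesis using x e by simp
next
  case False
  then show ?thesis using ramp_bounds(1)[of e] by (simp add: indicator_def)
qed

lemma nu2_atLeast:
  assumes "0 < a"
  shows "(\<integral>r. indicat_real {ereal a..} r \<partial>nu2) = 1 / a\<^sup>2" "integrable nu2 (indicat_real {ereal a..})"
  using assms by (auto simp: measure_def emeasure_nu2_atLeast intro!: integrable_real_indicator)

lemma integrable_nu2_ramp:
  assumes e: "0 < e"
  shows "integrable nu2 (\<lambda>r. indicat_real {0<..} r * ramp e (recip r))"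
proof (rule Bochner_Integration.integrable_bound[OF nu2_atLeast(2)[of 1]])
  have "norm (indicat_real {0<..} r * ramp e (recip r)) = indicat_real {0<..} r * ramp e (recip r)" for r
    using ramp_bounds(1)[of e] by simp
  then show "AE r in nu2. norm (indicat_real {0<..} r * ramp e (recip r)) \<le> norm (indicat_real {ereal 1..} r)"
    using ramp_recip_le[OF e] by (intro AE_I2) simp
qed simp_all

text \<open>The ramp lies between the indicators of \<open>{1 + e..}\<close> and
  \<open>{1..}\<close> at all finite radii, and \<open>nu2\<close> gives no mass to
  infinity.\<close>

lemma integral_nu2_ramp_bounds:
  assumes e: "0 < e"
  shows "(\<integral>r. indicat_real {0<..} r * ramp e (recip r) \<partial>nu2) \<le> 1"
    and "1 / (1 + e)\<^sup>2 \<le> (\<integral>r. indicat_real {0<..} r * ramp e (recip r) \<partial>nu2)"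
proof -
  have fin: "AE r in nu2. r \<noteq> \<infinity>"
    unfolding nu2_def by (subst AE_distr_iff) auto
  have "(\<integral>r. indicat_real {0<..} r * ramp e (recip r) \<partial>nu2) \<le> (\<integral>r. indicat_real {ereal 1..} r \<partial>nu2)"
    by (intro integral_mono integrable_nu2_ramp e nu2_atLeast ramp_recip_le) simp
  then show "(\<integral>r. indicat_real {0<..} r * ramp e (recip r) \<partial>nu2) \<le> 1" using nu2_atLeast(1)[of 1] by simp
  have "(\<integral>r. indicat_real {ereal (1 + e)..} r \<partial>nu2) \<le> (\<integral>r. indicat_real {0<..} r * ramp e (recip r) \<partial>nu2)"
  proof (intro integral_mono_AE integrable_nu2_ramp e nu2_atLeast)
    show "AE r in nu2. indicat_real {ereal (1 + e)..} r \<le> indicat_real {0<..} r * ramp e (recip r)"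
      using fin by eventually_elim (rule ramp_recip_ge[OF e])
  qed (use e in simp)
  then show "1 / (1 + e)\<^sup>2 \<le> (\<integral>r. indicat_real {0<..} r * ramp e (recip r) \<partial>nu2)" using nu2_atLeast(1)[of "1 + e"] e by simp
qed

section \<open>Exceedances of homogeneous functions under regular variation\<close>

locale regular_variation = prob_space M for M :: "'a measure" +
  fixes Y :: "'a \<Rightarrow> real ^ 'd::finite" and H :: "(real ^ 'd) measure"
  assumes Y[measurable]: "Y \<in> borel_measurable M" and nonneg: "AE x in M. \<forall>i. 0 \<le> Y x $ i"
    and spec: "spectral_measure_of M Y H"
begin

lemma sets_H[measurable_cong, simp]: "sets H = sets borel" and finite_H: "finite_measure H"
  using spec by (auto simp: spectral_measure_of_def)

lemma AE_H: "AE w in H. w \<in> pos_sphere"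
proof (rule AE_I)
  show "emeasure H (- pos_sphere) = 0" using spec by (auto simp: spectral_measure_of_def)
qed auto

lemma integrable_H:
  fixes f :: "real ^ 'd \<Rightarrow> real"
  assumes "f \<in> borel_measurable borel" "continuous_on pos_sphere f"
  shows "integrable H f"
proof -
  interpret H: finite_measure H by (rule finite_H)
  have "bounded (f ` pos_sphere)" using assms(2) by (intro compact_imp_bounded compact_continuous_image compact_pos_sphere)
  then obtain C where "\<And>w. w \<in> pos_sphere \<Longrightarrow> norm (f w) \<le> C" by (auto simp: bounded_iff)
  then show ?thesis by (intro H.integrable_const_bound[where B=C]) (use AE_H assms in auto)
qed

lemma AE_angle: "AE x in M. Y x = 0 \<or> angle (Y x) \<in> pos_sphere"
  using nonneg by eventually_elim (auto intro: angle_in_pos_sphere)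

text \<open>The event is that a positively homogeneous function of \<open>Y\<close>, given on the
  sphere by \<open>m\<close>, exceeds sqrt n. For \<open>\<phi>\<close> equal to 1, a component or a
  maximum of components as \<open>m\<close> yields the prelimit of a squared scaling;
  \<open>m\<close> equal to 1 yields weighted tails of the norm.\<close>

definition exceed :: "(real ^ 'd \<Rightarrow> real) \<Rightarrow> (real ^ 'd \<Rightarrow> real) \<Rightarrow> nat \<Rightarrow> real" where
  "exceed \<phi> m n = real n * (\<integral>x. \<phi> (angle (Y x)) * of_bool (sqrt (real n) < norm (Y x) * m (angle (Y x))) \<partial>M)"

context
  fixes \<phi> :: "real ^ 'd \<Rightarrow> real"
  assumes \<phi>[measurable]: "\<phi> \<in> borel_measurable borel" and \<phi>c: "continuous_on pos_sphere \<phi>"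
    and \<phi>0: "\<And>w. w \<in> pos_sphere \<Longrightarrow> 0 \<le> \<phi> w"
begin

lemma phi_bounded:
  obtains C where "\<And>w. w \<in> pos_sphere \<Longrightarrow> \<bar>\<phi> w\<bar> \<le> C" "0 \<le> C"
proof -
  have "bounded (\<phi> ` pos_sphere)" by (intro compact_imp_bounded compact_continuous_image compact_pos_sphere \<phi>c)
  then obtain C where C: "\<And>w. w \<in> pos_sphere \<Longrightarrow> \<bar>\<phi> w\<bar> \<le> C" by (auto simp: bounded_iff)
  show ?thesis by (rule that[of "max C 0"]) (auto dest: C)
qed

lemma integrable_exceed:
  assumes [measurable]: "Measurable.pred M P" and P: "\<And>x. P x \<Longrightarrow> Y x \<noteq> 0"
  shows "integrable M (\<lambda>x. \<phi> (angle (Y x)) * of_bool (P x))"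
proof -
  obtain C where C: "\<And>w. w \<in> pos_sphere \<Longrightarrow> \<bar>\<phi> w\<bar> \<le> C" "0 \<le> C" using phi_bounded by blast
  have [measurable]: "(\<lambda>x. of_bool (P x) :: real) \<in> borel_measurable M" unfolding of_bool_def by measurable
  show ?thesis
  proof (rule integrable_const_bound[where B=C])
    show "AE x in M. norm (\<phi> (angle (Y x)) * of_bool (P x)) \<le> C"
      using AE_angle by eventually_elim (auto simp: C of_bool_def dest: P)
  qed measurable
qed

text \<open>The test function is \<open>\<phi> w * ramp e (recip r / m w)\<close>. Since
  \<open>m\<close> is positive on the compact sphere, it is continuous up to infinity and vanishes
  for small radii. The radial integral is evaluated by homogeneity, which produces the factor
  \<open>(m w)\<^sup>2\<close>.\<close>

lemma tendsto_ramp: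
  assumes m[measurable]: "m \<in> borel_measurable borel" and mc: "continuous_on pos_sphere m"
    and m0: "\<And>w. w \<in> pos_sphere \<Longrightarrow> 0 < m w" and e: "0 < e"
  shows "(\<lambda>n. real n * (\<integral>x. \<phi> (angle (Y x)) * (of_bool (Y x \<noteq> 0 \<and> 0 < n) * ramp e (sqrt (real n) / (norm (Y x) * m (angle (Y x))))) \<partial>M))
     \<longlonglongrightarrow> (\<integral>r. indicat_real {0<..} r * ramp e (recip r) \<partial>nu2) * (\<integral>w. \<phi> w * (m w)\<^sup>2 \<partial>H)"
proof -
  have "bounded (m ` pos_sphere)" by (intro compact_imp_bounded compact_continuous_image compact_pos_sphere mc)
  then obtain B where "\<And>w. w \<in> pos_sphere \<Longrightarrow> \<bar>m w\<bar> \<le> B" by (auto simp: bounded_iff)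
  then have B: "\<And>w. w \<in> pos_sphere \<Longrightarrow> m w \<le> max B 1" by (auto simp: abs_le_iff le_max_iff_disj)
  \<comment> \<open>Below this radius \<open>r * m w\<close> is at most 1 for every direction, so
    the ramp vanishes; the maximum with 1 only keeps \<open>b\<close> well defined and
    positive.\<close>
  define b where "b = 1 / max B 1"
  have b: "0 < b" by (simp add: b_def)
  define g where "g p = (if p \<in> {0<..} \<times> pos_sphere then \<phi> (snd p) * ramp e (recip (fst p) / m (snd p)) else 0)" for p
  have g: "continuous_on ({0<..} \<times> pos_sphere) g"
  proof -
    have "continuous_on ({0<..} \<times> pos_sphere) (\<lambda>p. \<phi> (snd p) * ramp e (recip (fst p) / m (snd p)))"
      unfolding ramp_def
      by (intro continuous_intros continuous_on_compose2[OF \<phi>c] continuous_on_compose2[OF mc] continuous_on_compose2[OF continuous_on_recip])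
         (use e in \<open>auto dest!: m0\<close>)
    then show ?thesis by (simp add: g_def cong: continuous_on_cong)
  qed
  have z: "vanishes_below b g"
    unfolding vanishes_below_def
  proof (intro allI impI)
    fix p :: "ereal \<times> (real ^ 'd)" assume p: "p \<notin> {ereal b..} \<times> pos_sphere"
    obtain r w where rw: "p = (r, w)" by (cases p)
    show "g p = 0"
    proof (cases "0 < r \<and> w \<in> pos_sphere")
      case True
      then have "r < ereal b" using p rw by auto
      then obtain x where x: "r = ereal x" "0 < x" "x < b" using True by (cases r) auto
      have "m w \<le> inverse x"
      proof -
        have "x * max B 1 < 1" using x by (simp add: b_def field_simps)
        moreover have "x * m w \<le> x * max B 1" using B[of w] x True by (intro mult_left_mono) auto
        ultimately have "x * m w \<le> 1" by linarith
        then show ?thesis using x by (simp add: field_simps inverse_eq_divide)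
      qed
      then have "1 \<le> recip r / m w" using True m0[of w] by (simp add: x recip_ereal)
      then show ?thesis by (simp add: g_def ramp_eq_0 e rw)
    qed (auto simp: g_def rw)
  qed
  have "(\<lambda>n. real n * (\<integral>x. g (ereal (norm (Y x) / sqrt (real n)), angle (Y x)) \<partial>M)) \<longlonglongrightarrow> (\<integral>w. \<integral>r. g (r, w) \<partial>nu2 \<partial>H)"
    by (rule spectral_measure_ofD[OF Y spec g b z])
  moreover have "(\<integral>w. \<integral>r. g (r, w) \<partial>nu2 \<partial>H) = (\<integral>r. indicat_real {0<..} r * ramp e (recip r) \<partial>nu2) * (\<integral>w. \<phi> w * (m w)\<^sup>2 \<partial>H)"
  proof -
    have "(\<integral>w. \<integral>r. g (r, w) \<partial>nu2 \<partial>H) = (\<integral>w. (\<integral>r. indicat_real {0<..} r * ramp e (recip r) \<partial>nu2) * (\<phi> w * (m w)\<^sup>2) \<partial>H)"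
    proof (rule integral_cong_AE)
      show "AE w in H. (\<integral>r. g (r, w) \<partial>nu2) = (\<integral>r. indicat_real {0<..} r * ramp e (recip r) \<partial>nu2) * (\<phi> w * (m w)\<^sup>2)"
        using AE_H
      proof eventually_elim
        case (elim w)
        have mw: "0 < m w" using m0 elim by simp
        have "(\<integral>r. g (r, w) \<partial>nu2) = (\<integral>r. \<phi> w * (\<lambda>r. indicat_real {0<..} r * ramp e (recip r)) (r * ereal (m w)) \<partial>nu2)"
        proof (rule Bochner_Integration.integral_cong[OF refl])
          fix r
          show "g (r, w) = \<phi> w * (\<lambda>r. indicat_real {0<..} r * ramp e (recip r)) (r * ereal (m w))"
          proof (cases r)
            case (real x)
            then show ?thesis using mw elim
              by (simp add: g_def recip_ereal indicator_def zero_less_mult_iff inverse_eq_divide)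
          qed (use mw elim in \<open>auto simp: g_def recip_def indicator_def\<close>)
        qed
        also have "\<dots> = \<phi> w * ((m w)\<^sup>2 * (\<integral>r. indicat_real {0<..} r * ramp e (recip r) \<partial>nu2))"
          using integral_nu2_scale[of "\<lambda>r. indicat_real {0<..} r * ramp e (recip r)" "m w"] mw by simp
        finally show ?case by simp
      qed
      show "(\<lambda>w. \<integral>r. g (r, w) \<partial>nu2) \<in> borel_measurable H"
      proof -
        interpret nu2: sigma_finite_measure nu2 by (rule sigma_finite_nu2)
        have "g \<in> borel_measurable borel" by (rule polar_function_measurable[OF g b z])
        then have [measurable]: "g \<in> borel_measurable (borel \<Otimes>\<^sub>M borel)" by (simp add: borel_prod)
        have "(\<lambda>(w, r). g (r, w)) \<in> borel_measurable (H \<Otimes>\<^sub>M nu2)" by measurable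
        then show ?thesis using nu2.borel_measurable_lebesgue_integral by fastforce
      qed
    qed measurable
    then show ?thesis by simp
  qed
  moreover have "(\<integral>x. g (ereal (norm (Y x) / sqrt (real n)), angle (Y x)) \<partial>M)
     = (\<integral>x. \<phi> (angle (Y x)) * (of_bool (Y x \<noteq> 0 \<and> 0 < n) * ramp e (sqrt (real n) / (norm (Y x) * m (angle (Y x))))) \<partial>M)" for n
  proof (rule integral_cong_AE)
    show "AE x in M. g (ereal (norm (Y x) / sqrt (real n)), angle (Y x)) = \<phi> (angle (Y x)) * (of_bool (Y x \<noteq> 0 \<and> 0 < n) * ramp e (sqrt (real n) / (norm (Y x) * m (angle (Y x)))))"
      using AE_angle
    proof eventually_elim
      case (elim x)
      show ?case
        using elim by (cases "n = 0"; cases "Y x = 0") (auto simp: g_def recip_ereal inverse_eq_divide)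
    qed
    have "g \<in> borel_measurable borel" by (rule polar_function_measurable[OF g b z])
    then have [measurable]: "g \<in> borel_measurable (borel \<Otimes>\<^sub>M borel)" by (simp add: borel_prod)
    show "(\<lambda>x. g (ereal (norm (Y x) / sqrt (real n)), angle (Y x))) \<in> borel_measurable M" by measurable
    show "(\<lambda>x. \<phi> (angle (Y x)) * (of_bool (Y x \<noteq> 0 \<and> 0 < n) * ramp e (sqrt (real n) / (norm (Y x) * m (angle (Y x)))))) \<in> borel_measurable M"
      unfolding of_bool_def by measurable
  qed
  ultimately show ?thesis by simp
qed

text \<open>The indicator lies between the ramps for \<open>m\<close> and for
  \<open>(1 + e) * m\<close>. Their limits are I(e) P and I(e) (1 + e)^2 P with I(e) between 1 / (1
  + e)^2 and 1, and both tend to P as e tends to 0.\<close>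

lemma tendsto_exceed_pos:
  assumes m[measurable]: "m \<in> borel_measurable borel" and mc: "continuous_on pos_sphere m"
    and m0: "\<And>w. w \<in> pos_sphere \<Longrightarrow> 0 < m w"
  shows "exceed \<phi> m \<longlonglongrightarrow> (\<integral>w. \<phi> w * (m w)\<^sup>2 \<partial>H)"
proof -
  define P where "P = (\<integral>w. \<phi> w * (m w)\<^sup>2 \<partial>H)"
  define I where "I e = (\<integral>r. indicat_real {0<..} r * ramp e (recip r) \<partial>nu2)" for e
  define L where "L m e n = real n * (\<integral>x. \<phi> (angle (Y x)) * (of_bool (Y x \<noteq> 0 \<and> 0 < n) * ramp e (sqrt (real n) / (norm (Y x) * m (angle (Y x))))) \<partial>M)" for m e n
  have P0: "0 \<le> P" unfolding P_def by (intro integral_nonneg_AE) (use AE_H in eventually_elim, simp add: \<phi>0)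
  obtain C where C: "\<And>w. w \<in> pos_sphere \<Longrightarrow> \<bar>\<phi> w\<bar> \<le> C" "0 \<le> C" using phi_bounded by blast
  have Lint: "integrable M (\<lambda>x. \<phi> (angle (Y x)) * (of_bool (Y x \<noteq> 0 \<and> 0 < n) * ramp e (sqrt (real n) / (norm (Y x) * m (angle (Y x))))))"
    if [measurable]: "m \<in> borel_measurable borel" for m :: "real ^ 'd \<Rightarrow> real" and n :: nat and e
  proof (rule integrable_const_bound[where B=C])
    show "AE x in M. norm (\<phi> (angle (Y x)) * (of_bool (Y x \<noteq> 0 \<and> 0 < n) * ramp e (sqrt (real n) / (norm (Y x) * m (angle (Y x)))))) \<le> C"
      using AE_angle
    proof eventually_elim
      case (elim x)
      show ?case
      proof (cases "Y x = 0")
        case False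
        then have "\<bar>\<phi> (angle (Y x))\<bar> * (of_bool (Y x \<noteq> 0 \<and> 0 < n) * \<bar>ramp e (sqrt (real n) / (norm (Y x) * m (angle (Y x))))\<bar>) \<le> C * 1"
          using elim C ramp_bounds by (intro mult_mono) (auto simp: of_bool_def abs_le_iff order_trans[OF _ ramp_bounds(1)])
        then show ?thesis by (simp add: abs_mult)
      qed (use C in auto)
    qed
    show "(\<lambda>x. \<phi> (angle (Y x)) * (of_bool (Y x \<noteq> 0 \<and> 0 < n) * ramp e (sqrt (real n) / (norm (Y x) * m (angle (Y x)))))) \<in> borel_measurable M"
      unfolding of_bool_def by measurable
  qed
  have Eint: "integrable M (\<lambda>x. \<phi> (angle (Y x)) * of_bool (sqrt (real n) < norm (Y x) * m (angle (Y x))))" for n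
    by (rule integrable_exceed) (auto, measurable)
  have lower: "L m e n \<le> exceed \<phi> m n" if e: "0 < e" for e n
    unfolding L_def exceed_def
  proof (intro mult_left_mono integral_mono_AE Lint Eint m)
    show "AE x in M. \<phi> (angle (Y x)) * (of_bool (Y x \<noteq> 0 \<and> 0 < n) * ramp e (sqrt (real n) / (norm (Y x) * m (angle (Y x))))) \<le> \<phi> (angle (Y x)) * of_bool (sqrt (real n) < norm (Y x) * m (angle (Y x)))"
      using AE_angle
    proof eventually_elim
      case (elim x)
      show ?case
      proof (cases "Y x = 0")
        case False
        then have a: "angle (Y x) \<in> pos_sphere" using elim by simp
        have "0 < norm (Y x) * m (angle (Y x))" using False m0[OF a] by simp
        then have "ramp e (sqrt (real n) / (norm (Y x) * m (angle (Y x)))) \<le> of_bool (sqrt (real n) < norm (Y x) * m (angle (Y x)))"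
          using ramp_bounds[of e] ramp_eq_0[OF e] by (auto simp: of_bool_def)
        then show ?thesis using \<phi>0[OF a] ramp_bounds(1)[of e] by (intro mult_left_mono) (auto simp: of_bool_def)
      qed simp
    qed
  qed simp
  have upper: "exceed \<phi> m n \<le> L (\<lambda>w. (1 + e) * m w) e n" if e: "0 < e" for e n
  proof (cases "n = 0")
    case True
    then show ?thesis by (simp add: L_def exceed_def)
  next
    case n: False
    show ?thesis
      unfolding L_def exceed_def
    proof (intro mult_left_mono integral_mono_AE Lint Eint)
    show "AE x in M. \<phi> (angle (Y x)) * of_bool (sqrt (real n) < norm (Y x) * m (angle (Y x))) \<le> \<phi> (angle (Y x)) * (of_bool (Y x \<noteq> 0 \<and> 0 < n) * ramp e (sqrt (real n) / (norm (Y x) * ((1 + e) * m (angle (Y x))))))"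
      using AE_angle
    proof eventually_elim
      case (elim x)
      show ?case
      proof (cases "Y x = 0")
        case False
        then have a: "angle (Y x) \<in> pos_sphere" using elim by simp
        have p: "0 < norm (Y x) * m (angle (Y x))" using False m0[OF a] by simp
        have "of_bool (sqrt (real n) < norm (Y x) * m (angle (Y x))) \<le> ramp e (sqrt (real n) / (norm (Y x) * ((1 + e) * m (angle (Y x)))))"
        proof (cases "sqrt (real n) < norm (Y x) * m (angle (Y x))")
          case True
          have "sqrt (real n) / (norm (Y x) * ((1 + e) * m (angle (Y x)))) = sqrt (real n) / (norm (Y x) * m (angle (Y x))) * (1 / (1 + e))"
            by simp
          also have "\<dots> \<le> 1 * (1 / (1 + e))" using True p e by (intro mult_right_mono) auto
          finally show ?thesis using ramp_eq_1[OF e] by simp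
        qed (simp add: ramp_bounds)
        then show ?thesis using \<phi>0[OF a] False n by (intro mult_left_mono) auto
      qed simp
    qed
    show "(\<lambda>w. (1 + e) * m w) \<in> borel_measurable borel" by measurable
    qed simp
  qed
  have limL: "L m e \<longlonglongrightarrow> I e * P" and limU: "L (\<lambda>w. (1 + e) * m w) e \<longlonglongrightarrow> I e * ((1 + e)\<^sup>2 * P)" if e: "0 < e" for e
  proof -
    show "L m e \<longlonglongrightarrow> I e * P" unfolding L_def I_def P_def by (rule tendsto_ramp[OF m mc m0 e])
    have "L (\<lambda>w. (1 + e) * m w) e \<longlonglongrightarrow> I e * (\<integral>w. \<phi> w * ((1 + e) * m w)\<^sup>2 \<partial>H)"
      unfolding L_def I_def by (rule tendsto_ramp) (use e m0 in \<open>auto intro!: continuous_intros mc\<close>)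
    moreover have "(\<integral>w. \<phi> w * ((1 + e) * m w)\<^sup>2 \<partial>H) = (\<integral>w. (1 + e)\<^sup>2 * (\<phi> w * (m w)\<^sup>2) \<partial>H)"
      by (intro Bochner_Integration.integral_cong) (auto simp: power_mult_distrib)
    ultimately show "L (\<lambda>w. (1 + e) * m w) e \<longlonglongrightarrow> I e * ((1 + e)\<^sup>2 * P)" by (simp add: P_def)
  qed
  show ?thesis unfolding P_def[symmetric]
  proof (rule order_tendstoI)
    fix a assume a: "a < P"
    have "((\<lambda>e. 1 / (1 + e)\<^sup>2 * P) \<longlongrightarrow> 1 / (1 + 0)\<^sup>2 * P) (at_right 0)" by (intro tendsto_intros) auto
    then have "((\<lambda>e. 1 / (1 + e)\<^sup>2 * P) \<longlongrightarrow> P) (at_right 0)" by simp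
    then have "eventually (\<lambda>e. a < 1 / (1 + e)\<^sup>2 * P \<and> 0 < e) (at_right 0)"
      using a by (intro eventually_conj eventually_at_right_less) (auto dest: order_tendstoD)
    then obtain e where e: "a < 1 / (1 + e)\<^sup>2 * P" "0 < e"
      using eventually_happens'[of "at_right (0::real)"] by (auto simp: trivial_limit_at_right_real)
    have "1 / (1 + e)\<^sup>2 * P \<le> I e * P" using integral_nu2_ramp_bounds(2)[OF e(2)] P0 by (intro mult_right_mono) (auto simp: I_def)
    then have "eventually (\<lambda>n. a < L m e n) sequentially" using less_le_trans[OF e(1)] by (intro order_tendstoD(1)[OF limL[OF e(2)]])
    then show "eventually (\<lambda>n. a < exceed \<phi> m n) sequentially"
      by eventually_elim (use lower[OF e(2)] less_le_trans in blast)
  next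
    fix a assume a: "P < a"
    have "((\<lambda>e. (1 + e)\<^sup>2 * P) \<longlongrightarrow> (1 + 0)\<^sup>2 * P) (at_right 0)" by (intro tendsto_intros)
    then have "((\<lambda>e. (1 + e)\<^sup>2 * P) \<longlongrightarrow> P) (at_right 0)" by simp
    then have "eventually (\<lambda>e. (1 + e)\<^sup>2 * P < a \<and> 0 < e) (at_right 0)"
      using a by (intro eventually_conj eventually_at_right_less) (auto dest: order_tendstoD)
    then obtain e where e: "(1 + e)\<^sup>2 * P < a" "0 < e"
      using eventually_happens'[of "at_right (0::real)"] by (auto simp: trivial_limit_at_right_real)
    have "I e * ((1 + e)\<^sup>2 * P) \<le> 1 * ((1 + e)\<^sup>2 * P)" using integral_nu2_ramp_bounds(1)[OF e(2)] P0 by (intro mult_right_mono) (auto simp: I_def)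
    then have "eventually (\<lambda>n. L (\<lambda>w. (1 + e) * m w) e n < a) sequentially" using e(1) by (intro order_tendstoD(2)[OF limU[OF e(2)]]) simp
    then show "eventually (\<lambda>n. exceed \<phi> m n < a) sequentially"
      by eventually_elim (use upper[OF e(2)] le_less_trans in blast)
  qed
qed

text \<open>A zero of \<open>m\<close> makes the exceedance region non-compact at \<open>\<infinity>\<close>; hence the detour through \<open>max (m w) \<delta>\<close>.\<close>

theorem tendsto_exceed:
  assumes m[measurable]: "m \<in> borel_measurable borel" and mc: "continuous_on pos_sphere m"
    and m0: "\<And>w. w \<in> pos_sphere \<Longrightarrow> 0 \<le> m w"
  shows "exceed \<phi> m \<longlonglongrightarrow> (\<integral>w. \<phi> w * (m w)\<^sup>2 \<partial>H)"
proof -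
  define C where "C = (\<integral>w. \<phi> w \<partial>H)"
  have C0: "0 \<le> C" unfolding C_def by (intro integral_nonneg_AE) (use AE_H in eventually_elim, simp add: \<phi>0)
  have phiC: "integrable H \<phi>" by (rule integrable_H[OF \<phi> \<phi>c])
  have Eint: "integrable M (\<lambda>x. \<phi> (angle (Y x)) * of_bool (sqrt (real n) < norm (Y x) * m (angle (Y x))))"
    if [measurable]: "m \<in> borel_measurable borel" for n and m :: "real ^ 'd \<Rightarrow> real"
    by (rule integrable_exceed) (auto, measurable)
  \<comment> \<open>The two exceedance events differ only where \<open>m\<close> is below
    \<open>\<delta>\<close>, and there they are contained in the event that
    \<open>norm (Y x) * \<delta>\<close> exceeds the level.\<close>
  have bound: "\<bar>exceed \<phi> m n - exceed \<phi> (\<lambda>w. max (m w) \<delta>) n\<bar> \<le> exceed \<phi> (\<lambda>_. \<delta>) n" if \<delta>: "0 < \<delta>" for \<delta> n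
  proof -
    have "\<bar>exceed \<phi> m n - exceed \<phi> (\<lambda>w. max (m w) \<delta>) n\<bar>
      = real n * \<bar>\<integral>x. \<phi> (angle (Y x)) * of_bool (sqrt (real n) < norm (Y x) * m (angle (Y x)))
            - \<phi> (angle (Y x)) * of_bool (sqrt (real n) < norm (Y x) * max (m (angle (Y x))) \<delta>) \<partial>M\<bar>"
    proof -
      have "(\<lambda>w. max (m w) \<delta>) \<in> borel_measurable borel" by measurable
      from Bochner_Integration.integral_diff[OF Eint[OF m] Eint[OF this], of n n]
      show ?thesis unfolding exceed_def right_diff_distrib[symmetric] abs_mult by simp
    qed
    also have "\<dots> \<le> real n * (\<integral>x. \<phi> (angle (Y x)) * of_bool (sqrt (real n) < norm (Y x) * \<delta>) \<partial>M)"
    proof (intro mult_left_mono order_trans[OF integral_abs_bound] integral_mono_AE integrable_abs Bochner_Integration.integrable_diff Eint)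
      show "AE x in M. \<bar>\<phi> (angle (Y x)) * of_bool (sqrt (real n) < norm (Y x) * m (angle (Y x)))
            - \<phi> (angle (Y x)) * of_bool (sqrt (real n) < norm (Y x) * max (m (angle (Y x))) \<delta>)\<bar> \<le> \<phi> (angle (Y x)) * of_bool (sqrt (real n) < norm (Y x) * \<delta>)"
        using AE_angle
      proof eventually_elim
        case (elim x)
        show ?case
        proof (cases "Y x = 0")
          case False
          then have a: "angle (Y x) \<in> pos_sphere" using elim by simp
          show ?thesis
          proof (cases "\<delta> \<le> m (angle (Y x))")
            case True
            then show ?thesis using \<phi>0[OF a] by (simp add: max_absorb1)
          next
            case False
            then have "norm (Y x) * m (angle (Y x)) \<le> norm (Y x) * \<delta>" by (intro mult_left_mono) auto
            then show ?thesis using False \<phi>0[OF a] by (simp add: max_absorb2 of_bool_def)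
          qed
        qed simp
      qed
    qed auto
    finally show ?thesis by (simp add: exceed_def)
  qed
  have bound2: "\<bar>(\<integral>w. \<phi> w * (m w)\<^sup>2 \<partial>H) - (\<integral>w. \<phi> w * (max (m w) \<delta>)\<^sup>2 \<partial>H)\<bar> \<le> \<delta>\<^sup>2 * C" if \<delta>: "0 < \<delta>" for \<delta>
  proof -
    have i: "integrable H (\<lambda>w. \<phi> w * (m w)\<^sup>2)" "integrable H (\<lambda>w. \<phi> w * (max (m w) \<delta>)\<^sup>2)"
      by (auto intro!: integrable_H continuous_intros \<phi>c mc)
    have "\<bar>(\<integral>w. \<phi> w * (m w)\<^sup>2 \<partial>H) - (\<integral>w. \<phi> w * (max (m w) \<delta>)\<^sup>2 \<partial>H)\<bar> = \<bar>\<integral>w. \<phi> w * (m w)\<^sup>2 - \<phi> w * (max (m w) \<delta>)\<^sup>2 \<partial>H\<bar>"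
      using i by simp
    also have "\<dots> \<le> (\<integral>w. \<delta>\<^sup>2 * \<phi> w \<partial>H)"
    proof (intro order_trans[OF integral_abs_bound] integral_mono_AE integrable_abs Bochner_Integration.integrable_diff i integrable_mult_right phiC)
      show "AE w in H. \<bar>\<phi> w * (m w)\<^sup>2 - \<phi> w * (max (m w) \<delta>)\<^sup>2\<bar> \<le> \<delta>\<^sup>2 * \<phi> w"
        using AE_H
      proof eventually_elim
        case (elim w)
        have "\<bar>(m w)\<^sup>2 - (max (m w) \<delta>)\<^sup>2\<bar> \<le> \<delta>\<^sup>2"
        proof (cases "\<delta> \<le> m w")
          case False
          then have "(m w)\<^sup>2 \<le> \<delta>\<^sup>2" using m0[OF elim] by (intro power_mono) auto
          then show ?thesis using False by (simp add: max_absorb2)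
        qed (simp add: max_absorb1)
        then have "\<phi> w * \<bar>(m w)\<^sup>2 - (max (m w) \<delta>)\<^sup>2\<bar> \<le> \<phi> w * \<delta>\<^sup>2" using \<phi>0[OF elim] by (rule mult_left_mono)
        then show ?case using \<phi>0[OF elim] by (simp flip: right_diff_distrib add: abs_mult mult.commute)
      qed
    qed
    finally show ?thesis by (simp add: C_def)
  qed
  show ?thesis
  proof (rule LIMSEQ_I)
    fix r :: real assume r: "0 < r"
    then have r4: "0 < r / 4" by simp
    \<comment> \<open>Makes \<open>\<delta>\<^sup>2 * C\<close> at most r/8; adding 1 to
      \<open>C\<close> avoids a division by 0.\<close>
    define \<delta> where "\<delta> = sqrt (r / (8 * (C + 1)))"
    have \<delta>: "0 < \<delta>" "\<delta>\<^sup>2 * C < r / 4"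
    proof -
      show "0 < \<delta>" using r C0 by (simp add: \<delta>_def)
      have "\<delta>\<^sup>2 * C \<le> r / (8 * (C + 1)) * (C + 1)" using r C0 by (simp add: \<delta>_def)  (simp add: mult_left_mono divide_right_mono)
      also have "\<dots> = r / 8" using C0 by (simp add: field_simps)
      finally show "\<delta>\<^sup>2 * C < r / 4" using r by simp
    qed
    have 1: "exceed \<phi> (\<lambda>w. max (m w) \<delta>) \<longlonglongrightarrow> (\<integral>w. \<phi> w * (max (m w) \<delta>)\<^sup>2 \<partial>H)"
      by (rule tendsto_exceed_pos) (use \<delta> in \<open>auto intro!: continuous_intros mc simp: less_max_iff_disj\<close>)
    have "exceed \<phi> (\<lambda>_. \<delta>) \<longlonglongrightarrow> (\<integral>w. \<phi> w * \<delta>\<^sup>2 \<partial>H)"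
      by (rule tendsto_exceed_pos) (use \<delta> in auto)
    then have 2: "exceed \<phi> (\<lambda>_. \<delta>) \<longlonglongrightarrow> \<delta>\<^sup>2 * C" by (simp add: C_def mult.commute)
    have "eventually (\<lambda>n. norm (exceed \<phi> m n - (\<integral>w. \<phi> w * (m w)\<^sup>2 \<partial>H)) < r) sequentially"
      using tendstoD[OF 1 r4] order_tendstoD(2)[OF 2 \<delta>(2)]
    proof eventually_elim
      case (elim n)
      then show ?case using bound[OF \<delta>(1), of n] bound2[OF \<delta>(1)] \<delta>(2) unfolding dist_real_def real_norm_def by linarith
    qed
    then show "\<exists>no. \<forall>n\<ge>no. norm (exceed \<phi> m n - (\<integral>w. \<phi> w * (m w)\<^sup>2 \<partial>H)) < r" by (simp add: eventually_sequentially)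
  qed
qed

end

end

lemma continuous_on_Max_image:
  fixes f :: "'i \<Rightarrow> 'b::topological_space \<Rightarrow> real"
  assumes "finite A" "A \<noteq> {}" "\<And>i. i \<in> A \<Longrightarrow> continuous_on S (f i)"
  shows "continuous_on S (\<lambda>x. Max ((\<lambda>i. f i x) ` A))"
  using assms
proof (induction rule: finite_ne_induct)
  case (insert i A)
  then have "continuous_on S (\<lambda>x. max (f i x) (Max ((\<lambda>i. f i x) ` A)))" by (intro continuous_on_max) auto
  then show ?case using insert by simp
qed simp

lemma norm_angle_component: "norm y * angle y $ i = y $ i"
  by (cases "y = 0") (auto simp: angle_def)

text \<open>The indicator of an open set is the limit of the continuous functions min 1 (k *
  distance to the complement), and the open sets are an intersection-stable generator of the Borel
  sets.\<close>

lemma finite_measure_eqI_continuous: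
  fixes H1 H2 :: "'b::metric_space measure"
  assumes H: "finite_measure H1" "finite_measure H2" and s: "sets H1 = sets borel" "sets H2 = sets borel"
    and eq: "\<And>\<phi> :: 'b \<Rightarrow> real. continuous_on UNIV \<phi> \<Longrightarrow> (\<And>x. 0 \<le> \<phi> x) \<Longrightarrow> (\<And>x. \<phi> x \<le> 1) \<Longrightarrow> (\<integral>x. \<phi> x \<partial>H1) = (\<integral>x. \<phi> x \<partial>H2)"
  shows "H1 = H2"
proof -
  interpret H1: finite_measure H1 by fact
  interpret H2: finite_measure H2 by fact
  note [measurable_cong] = s
  have sp: "space H1 = UNIV" "space H2 = UNIV" using s[THEN sets_eq_imp_space_eq] by auto
  have open_eq: "emeasure H1 U = emeasure H2 U" if U: "open U" for U
  \<comment> \<open>The whole space is separate because \<open>infdist\<close> to the empty set is 0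
    by convention, which would make the approximating functions vanish.\<close>
  proof (cases "U = UNIV")
    case True
    have "measure H1 UNIV = measure H2 UNIV" using eq[of "\<lambda>_. 1"] sp by simp
    then show ?thesis using True by (simp add: H1.emeasure_eq_measure H2.emeasure_eq_measure)
  next
    case False
    define f where "f k x = min 1 (real k * infdist x (- U))" for k :: nat and x
    have fc: "continuous_on UNIV (f k)" for k unfolding f_def[abs_def] by (intro continuous_intros)
    have fm: "f k \<in> borel_measurable borel" for k by (rule borel_measurable_continuous_onI[OF fc])
    have fb: "0 \<le> f k x" "f k x \<le> 1" for k x by (auto simp: f_def infdist_nonneg)
    have lim: "(\<lambda>k. f k x) \<longlonglongrightarrow> indicat_real U x" for x
    proof (cases "x \<in> U")
      case True
      have "0 < infdist x (- U)" using True U False by (intro infdist_pos_not_in_closed) auto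
      moreover obtain k0 :: nat where "1 / infdist x (- U) \<le> real k0" using real_arch_simple by blast
      ultimately have "1 \<le> real k * infdist x (- U)" if "k0 \<le> k" for k
        using that by (simp add: field_simps) (meson mult_right_mono order_trans of_nat_mono less_imp_le)
      then have "eventually (\<lambda>k. f k x = 1) sequentially"
        by (auto simp: eventually_sequentially f_def intro!: exI[of _ k0])
      then show ?thesis using True by (simp add: tendsto_eventually)
    next
      case False
      then show ?thesis by (simp add: f_def)
    qed
    have "(\<lambda>k. \<integral>x. f k x \<partial>N) \<longlonglongrightarrow> measure N U" if N: "finite_measure N" "sets N = sets borel" for N
    proof -
      interpret N: finite_measure N by fact
      have [measurable]: "f k \<in> borel_measurable N" for k using fm N(2) by (simp cong: measurable_cong_sets)
      have [measurable]: "U \<in> sets N" using U N(2) by auto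
      have "(\<lambda>k. \<integral>x. f k x \<partial>N) \<longlonglongrightarrow> (\<integral>x. indicat_real U x \<partial>N)"
      proof (rule integral_dominated_convergence[where w="\<lambda>_. 1"])
        show "AE x in N. norm (f k x) \<le> 1" for k using fb by (intro AE_I2) (simp add: abs_le_iff fb order_trans[OF _ fb(1)])
      qed (use lim in auto)
      then show ?thesis by simp
    qed
    from this[OF H(1) s(1)] this[OF H(2) s(2)] have "measure H1 U = measure H2 U"
      using eq[OF fc fb] by (simp add: LIMSEQ_unique)
    then show ?thesis by (simp add: H1.emeasure_eq_measure H2.emeasure_eq_measure)
  qed
  show ?thesis
  proof (rule measure_eqI_generator_eq[where E="{U. open U}" and \<Omega>=UNIV and A="\<lambda>_. UNIV"])
    show "Int_stable {U :: 'b set. open U}" by (auto simp: Int_stable_def)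
  qed (use open_eq H1.emeasure_finite in \<open>auto simp: s borel_def\<close>)
qed

lemma (in prob_space) integral_of_bool: "Measurable.pred M P \<Longrightarrow> (\<integral>x. of_bool (P x) \<partial>M) = prob {x \<in> space M. P x}"
proof -
  assume [measurable]: "Measurable.pred M P"
  have "(\<integral>x. of_bool (P x) \<partial>M) = (\<integral>x. indicat_real {x \<in> space M. P x} x \<partial>M)"
    by (intro Bochner_Integration.integral_cong) (auto simp: indicator_def)
  then show ?thesis by simp
qed

section \<open>Uniqueness of the spectral measure, conditional limits, independent
  components\<close>

context regular_variation begin

text \<open>\<open>exceed\<close> does not involve the spectral measure, so its limit determines the
  integral of every nonnegative continuous function.\<close>

lemma spectral_measure_eqI:
  assumes "regular_variation M Y H'"
  shows "H' = H"
proof -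
  interpret R: regular_variation M Y H' by fact
  show ?thesis
  proof (rule finite_measure_eqI_continuous)
    fix \<phi> :: "real ^ 'd \<Rightarrow> real" assume \<phi>: "continuous_on UNIV \<phi>" "\<And>x. 0 \<le> \<phi> x"
    have m: "\<phi> \<in> borel_measurable borel" using \<phi>(1) by (rule borel_measurable_continuous_onI)
    have c: "continuous_on pos_sphere \<phi>" using \<phi>(1) by (rule continuous_on_subset) auto
    have "exceed \<phi> (\<lambda>_. 1) \<longlonglongrightarrow> (\<integral>w. \<phi> w * 1\<^sup>2 \<partial>H)" by (rule tendsto_exceed[OF m c \<phi>(2)]) auto
    moreover have "R.exceed \<phi> (\<lambda>_. 1) \<longlonglongrightarrow> (\<integral>w. \<phi> w * 1\<^sup>2 \<partial>H')" by (rule R.tendsto_exceed[OF m c \<phi>(2)]) auto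
    ultimately show "(\<integral>x. \<phi> x \<partial>H') = (\<integral>x. \<phi> x \<partial>H)" by (simp add: LIMSEQ_unique)
  qed (use finite_H R.finite_H in auto)
qed

lemma spectral_measure_eq: "spectral_measure M Y = H"
  unfolding spectral_measure_def
proof (rule the_equality)
  show "spectral_measure_of M Y H" by (rule spec)
  fix H' assume "spectral_measure_of M Y H'"
  then have "regular_variation M Y H'" using Y nonneg by unfold_locales
  then show "H' = H" by (rule spectral_measure_eqI)
qed

text \<open>Passage from thresholds sqrt n to real thresholds: for nonnegative \<open>\<phi>\<close>
  the integral decreases in \<open>t\<close>, so it is caught between its values at sqrt N and sqrt
  (N + 1), where N is the integer part of the square of \<open>t\<close>.\<close>

lemma tendsto_tail_weighted:
  assumes \<phi>[measurable]: "\<phi> \<in> borel_measurable borel" and \<phi>c: "continuous_on pos_sphere \<phi>"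
    and \<phi>0: "\<And>w. w \<in> pos_sphere \<Longrightarrow> 0 \<le> \<phi> w"
  shows "((\<lambda>t. t\<^sup>2 * (\<integral>x. \<phi> (angle (Y x)) * of_bool (t < norm (Y x)) \<partial>M)) \<longlongrightarrow> (\<integral>w. \<phi> w \<partial>H)) at_top"
proof -
  define e where "e t = (\<integral>x. \<phi> (angle (Y x)) * of_bool (t < norm (Y x)) \<partial>M)" for t
  have lim: "(\<lambda>n. real n * e (sqrt (real n))) \<longlonglongrightarrow> (\<integral>w. \<phi> w \<partial>H)"
    using tendsto_exceed[OF \<phi> \<phi>c \<phi>0, of "\<lambda>_. 1"] by (simp add: exceed_def[abs_def] e_def)
  have int: "integrable M (\<lambda>x. \<phi> (angle (Y x)) * of_bool (t < norm (Y x)))" if "0 \<le> t" for t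
    by (rule integrable_exceed[OF \<phi> \<phi>c \<phi>0]) (use that in auto)
  have anti: "e t \<le> e s" if "0 \<le> s" "s \<le> t" for s t
    unfolding e_def
  proof (intro integral_mono_AE int)
    show "AE x in M. \<phi> (angle (Y x)) * of_bool (t < norm (Y x)) \<le> \<phi> (angle (Y x)) * of_bool (s < norm (Y x))"
      using AE_angle
    proof eventually_elim
      case (elim x)
      then show ?case using that \<phi>0[of "angle (Y x)"] by (auto simp: of_bool_def)
    qed
  qed (use that in auto)
  have e0: "0 \<le> e t" if "0 \<le> t" for t
    unfolding e_def
  proof (rule integral_nonneg_AE)
    show "AE x in M. 0 \<le> \<phi> (angle (Y x)) * of_bool (t < norm (Y x))"
      using AE_angle
    proof eventually_elim
      case (elim x)
      then show ?case using that \<phi>0[of "angle (Y x)"] by (auto simp: of_bool_def)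
    qed
  qed
  define N where "N t = nat \<lfloor>t\<^sup>2\<rfloor>" for t :: real
  have N: "filterlim N sequentially at_top"
    unfolding N_def by real_asymp
  have le: "real (N t) \<le> t\<^sup>2" "t\<^sup>2 \<le> real (Suc (N t))" for t
    using real_of_int_floor_add_one_ge[of "t\<^sup>2"] by (auto simp: N_def add.commute)
  have sq: "sqrt (real (N t)) \<le> t" "t \<le> sqrt (real (Suc (N t)))" if "0 \<le> t" for t
    using le[of t] that real_sqrt_le_mono[OF le(1)[of t]] real_sqrt_le_mono[OF le(2)[of t]] by auto
  have l1: "(\<lambda>n. real n / real (Suc n) * (real (Suc n) * e (sqrt (real (Suc n))))) \<longlonglongrightarrow> 1 * (\<integral>w. \<phi> w \<partial>H)"
    by (intro tendsto_mult LIMSEQ_Suc[OF lim] LIMSEQ_n_over_Suc_n)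
  have l2: "(\<lambda>n. real (Suc n) / real n * (real n * e (sqrt (real n)))) \<longlonglongrightarrow> 1 * (\<integral>w. \<phi> w \<partial>H)"
    by (intro tendsto_mult lim LIMSEQ_Suc_n_over_n)
  have "((\<lambda>t. t\<^sup>2 * e t) \<longlongrightarrow> 1 * (\<integral>w. \<phi> w \<partial>H)) at_top"
  proof (rule tendsto_sandwich[OF _ _ filterlim_compose[OF l1 N] filterlim_compose[OF l2 N]])
    show "eventually (\<lambda>t. real (N t) / real (Suc (N t)) * (real (Suc (N t)) * e (sqrt (real (Suc (N t))))) \<le> t\<^sup>2 * e t) at_top"
      using eventually_ge_at_top[of 0]
    proof eventually_elim
      case (elim t)
      have "real (N t) * e (sqrt (real (Suc (N t)))) \<le> t\<^sup>2 * e t"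
        by (intro mult_mono le anti sq e0) (use elim in auto)
      then show ?case by simp
    qed
    show "eventually (\<lambda>t. t\<^sup>2 * e t \<le> real (Suc (N t)) / real (N t) * (real (N t) * e (sqrt (real (N t))))) at_top"
      using eventually_ge_at_top[of 1]
    proof eventually_elim
      case (elim t)
      have "1 \<le> t\<^sup>2" using elim by simp
      then have "0 < N t" unfolding N_def by simp
      have "t\<^sup>2 * e t \<le> real (Suc (N t)) * e (sqrt (real (N t)))"
        by (intro mult_mono le anti sq e0) (use elim in auto)
      then show ?case using \<open>0 < N t\<close> by simp
    qed
  qed
  then show ?thesis by (simp add: e_def)
qed

lemma tail_asymp: "((\<lambda>t. t\<^sup>2 * prob {x \<in> space M. t < norm (Y x)}) \<longlongrightarrow> measure H UNIV) at_top"
proof -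
  have sp: "space H = UNIV" using sets_eq_imp_space_eq[OF sets_H] by simp
  have "((\<lambda>t. t\<^sup>2 * (\<integral>x. 1 * of_bool (t < norm (Y x)) \<partial>M)) \<longlongrightarrow> (\<integral>w. 1 \<partial>H)) at_top"
    by (rule tendsto_tail_weighted[of "\<lambda>_. 1"]) auto
  moreover have "(\<integral>x. 1 * of_bool (t < norm (Y x)) \<partial>M) = prob {x \<in> space M. t < norm (Y x)}" for t
    using integral_of_bool[of "\<lambda>x. t < norm (Y x)"] by simp
  ultimately show ?thesis using sp by simp
qed

text \<open>A function of either sign is made nonnegative by adding a bound \<open>C\<close>; in the
  quotient by the tail probability the shift is again the constant \<open>C\<close> and can be
  subtracted.\<close>

lemma tendsto_tail_conditional:
  assumes \<phi>[measurable]: "\<phi> \<in> borel_measurable borel" and \<phi>c: "continuous_on pos_sphere \<phi>"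
    and pos: "0 < measure H UNIV"
  shows "((\<lambda>t. (\<integral>x. \<phi> (angle (Y x)) * of_bool (t < norm (Y x)) \<partial>M) / prob {x \<in> space M. t < norm (Y x)})
           \<longlongrightarrow> (\<integral>w. \<phi> w \<partial>H) / measure H UNIV) at_top"
proof -
  have sp: "space H = UNIV" using sets_eq_imp_space_eq[OF sets_H] by simp
  interpret H: finite_measure H by (rule finite_H)
  have "bounded (\<phi> ` pos_sphere)" by (intro compact_imp_bounded compact_continuous_image compact_pos_sphere \<phi>c)
  then obtain C where C: "\<And>w. w \<in> pos_sphere \<Longrightarrow> \<bar>\<phi> w\<bar> \<le> C" by (auto simp: bounded_iff)
  have C': "0 \<le> \<phi> w + C" if "w \<in> pos_sphere" for w using C[OF that] by linarith
  define P where "P t = prob {x \<in> space M. t < norm (Y x)}" for t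
  define e where "e t = (\<integral>x. \<phi> (angle (Y x)) * of_bool (t < norm (Y x)) \<partial>M)" for t
  have P: "((\<lambda>t. t\<^sup>2 * P t) \<longlongrightarrow> measure H UNIV) at_top" unfolding P_def by (rule tail_asymp)
  have c: "continuous_on pos_sphere (\<lambda>w. \<phi> w + C)" by (intro continuous_intros \<phi>c)
  have "((\<lambda>t. t\<^sup>2 * (\<integral>x. (\<phi> (angle (Y x)) + C) * of_bool (t < norm (Y x)) \<partial>M)) \<longlongrightarrow> (\<integral>w. \<phi> w + C \<partial>H)) at_top"
    by (rule tendsto_tail_weighted[OF _ c C']) auto
  then have E: "((\<lambda>t. t\<^sup>2 * (\<integral>x. (\<phi> (angle (Y x)) + C) * of_bool (t < norm (Y x)) \<partial>M)) \<longlongrightarrow> (\<integral>w. \<phi> w \<partial>H) + C * measure H UNIV) at_top"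
    using integrable_H[OF \<phi> \<phi>c] sp by (simp add: mult.commute)
  have split: "(\<integral>x. (\<phi> (angle (Y x)) + C) * of_bool (t < norm (Y x)) \<partial>M) = e t + C * P t" if "0 \<le> t" for t
  proof -
    have i1: "integrable M (\<lambda>x. (\<phi> (angle (Y x)) + C) * of_bool (t < norm (Y x)))"
      by (rule integrable_exceed[OF _ c C']) (use that in auto)
    have i2: "integrable M (\<lambda>x. (1 :: real) * of_bool (t < norm (Y x)))"
      by (rule integrable_exceed[where \<phi>="\<lambda>_. 1"]) (use that in auto)
    have "e t = (\<integral>x. (\<phi> (angle (Y x)) + C) * of_bool (t < norm (Y x)) - C * (1 * of_bool (t < norm (Y x))) \<partial>M)"
      unfolding e_def by (intro Bochner_Integration.integral_cong) (auto simp: algebra_simps)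
    also have "\<dots> = (\<integral>x. (\<phi> (angle (Y x)) + C) * of_bool (t < norm (Y x)) \<partial>M) - C * (\<integral>x. 1 * of_bool (t < norm (Y x)) \<partial>M)"
      by (subst Bochner_Integration.integral_diff[OF i1 integrable_mult_right[OF i2]]) (simp only: integral_mult_right_zero)
    also have "(\<integral>x. 1 * of_bool (t < norm (Y x)) \<partial>M) = P t"
      using integral_of_bool[of "\<lambda>x. t < norm (Y x)"] by (simp add: P_def)
    finally show ?thesis by simp
  qed
  have "((\<lambda>t. t\<^sup>2 * (\<integral>x. (\<phi> (angle (Y x)) + C) * of_bool (t < norm (Y x)) \<partial>M) / (t\<^sup>2 * P t) - C)
      \<longlongrightarrow> ((\<integral>w. \<phi> w \<partial>H) + C * measure H UNIV) / measure H UNIV - C) at_top"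
    by (intro tendsto_intros E P) (use pos in simp)
  moreover have "((\<integral>w. \<phi> w \<partial>H) + C * measure H UNIV) / measure H UNIV - C = (\<integral>w. \<phi> w \<partial>H) / measure H UNIV"
    using pos by (simp add: field_simps)
  moreover have "eventually (\<lambda>t. t\<^sup>2 * (\<integral>x. (\<phi> (angle (Y x)) + C) * of_bool (t < norm (Y x)) \<partial>M) / (t\<^sup>2 * P t) - C = e t / P t) at_top"
    using eventually_gt_at_top[of 0] order_tendstoD(1)[OF P pos]
  proof eventually_elim
    case (elim t)
    then have "P t \<noteq> 0" by auto
    then show ?case using elim by (simp add: split add_divide_distrib)
  qed
  ultimately have "((\<lambda>t. e t / P t) \<longlongrightarrow> (\<integral>w. \<phi> w \<partial>H) / measure H UNIV) at_top"
    by (auto elim: Lim_transform_eventually)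
  then show ?thesis by (simp add: e_def P_def)
qed

text \<open>Exceedances of a single component show that its square has integral 1. Joint exceedances
  of two components have probability of order 1/n^2, so the minimum of two components is almost
  everywhere 0. Hence \<open>H\<close> lives on the unit vectors of the axes, with mass 1 at each of
  them.\<close>

theorem integral_spectral_indep:
  fixes \<phi> :: "real ^ 'd \<Rightarrow> real"
  assumes std: "\<And>i. (\<lambda>n. real n * prob {x \<in> space M. sqrt (real n) < Y x $ i}) \<longlonglongrightarrow> 1"
    and indep: "\<And>i j s. i \<noteq> j \<Longrightarrow> prob {x \<in> space M. s < Y x $ i \<and> s < Y x $ j} = prob {x \<in> space M. s < Y x $ i} * prob {x \<in> space M. s < Y x $ j}"
    and \<phi>[measurable]: "\<phi> \<in> borel_measurable borel"
  shows "(\<integral>w. \<phi> w \<partial>H) = (\<Sum>i\<in>UNIV. \<phi> (axis i 1))"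
proof -
  have comp: "continuous_on S (\<lambda>w :: real ^ 'd. w $ i)" for S i by (intro continuous_intros)
  have nn: "0 \<le> w $ i" if "w \<in> pos_sphere" for w :: "real ^ 'd" and i using that by (simp add: pos_sphere_def)
  have 1: "(\<integral>w. (w $ i)\<^sup>2 \<partial>H) = 1" for i
  proof -
    have "exceed (\<lambda>_. 1) (\<lambda>w. w $ i) \<longlonglongrightarrow> (\<integral>w. 1 * (w $ i)\<^sup>2 \<partial>H)"
      by (rule tendsto_exceed) (auto intro: comp nn)
    moreover have "exceed (\<lambda>_. 1) (\<lambda>w. w $ i) = (\<lambda>n. real n * prob {x \<in> space M. sqrt (real n) < Y x $ i})"
    proof
      fix n
      show "exceed (\<lambda>_. 1) (\<lambda>w. w $ i) n = real n * prob {x \<in> space M. sqrt (real n) < Y x $ i}"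
        using integral_of_bool[of "\<lambda>x. sqrt (real n) < Y x $ i"] by (simp add: exceed_def norm_angle_component)
    qed
    ultimately show ?thesis using LIMSEQ_unique[OF std[of i]] by simp
  qed
  have 2: "AE w in H. min (w $ i) (w $ j) = 0" if "i \<noteq> j" for i j
  proof -
    have "exceed (\<lambda>_. 1) (\<lambda>w. min (w $ i) (w $ j)) \<longlonglongrightarrow> (\<integral>w. 1 * (min (w $ i) (w $ j))\<^sup>2 \<partial>H)"
      by (rule tendsto_exceed) (auto intro!: comp nn continuous_on_min)
    moreover have "exceed (\<lambda>_. 1) (\<lambda>w. min (w $ i) (w $ j)) \<longlonglongrightarrow> 0"
    proof -
      have "norm y * min (angle y $ i) (angle y $ j) = min (y $ i) (y $ j)" for y :: "real ^ 'd"
        by (simp add: min_mult_distrib_left norm_angle_component)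
      then have "exceed (\<lambda>_. 1) (\<lambda>w. min (w $ i) (w $ j)) n = real n * prob {x \<in> space M. sqrt (real n) < Y x $ i \<and> sqrt (real n) < Y x $ j}" for n
        using integral_of_bool[of "\<lambda>x. sqrt (real n) < Y x $ i \<and> sqrt (real n) < Y x $ j"] by (simp add: exceed_def)
      then have eq: "exceed (\<lambda>_. 1) (\<lambda>w. min (w $ i) (w $ j)) n = real n * prob {x \<in> space M. sqrt (real n) < Y x $ i} *
          (real n * prob {x \<in> space M. sqrt (real n) < Y x $ j} * (1 / real n))" for n
        using indep[OF that, of "sqrt (real n)"] by simp
      have "(\<lambda>n. real n * prob {x \<in> space M. sqrt (real n) < Y x $ i} *
          (real n * prob {x \<in> space M. sqrt (real n) < Y x $ j} * (1 / real n))) \<longlonglongrightarrow> 1 * (1 * 0)"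
        by (intro tendsto_mult std lim_1_over_n)
      then show ?thesis unfolding eq[abs_def] by simp
    qed
    ultimately have "(\<integral>w. (min (w $ i) (w $ j))\<^sup>2 \<partial>H) = 0" by (simp add: LIMSEQ_unique)
    moreover have "integrable H (\<lambda>w. (min (w $ i) (w $ j))\<^sup>2)"
      by (rule integrable_H) (auto intro!: continuous_intros)
    ultimately have "AE w in H. (min (w $ i) (w $ j))\<^sup>2 = 0" by (subst (asm) integral_nonneg_eq_0_iff_AE) auto
    then show ?thesis by simp
  qed
  have "AE w in H. \<forall>i. \<forall>j. i \<noteq> j \<longrightarrow> min (w $ i) (w $ j) = 0"
    using 2 by (simp add: AE_all_countable)
  then have "AE w in H. \<phi> w = (\<Sum>i\<in>UNIV. \<phi> (axis i 1) * (w $ i)\<^sup>2)"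
    using AE_H
  proof eventually_elim
    case (elim w)
    then have w: "\<And>i. 0 \<le> w $ i" "norm w = 1" by (auto simp: pos_sphere_def)
    then obtain i where i: "w $ i \<noteq> 0" by (metis norm_zero vec_eq_iff zero_index zero_neq_one)
    have j: "w $ j = 0" if "j \<noteq> i" for j
      using elim(1) that w(1)[of i] w(1)[of j] i by (auto simp: min_def split: if_splits)
    have wi: "w = w $ i *\<^sub>R axis i 1" using j by (simp add: vec_eq_iff axis_def)
    have "norm w = \<bar>w $ i\<bar>" by (subst wi) simp
    then have "w $ i = 1" using w(1)[of i] w(2) by simp
    then have "w = axis i 1" using wi by simp
    then show ?case by (simp add: axis_def if_distrib[of "\<lambda>x. x\<^sup>2"] if_distrib[of "(*) _"] cong: if_cong)
  qed
  then have "(\<integral>w. \<phi> w \<partial>H) = (\<integral>w. (\<Sum>i\<in>UNIV. \<phi> (axis i 1) * (w $ i)\<^sup>2) \<partial>H)"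
    by (intro integral_cong_AE) auto
  also have "\<dots> = (\<Sum>i\<in>UNIV. \<phi> (axis i 1) * (\<integral>w. (w $ i)\<^sup>2 \<partial>H))"
    by (subst Bochner_Integration.integral_sum) (auto intro!: integrable_mult_right integrable_H continuous_intros)
  finally show ?thesis by (simp add: 1)
qed

end

section \<open>Regular variation of max-linear vectors\<close>

lemma max_linear_scale: "0 \<le> a \<Longrightarrow> max_linear A (a *\<^sub>R z) = a *\<^sub>R max_linear A z"
proof -
  assume a: "0 \<le> a"
  have "Max (range (\<lambda>j. A $ i $ j * (a * z $ j))) = a * Max (range (\<lambda>j. A $ i $ j * z $ j))" for i
  proof -
    have "mono (\<lambda>y. a * y)" using a by (auto intro!: monoI mult_left_mono)
    then have "a * Max (range (\<lambda>j. A $ i $ j * z $ j)) = Max ((\<lambda>y. a * y) ` range (\<lambda>j. A $ i $ j * z $ j))"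
      by (intro mono_Max_commute) auto
    then show ?thesis by (simp add: image_image mult.left_commute)
  qed
  then show ?thesis by (simp add: max_linear_def vec_eq_iff)
qed

lemma continuous_on_max_linear: "continuous_on S (max_linear A)"
proof -
  have "continuous_on S (\<lambda>z. Max ((\<lambda>j. A $ i $ j * z $ j) ` UNIV))" for i
    by (rule continuous_on_Max_image) (auto intro!: continuous_intros)
  then have "continuous_on S (\<lambda>z. \<chi> i. Max (range (\<lambda>j. A $ i $ j * z $ j)))" by (rule continuous_on_vec_lambda)
  then show ?thesis by (simp add: max_linear_def[abs_def])
qed

lemma max_linear_axis:
  assumes "\<And>i. 0 \<le> A $ i $ j"
  shows "max_linear A (axis j 1) = column j A"
proof -
  have "Max (range (\<lambda>l. A $ i $ l * axis j 1 $ l)) = A $ i $ j" for i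
    using assms by (intro Max_eqI) (auto simp: axis_def image_iff intro!: exI[of _ j])
  then show ?thesis by (simp add: max_linear_def column_def vec_eq_iff)
qed

text \<open>The unit mass at the j-th axis is moved to the direction of the j-th column; stretching
  radii by the norm of the column multiplies the mass by the square of that norm.\<close>

definition max_linear_spectral :: "real ^ 'd ^ 'd \<Rightarrow> (real ^ 'd::finite) measure" where
  "max_linear_spectral A = distr (density (count_space UNIV) (\<lambda>j. ennreal ((norm (column j A))\<^sup>2))) borel (\<lambda>j. angle (column j A))"

lemma sets_max_linear_spectral[measurable_cong, simp]: "sets (max_linear_spectral A) = sets borel"
  by (simp add: max_linear_spectral_def)

lemma integral_max_linear_spectral:
  fixes \<phi> :: "real ^ 'd::finite \<Rightarrow> real"
  assumes [measurable]: "\<phi> \<in> borel_measurable borel"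
  shows "(\<integral>w. \<phi> w \<partial>max_linear_spectral A) = (\<Sum>j\<in>UNIV. (norm (column j A))\<^sup>2 * \<phi> (angle (column j A)))"
proof -
  have "(\<integral>w. \<phi> w \<partial>max_linear_spectral A) = (\<integral>j. \<phi> (angle (column j A)) \<partial>density (count_space UNIV) (\<lambda>j. ennreal ((norm (column j A))\<^sup>2)))"
    unfolding max_linear_spectral_def by (rule integral_distr) simp_all
  also have "\<dots> = (\<integral>j. (norm (column j A))\<^sup>2 * \<phi> (angle (column j A)) \<partial>count_space UNIV)"
    by (subst integral_density) auto
  also have "\<dots> = (\<Sum>j\<in>UNIV. (norm (column j A))\<^sup>2 * \<phi> (angle (column j A)))"
    by (rule lebesgue_integral_count_space_finite) simp
  finally show ?thesis .
qed

lemma emeasure_max_linear_spectral: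
  assumes "S \<in> sets borel"
  shows "emeasure (max_linear_spectral A) S = ennreal (\<Sum>j\<in>UNIV. (norm (column j A))\<^sup>2 * indicator S (angle (column j A)))"
proof -
  have "emeasure (max_linear_spectral A) S = (\<integral>\<^sup>+j. ennreal ((norm (column j A))\<^sup>2) * indicator S (angle (column j A)) \<partial>count_space UNIV)"
    unfolding max_linear_spectral_def using assms
    by (subst emeasure_distr) (auto simp: emeasure_density indicator_def intro!: nn_integral_cong)
  also have "\<dots> = (\<Sum>j\<in>UNIV. ennreal ((norm (column j A))\<^sup>2) * indicator S (angle (column j A)))"
    by (rule nn_integral_count_space_finite) simp
  also have "\<dots> = (\<Sum>j\<in>UNIV. ennreal ((norm (column j A))\<^sup>2 * indicator S (angle (column j A))))"
    by (intro sum.cong) (auto simp: indicator_def)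
  finally show ?thesis by (simp add: sum_ennreal)
qed

context
  fixes A :: "real ^ 'd::finite ^ 'd"
  assumes A0: "\<And>i j. 0 \<le> A $ i $ j" and diag: "\<And>i. 0 < A $ i $ i"
begin

lemma max_linear_nonneg:
  assumes z: "\<And>i. 0 \<le> z $ i"
  shows "0 \<le> max_linear A z $ i"
  using max_linear_ge[of A i i z] A0[of i i] z[of i] by (meson mult_nonneg_nonneg order_trans)

lemma max_linear_nonzero:
  assumes z: "z \<in> pos_sphere"
  shows "max_linear A z \<noteq> 0"
proof
  assume 0: "max_linear A z = 0"
  have z0: "0 \<le> z $ i" for i using z by (simp add: pos_sphere_def)
  have "z $ i = 0" for i
    using max_linear_ge[of A i i z] 0 diag[of i] z0[of i] by (simp add: mult_le_0_iff)
  then have "z = 0" by (simp add: vec_eq_iff)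
  then show False using z by (simp add: pos_sphere_def)
qed

lemma angle_max_linear: "z \<in> pos_sphere \<Longrightarrow> angle (max_linear A z) \<in> pos_sphere"
  by (intro angle_in_pos_sphere max_linear_nonzero max_linear_nonneg) (auto simp: pos_sphere_def)

lemma column_nonzero: "column j A \<noteq> 0"
proof -
  have "column j A $ j \<noteq> 0" using diag[of j] by (simp add: column_def)
  then show ?thesis by (metis zero_index)
qed

lemma angle_column: "angle (column j A) \<in> pos_sphere"
  by (rule angle_in_pos_sphere[OF column_nonzero]) (simp add: column_def A0)

lemma axis_pos_sphere: "axis j 1 \<in> (pos_sphere :: (real ^ 'd) set)"
proof -
  have "0 \<le> (axis j 1 :: real ^ 'd) $ i" for i by (simp add: axis_def)
  then show ?thesis by (simp add: pos_sphere_def)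
qed

lemma finite_max_linear_spectral: "finite_measure (max_linear_spectral A)"
  using sets_eq_imp_space_eq[OF sets_max_linear_spectral[of A]]
  by (intro finite_measureI) (simp add: emeasure_max_linear_spectral)

text \<open>In polar coordinates the map sends (r, w) to r times the norm of its value at w,
  together with the direction of that value. The positive diagonal keeps this value away from 0 on
  the sphere, so test functions for \<open>X\<close> pull back to test functions for
  \<open>Z\<close>.\<close>

theorem regular_variation_max_linear:
  assumes Z: "regular_variation M Z H"
    and H: "\<And>\<phi> :: real ^ 'd \<Rightarrow> real. \<phi> \<in> borel_measurable borel \<Longrightarrow> (\<integral>w. \<phi> w \<partial>H) = (\<Sum>i\<in>UNIV. \<phi> (axis i 1))"
    and X[measurable]: "X \<in> borel_measurable M" and XZ: "AE x in M. X x = max_linear A (Z x)"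
  shows "regular_variation M X (max_linear_spectral A)"
proof -
  interpret Z: regular_variation M Z H by fact
  have vague: "(\<lambda>n. \<integral>x. g x \<partial>scale_measure (of_nat n) (distr M borel (\<lambda>x. (ereal (norm (X x) / sqrt (real n)), angle (X x)))))
      \<longlonglongrightarrow> (\<integral>x. g x \<partial>(nu2 \<Otimes>\<^sub>M max_linear_spectral A))"
    if K: "compact K" "K \<subseteq> {0<..} \<times> pos_sphere" and g: "continuous_on ({0<..} \<times> pos_sphere) g" and gK: "\<And>x. x \<notin> K \<Longrightarrow> g x = 0"
    for g :: "ereal \<times> (real ^ 'd) \<Rightarrow> real" and K
  proof -
    \<comment> \<open>The radii occurring in a nonempty compact \<open>K\<close> attain their
      minimum, which is positive and possibly infinite.\<close>
    obtain b where b: "0 < b" "\<And>p. p \<in> K \<Longrightarrow> ereal b \<le> fst p"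
    proof (cases "K = {}")
      case True
      then show ?thesis using that[of 1] by simp
    next
      case False
      have "compact (fst ` K)" using K by (intro compact_continuous_image continuous_intros)
      then obtain r where r: "r \<in> fst ` K" "\<And>s. s \<in> fst ` K \<Longrightarrow> r \<le> s" using compact_attains_inf[of "fst ` K"] False by auto
      then have "0 < r" using K by auto
      from ereal_ge_inverse_Suc[OF this] obtain n where "ereal (1 / real (Suc n)) \<le> r" by auto
      then show ?thesis using r by (intro that[of "1 / real (Suc n)"]) (auto intro: order_trans)
    qed
    have z: "vanishes_below b g"
      unfolding vanishes_below_def
    proof (intro allI impI)
      fix p :: "ereal \<times> (real ^ 'd)" assume "p \<notin> {ereal b..} \<times> pos_sphere"
      then have "p \<notin> K" using b(2)[of p] K by (cases p) auto
      then show "g p = 0" by (rule gK)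
    qed
    have gm[measurable]: "g \<in> borel_measurable borel" by (rule polar_function_measurable[OF g b(1) z])
    have "bounded (max_linear A ` pos_sphere)"
      by (intro compact_imp_bounded compact_continuous_image compact_pos_sphere continuous_on_max_linear)
    then obtain C where C: "\<And>w. w \<in> pos_sphere \<Longrightarrow> norm (max_linear A w) \<le> C" by (auto simp: bounded_iff)
    \<comment> \<open>An upper bound for the stretching of radii: a test function vanishing below
      radius \<open>b\<close> pulls back to one vanishing below \<open>b / D\<close>.\<close>
    define D where "D = max C 1"
    have D: "\<And>w. w \<in> pos_sphere \<Longrightarrow> norm (max_linear A w) \<le> D" "0 < D" using C by (auto simp: D_def le_max_iff_disj)
    define h where "h p = (if p \<in> {0<..} \<times> pos_sphere then g (fst p * ereal (norm (max_linear A (snd p))), angle (max_linear A (snd p))) else 0)" for p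
    have nz: "0 < norm (max_linear A w)" if "w \<in> pos_sphere" for w using max_linear_nonzero[OF that] by simp
    have "continuous_on ({0<..} \<times> pos_sphere) (\<lambda>p. g (fst p * ereal (norm (max_linear A (snd p))), angle (max_linear A (snd p))))"
    proof (rule continuous_on_compose2[OF g])
      show "continuous_on ({0<..} \<times> pos_sphere) (\<lambda>p. (fst p * ereal (norm (max_linear A (snd p))), angle (max_linear A (snd p))))"
      proof (rule continuous_on_Pair)
        have c: "continuous_on ({0<..} \<times> pos_sphere) (\<lambda>p :: ereal \<times> (real ^ 'd). max_linear A (snd p))"
          by (rule continuous_on_compose2[OF continuous_on_max_linear[of UNIV]]) (auto intro!: continuous_intros)
        then show "continuous_on ({0<..} \<times> pos_sphere) (\<lambda>p :: ereal \<times> (real ^ 'd). angle (max_linear A (snd p)))"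
          unfolding angle_def by (intro continuous_intros) (auto simp: max_linear_nonzero)
        have cn: "continuous_on ({0<..} \<times> pos_sphere) (\<lambda>p :: ereal \<times> (real ^ 'd). ereal (norm (max_linear A (snd p))))"
          using c by (intro continuous_intros)
        show "continuous_on ({0<..} \<times> pos_sphere) (\<lambda>p :: ereal \<times> (real ^ 'd). fst p * ereal (norm (max_linear A (snd p))))"
          unfolding continuous_on_def
        proof
          fix p :: "ereal \<times> (real ^ 'd)" assume p: "p \<in> {0<..} \<times> pos_sphere"
          have "(fst \<longlongrightarrow> fst p) (at p within {0<..} \<times> pos_sphere)" by (intro tendsto_intros)
          moreover have "((\<lambda>p. ereal (norm (max_linear A (snd p)))) \<longlongrightarrow> ereal (norm (max_linear A (snd p)))) (at p within {0<..} \<times> pos_sphere)"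
            using cn p by (auto simp: continuous_on_def)
          ultimately show "((\<lambda>p. fst p * ereal (norm (max_linear A (snd p)))) \<longlongrightarrow> fst p * ereal (norm (max_linear A (snd p)))) (at p within {0<..} \<times> pos_sphere)"
            using p nz by (intro tendsto_mult_ereal_pos) (auto simp: max_linear_nonzero)
        qed
      qed
    qed (auto simp: angle_max_linear ereal_zero_less_0_iff nz max_linear_nonzero)
    then have h: "continuous_on ({0<..} \<times> pos_sphere) h" by (simp add: h_def cong: continuous_on_cong)
    have hz: "vanishes_below (b / D) h"
      unfolding vanishes_below_def
    proof (intro allI impI)
      fix p :: "ereal \<times> (real ^ 'd)" assume p: "p \<notin> {ereal (b / D)..} \<times> pos_sphere"
      obtain r w where rw: "p = (r, w)" by (cases p)
      show "h p = 0"
      proof (cases "0 < r \<and> w \<in> pos_sphere")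
        case True
        then have "r < ereal (b / D)" using p rw by auto
        then obtain x where x: "r = ereal x" "0 < x" "x < b / D" using True by (cases r) auto
        have "x * norm (max_linear A w) \<le> x * D" using x D(1)[of w] True by (intro mult_left_mono) auto
        also have "\<dots> < b" using x D(2) by (simp add: field_simps)
        finally have "g (r * ereal (norm (max_linear A w)), angle (max_linear A w)) = 0"
          using z x by (auto simp: vanishes_below_def)
        then show ?thesis by (simp add: h_def rw)
      qed (auto simp: h_def rw)
    qed
    have bD: "0 < b / D" using b D by simp
    have hm[measurable]: "h \<in> borel_measurable borel" by (rule polar_function_measurable[OF h bD hz])
    have lim: "(\<lambda>n. real n * (\<integral>x. h (ereal (norm (Z x) / sqrt (real n)), angle (Z x)) \<partial>M)) \<longlonglongrightarrow> (\<integral>w. \<integral>r. h (r, w) \<partial>nu2 \<partial>H)"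
      by (rule spectral_measure_ofD[OF Z.Y Z.spec h bD hz])
    have meas2: "(\<lambda>w. \<integral>r. f (r, w) \<partial>nu2) \<in> borel_measurable borel" if f: "f \<in> borel_measurable borel" for f :: "ereal \<times> (real ^ 'd) \<Rightarrow> real"
    proof -
      interpret nu2: sigma_finite_measure nu2 by (rule sigma_finite_nu2)
      have [measurable]: "f \<in> borel_measurable (borel \<Otimes>\<^sub>M borel)" using f by (simp add: borel_prod)
      have "(\<lambda>(w, r). f (r, w)) \<in> borel_measurable (borel \<Otimes>\<^sub>M nu2)" by measurable
      then show ?thesis using nu2.borel_measurable_lebesgue_integral by fastforce
    qed
    have "(\<integral>w. \<integral>r. h (r, w) \<partial>nu2 \<partial>H) = (\<Sum>j\<in>UNIV. \<integral>r. h (r, axis j 1) \<partial>nu2)"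
      by (rule H[OF meas2[OF hm]])
    also have "\<dots> = (\<Sum>j\<in>UNIV. (norm (column j A))\<^sup>2 * (\<integral>r. g (r, angle (column j A)) \<partial>nu2))"
    proof (rule sum.cong[OF refl])
      fix j
      have n0: "0 < norm (column j A)" using column_nonzero by simp
      have "h (r, axis j 1) = g (r * ereal (norm (column j A)), angle (column j A))" for r
      proof (cases "0 < r")
        case True
        then show ?thesis by (simp add: h_def axis_pos_sphere max_linear_axis A0)
      next
        case False
        then have "r * ereal (norm (column j A)) \<le> 0" using n0 by (auto simp: ereal_mult_le_0_iff)
        then have "\<not> ereal b \<le> r * ereal (norm (column j A))" using b(1) by (metis ereal_less(2) not_less order_trans)
        then show ?thesis using z False by (auto simp: h_def vanishes_below_def)
      qed
      then have "(\<integral>r. h (r, axis j 1) \<partial>nu2) = (\<integral>r. g (r * ereal (norm (column j A)), angle (column j A)) \<partial>nu2)" by simp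
      also have "\<dots> = (norm (column j A))\<^sup>2 * (\<integral>r. g (r, angle (column j A)) \<partial>nu2)"
      proof (rule integral_nu2_scale[of "\<lambda>r. g (r, angle (column j A))", OF _ n0])
        have "g \<in> borel_measurable (borel \<Otimes>\<^sub>M borel)" using gm by (simp add: borel_prod)
        then show "(\<lambda>r. g (r, angle (column j A))) \<in> borel_measurable borel" by measurable
      qed
      finally show "(\<integral>r. h (r, axis j 1) \<partial>nu2) = (norm (column j A))\<^sup>2 * (\<integral>r. g (r, angle (column j A)) \<partial>nu2)" .
    qed
    also have "\<dots> = (\<integral>w. \<integral>r. g (r, w) \<partial>nu2 \<partial>max_linear_spectral A)"
      by (rule integral_max_linear_spectral[OF meas2[OF gm], symmetric])
    also have "\<dots> = (\<integral>x. g x \<partial>(nu2 \<Otimes>\<^sub>M max_linear_spectral A))"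
      by (rule integral_nu2_pair[OF g b(1) z finite_max_linear_spectral sets_max_linear_spectral, symmetric])
    finally have rhs: "(\<integral>w. \<integral>r. h (r, w) \<partial>nu2 \<partial>H) = (\<integral>x. g x \<partial>(nu2 \<Otimes>\<^sub>M max_linear_spectral A))" .
    have lhs: "(\<integral>x. g x \<partial>scale_measure (of_nat n) (distr M borel (\<lambda>x. (ereal (norm (X x) / sqrt (real n)), angle (X x)))))
       = real n * (\<integral>x. h (ereal (norm (Z x) / sqrt (real n)), angle (Z x)) \<partial>M)" if n: "0 < n" for n
    proof -
      have [measurable]: "(\<lambda>x. (ereal (norm (X x) / sqrt (real n)), angle (X x))) \<in> borel_measurable M"
        "(\<lambda>x. (ereal (norm (Z x) / sqrt (real n)), angle (Z x))) \<in> borel_measurable M"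
        unfolding borel_prod[symmetric] by measurable
      have "(\<integral>x. g (ereal (norm (X x) / sqrt (real n)), angle (X x)) \<partial>M) = (\<integral>x. h (ereal (norm (Z x) / sqrt (real n)), angle (Z x)) \<partial>M)"
      proof (rule integral_cong_AE)
        show "AE x in M. g (ereal (norm (X x) / sqrt (real n)), angle (X x)) = h (ereal (norm (Z x) / sqrt (real n)), angle (Z x))"
          using XZ Z.nonneg
        proof eventually_elim
          case (elim x)
          show ?case
          proof (cases "Z x = 0")
            case True
            have "max_linear A 0 = 0" using max_linear_scale[of 0 A 0] by simp
            then have "X x = 0" using elim True by simp
            then show ?thesis using True z b(1) by (simp add: h_def vanishes_below_def)
          next
            case False
            then have a: "angle (Z x) \<in> pos_sphere" using elim by (intro angle_in_pos_sphere) auto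
            have "Z x = norm (Z x) *\<^sub>R angle (Z x)" using False by (simp add: angle_def)
            then have X: "X x = norm (Z x) *\<^sub>R max_linear A (angle (Z x))" using elim(1) max_linear_scale[of "norm (Z x)"] by (metis norm_ge_zero)
            have "angle (X x) = angle (max_linear A (angle (Z x)))" using False by (simp add: X angle_def)
            moreover have "ereal (norm (X x) / sqrt (real n)) = ereal (norm (Z x) / sqrt (real n)) * ereal (norm (max_linear A (angle (Z x))))" by (simp add: X)
            ultimately show ?thesis using a False n by (simp add: h_def)
          qed
        qed
        show "(\<lambda>x. g (ereal (norm (X x) / sqrt (real n)), angle (X x))) \<in> borel_measurable M" by measurable
        show "(\<lambda>x. h (ereal (norm (Z x) / sqrt (real n)), angle (Z x))) \<in> borel_measurable M" by measurable
      qed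
      moreover have "(of_nat n :: ennreal) = ennreal (real n)" by (simp add: ennreal_of_nat_eq_real_of_nat)
      ultimately show ?thesis by (simp add: integral_scale_measure integral_distr)
    qed
    have "eventually (\<lambda>n. real n * (\<integral>x. h (ereal (norm (Z x) / sqrt (real n)), angle (Z x)) \<partial>M)
      = (\<integral>x. g x \<partial>scale_measure (of_nat n) (distr M borel (\<lambda>x. (ereal (norm (X x) / sqrt (real n)), angle (X x)))))) sequentially"
      using eventually_gt_at_top[of 0] by eventually_elim (rule lhs[symmetric])
    from Lim_transform_eventually[OF lim this] show ?thesis unfolding rhs .
  qed
  have "spectral_measure_of M X (max_linear_spectral A)"
    unfolding spectral_measure_of_def vague_conv_on_def
    using vague finite_max_linear_spectral
    by (auto simp: emeasure_max_linear_spectral angle_column)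
  moreover have "AE x in M. \<forall>i. 0 \<le> X x $ i"
    using XZ Z.nonneg by eventually_elim (auto intro: max_linear_nonneg)
  ultimately show ?thesis using X by unfold_locales
qed

end

lemma norm_le_componentwise_less:
  fixes x y :: "real ^ 'd::finite"
  assumes "\<And>i. 0 \<le> x $ i" "\<And>i. x $ i \<le> y $ i" "x $ i < y $ i"
  shows "norm x < norm y"
proof -
  have "(\<Sum>i\<in>UNIV. (x $ i)\<^sup>2) < (\<Sum>i\<in>UNIV. (y $ i)\<^sup>2)"
    by (rule sum_strict_mono_ex1) (use assms in \<open>auto intro!: power_mono power_strict_mono exI[of _ i]\<close>)
  then show ?thesis by (simp add: norm_vec_def L2_set_def)
qed

section \<open>Absence of atoms in the law of the norm\<close>

context prob_space begin

text \<open>Where \<open>Z\<^sub>j\<close> attains the maximum of the component \<open>i0\<close>, the norm is strictly increasing in \<open>Z\<^sub>j\<close>, so each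
  level set meets every line in direction \<open>j\<close> at most once.\<close>

theorem atomless_norm_max_linear:
  fixes Z :: "'a \<Rightarrow> real ^ 'd::finite" and A :: "real ^ 'd ^ 'd"
  assumes A0: "\<And>i j. 0 \<le> A $ i $ j" and diag: "\<And>i. 0 < A $ i $ i"
    and indep: "indep_vars (\<lambda>_. borel) (\<lambda>i x. Z x $ i) UNIV"
    and atomless: "\<And>i z. prob {x \<in> space M. Z x $ i = z} = 0"
    and nonneg: "AE x in M. \<forall>i. 0 \<le> Z x $ i"
    and X[measurable]: "X \<in> borel_measurable M" and XZ: "AE x in M. X x = max_linear A (Z x)"
  shows "prob {x \<in> space M. norm (X x) = t} = 0"
proof -
  have Zm[measurable]: "(\<lambda>x. Z x $ i) \<in> borel_measurable M" for i
    using indep unfolding indep_vars_def by auto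
  define L where "L i = distr M borel (\<lambda>x. Z x $ i)" for i
  define P where "P = PiM (UNIV :: 'd set) L"
  have prob_L: "prob_space (L i)" for i unfolding L_def by (rule prob_space_distr) simp
  interpret P: product_prob_space L "UNIV :: 'd set"
    by (simp add: product_prob_space_def product_prob_space_axioms_def product_sigma_finite_def prob_L prob_space_imp_sigma_finite)
  have dP: "distr M (PiM UNIV (\<lambda>_. borel)) (\<lambda>x i. Z x $ i) = P"
    using indep_vars_iff_distr_eq_PiM[of "UNIV :: 'd set" "\<lambda>i x. Z x $ i" "\<lambda>_. borel"] indep
    by (simp add: P_def L_def[abs_def] restrict_UNIV)
  have sP: "sets P = sets (PiM (UNIV :: 'd set) (\<lambda>_. borel :: real measure))"
    unfolding dP[symmetric] by simp
  have spP: "space P = UNIV" using sets_eq_imp_space_eq[OF sP] by (simp add: space_PiM)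
  have L0: "measure (L i) {z} = 0" for i z
    using atomless[of i z] unfolding L_def by (subst measure_distr) (auto simp: vimage_def Int_def conj_commute)
  obtain i0 :: 'd where True by simp
  define V where "V w = max_linear A (\<chi> i. w i)" for w :: "'d \<Rightarrow> real"
  have comp: "(\<lambda>w. w i) \<in> borel_measurable P" for i
    unfolding measurable_cong_sets[OF sP refl] by (rule measurable_component_singleton) simp
  have Vc: "(\<lambda>w. V w $ i) \<in> borel_measurable P" for i
  proof -
    have "(\<lambda>w. Max ((\<lambda>j. A $ i $ j * w j) ` UNIV)) \<in> borel_measurable P"
      by (rule borel_measurable_Max) (simp, simp, rule borel_measurable_times[OF borel_measurable_const comp])
    then show ?thesis unfolding V_def max_linear_def vec_lambda_beta .
  qed
  then have Vm: "V \<in> borel_measurable P" by (rule borel_measurable_vecI)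
  \<comment> \<open>The part of the level set where index \<open>j\<close> attains the maximum in
    component \<open>i0\<close>; componentwise comparison of norms also calls for nonnegative
    coordinates.\<close>
  define B where "B j = {w \<in> space P. (\<forall>i. 0 \<le> w i) \<and> norm (V w) = t \<and> V w $ i0 = A $ i0 $ j * w j}" for j
  have B[measurable]: "B j \<in> sets P" for j
  proof -
    have nV: "(\<lambda>w. norm (V w)) \<in> borel_measurable P"
      by (rule measurable_compose[OF Vm borel_measurable_norm])
    have cj: "(\<lambda>w. A $ i0 $ j * w j) \<in> borel_measurable P"
      by (rule borel_measurable_times[OF borel_measurable_const comp])
    have 1: "{w \<in> space P. norm (V w) = t} \<in> sets P" "{w \<in> space P. V w $ i0 = A $ i0 $ j * w j} \<in> sets P"
      by (rule borel_measurable_eq[OF nV borel_measurable_const] borel_measurable_eq[OF Vc cj])+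
    have 2: "{w \<in> space P. 0 \<le> w i} \<in> sets P" for i
      by (rule borel_measurable_le[OF borel_measurable_const comp])
    have "B j = (\<Inter>i. {w \<in> space P. 0 \<le> w i}) \<inter> {w \<in> space P. norm (V w) = t} \<inter> {w \<in> space P. V w $ i0 = A $ i0 $ j * w j}"
      by (auto simp: B_def)
    also have "\<dots> \<in> sets P" 
    proof (intro sets.Int 1)
      show "(\<Inter>i. {w \<in> space P. 0 \<le> w i}) \<in> sets P" by (rule sets.finite_INT) (simp_all add: 2)
    qed
    finally show ?thesis .
  qed
  have B0: "measure P (B j) = 0" if j: "0 < A $ i0 $ j" for j
  proof -
    have ins: "insert j (UNIV - {j}) = (UNIV :: 'd set)" by auto
    have "measure P (B j) = (\<integral>w. indicat_real (B j) w \<partial>P)" by simp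
    also have "\<dots> = (\<integral>w. \<integral>y. indicat_real (B j) (w(j := y)) \<partial>L j \<partial>PiM (UNIV - {j}) L)"
    proof -
      have "integrable (PiM (insert j (UNIV - {j})) L) (indicat_real (B j))"
        unfolding ins P_def[symmetric] using B by (intro integrable_real_indicator) (auto simp: P_def P.P.emeasure_eq_measure)
      from P.product_integral_insert[OF _ _ this] show ?thesis unfolding ins P_def by simp
    qed
    also have "\<dots> = (\<integral>w. 0 \<partial>PiM (UNIV - {j}) L)"
    proof (rule Bochner_Integration.integral_cong[OF refl])
      fix w
      have uniq: "y = y'" if y: "w(j := y) \<in> B j" "w(j := y') \<in> B j" for y y'
      proof -
        have lt: "\<not> y < y'" if y: "w(j := y) \<in> B j" "w(j := y') \<in> B j" for y y'
        proof
          assume "y < y'"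
          have yB: "\<forall>i. 0 \<le> (w(j := y)) i" "norm (V (w(j := y))) = t" "V (w(j := y)) $ i0 = A $ i0 $ j * y"
            and yB': "norm (V (w(j := y'))) = t" "V (w(j := y')) $ i0 = A $ i0 $ j * y'"
            using y unfolding B_def by (simp_all only: mem_Collect_eq fun_upd_same simp_thms)
          have mono: "V (w(j := y)) $ i \<le> V (w(j := y')) $ i" for i
          proof -
            obtain l where "max_linear A (\<chi> i. (w(j := y)) i) $ i = A $ i $ l * (\<chi> i. (w(j := y)) i) $ l"
              by (rule max_linear_attained)
            then have "V (w(j := y)) $ i = A $ i $ l * (w(j := y)) l" unfolding V_def vec_lambda_beta .
            also have "\<dots> \<le> A $ i $ l * (w(j := y')) l" using \<open>y < y'\<close> A0 by (intro mult_left_mono) auto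
            also have "\<dots> \<le> V (w(j := y')) $ i" using max_linear_ge[of A i l "\<chi> i. (w(j := y')) i"] unfolding V_def vec_lambda_beta .
            finally show ?thesis .
          qed
          have "0 \<le> V (w(j := y)) $ i" for i
            unfolding V_def by (rule max_linear_nonneg[OF A0 diag]) (use yB(1) in \<open>simp only: vec_lambda_beta\<close>)
          moreover have "V (w(j := y)) $ i0 < V (w(j := y')) $ i0" unfolding yB yB' using j \<open>y < y'\<close> by simp
          ultimately have "norm (V (w(j := y))) < norm (V (w(j := y')))" using mono by (intro norm_le_componentwise_less)
          then show False unfolding yB yB' by simp
        qed
        from lt[OF y] lt[OF y(2) y(1)] show ?thesis by linarith
      qed
      show "(\<integral>y. indicat_real (B j) (w(j := y)) \<partial>L j) = 0"
      proof (cases "\<exists>y. w(j := y) \<in> B j")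
        case True
        then obtain y0 where "w(j := y0) \<in> B j" by auto
        then have "w(j := y) \<in> B j \<longleftrightarrow> y \<in> {y0}" for y using uniq[of y y0] by blast
        then have eq: "indicat_real (B j) (w(j := y)) = indicat_real {y0} y" for y unfolding indicator_def by presburger
        have "(\<integral>y. indicat_real {y0} y \<partial>L j) = measure (L j) ({y0} \<inter> space (L j))" by (rule Bochner_Integration.integral_indicator)
        also have "{y0} \<inter> space (L j) = {y0}" by (simp add: L_def)
        finally show ?thesis unfolding eq L0 .
      next
        case False
        then have eq: "indicat_real (B j) (w(j := y)) = 0" for y unfolding indicator_def by simp
        show ?thesis unfolding eq by simp
      qed
    qed
    finally show ?thesis by simp
  qed
  define J where "J = {j. 0 < A $ i0 $ j}"
  have nullB: "AE x in M. (\<lambda>i. Z x $ i) \<notin> B j" if "j \<in> J" for j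
  proof -
    have "emeasure P (B j) = 0" using B0[of j] that by (simp add: J_def P_def P.P.emeasure_eq_measure)
    then have "AE w in P. w \<notin> B j" using B by (intro AE_not_in) (auto simp: null_sets_def)
    then have "AE w in distr M (PiM UNIV (\<lambda>_. borel)) (\<lambda>x i. Z x $ i). w \<notin> B j" unfolding dP .
    then show ?thesis
      by (rule AE_distrD[rotated]) (auto intro!: measurable_PiM_single' simp: PiE_def extensional_def)
  qed
  have null0: "AE x in M. Z x $ i0 \<noteq> 0"
  proof -
    have "emeasure M {x \<in> space M. Z x $ i0 = 0} = 0" using atomless by (simp add: emeasure_eq_measure)
    then have "AE x in M. x \<notin> {x \<in> space M. Z x $ i0 = 0}" by (intro AE_not_in) (auto simp: null_sets_def)
    then show ?thesis by (rule AE_mp) (auto intro!: AE_I2)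
  qed
  have "AE x in M. \<forall>j\<in>J. (\<lambda>i. Z x $ i) \<notin> B j" using nullB by (simp add: AE_finite_all)
  then have "AE x in M. norm (X x) \<noteq> t"
    using null0 nonneg XZ
  proof eventually_elim
    case (elim x)
    have V: "V (\<lambda>i. Z x $ i) = X x" using elim(4) by (simp add: V_def)
    obtain j where j: "X x $ i0 = A $ i0 $ j * Z x $ j" unfolding elim(4) by (rule max_linear_attained)
    \<comment> \<open>The component \<open>i0\<close> is almost surely positive, so the coefficient
      at an index attaining the maximum is positive. Hence the sets \<open>B j\<close> with
      \<open>j\<close> in \<open>J\<close> cover the level set up to a null set.\<close>
    have "0 < A $ i0 $ i0 * Z x $ i0" using diag elim(2,3) by (simp add: less_le)
    also have "\<dots> \<le> X x $ i0" unfolding elim(4) by (rule max_linear_ge)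
    finally have "0 < A $ i0 $ j" using j elim(3) A0[of i0 j] by (auto simp: zero_less_mult_iff less_le)
    then have "(\<lambda>i. Z x $ i) \<notin> B j" using elim(1) by (simp add: J_def)
    then show ?case using elim(3) j V by (auto simp: B_def spP)
  qed
  then have "prob {x \<in> space M. norm (X x) = t} = prob {x \<in> space M. False}"
    by (intro finite_measure_eq_AE) auto
  then show ?thesis by simp
qed

end

section \<open>Asymptotics of the scaling estimator\<close>

lemma max_sq_bounds: 
  assumes "h \<noteq> {}"
  shows "0 \<le> max_sq h w" "max_sq h w \<le> (norm w)\<^sup>2"
proof -
  have "max_sq h w \<in> (\<lambda>j. (w $ j)\<^sup>2) ` h" unfolding max_sq_def using assms by (intro Max_in) auto
  then obtain j where j: "max_sq h w = (w $ j)\<^sup>2" by auto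
  show "0 \<le> max_sq h w" unfolding j by simp
  have "\<bar>w $ j\<bar> \<le> norm w" by (rule component_le_norm_cart)
  then show "max_sq h w \<le> (norm w)\<^sup>2" unfolding j by (metis abs_le_square_iff abs_norm_cancel)
qed

lemma norm_angle_le: "norm (angle y) \<le> 1"
  by (simp add: angle_def)

lemma max_sq_angle_bounds: "h \<noteq> {} \<Longrightarrow> 0 \<le> max_sq h (angle y) \<and> max_sq h (angle y) \<le> 1"
  using max_sq_bounds[of h "angle y"] norm_angle_le[of y] by (auto intro: order_trans simp: power_le_one)

lemma continuous_on_max_sq: "h \<noteq> {} \<Longrightarrow> continuous_on S (max_sq h)"
  unfolding max_sq_def[abs_def] by (rule continuous_on_Max_image) (auto intro!: continuous_intros)

lemma continuous_on_max_over: "h \<noteq> {} \<Longrightarrow> continuous_on S (max_over h)"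
  unfolding max_over_def[abs_def] by (rule continuous_on_Max_image) (auto intro!: continuous_intros)

lemma max_sq_measurable: "h \<noteq> {} \<Longrightarrow> max_sq h \<in> borel_measurable borel"
  by (rule borel_measurable_continuous_onI[OF continuous_on_max_sq])

lemma max_over_measurable: "h \<noteq> {} \<Longrightarrow> max_over h \<in> borel_measurable borel"
  by (rule borel_measurable_continuous_onI[OF continuous_on_max_over])

lemma max_over_angle:
  assumes "h \<noteq> {}"
  shows "norm y * max_over h (angle y) = max_over h y"
proof -
  have "mono (\<lambda>x. norm y * x)" by (auto intro!: monoI mult_left_mono)
  then have "norm y * max_over h (angle y) = Max ((\<lambda>x. norm y * x) ` (\<lambda>j. angle y $ j) ` h)"
    unfolding max_over_def using assms by (intro mono_Max_commute) auto
  then show ?thesis by (simp add: max_over_def image_image norm_angle_component)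
qed

lemma max_over_nonneg: "h \<noteq> {} \<Longrightarrow> w \<in> pos_sphere \<Longrightarrow> 0 \<le> max_over h w"
  unfolding max_over_def by (subst Max_ge_iff) (auto simp: pos_sphere_def)

lemma max_over_sq:
  assumes h: "h \<noteq> {}" and w: "w \<in> pos_sphere"
  shows "(max_over h w)\<^sup>2 = max_sq h w"
proof (rule antisym)
  have "max_over h w \<in> (\<lambda>j. w $ j) ` h" unfolding max_over_def using h by (intro Max_in) auto
  then obtain j where j: "j \<in> h" "max_over h w = w $ j" by auto
  show "(max_over h w)\<^sup>2 \<le> max_sq h w" unfolding j(2) max_sq_def using j(1) by (intro Max_ge) auto
  have "max_sq h w \<in> (\<lambda>j. (w $ j)\<^sup>2) ` h" unfolding max_sq_def using h by (intro Max_in) auto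
  then obtain l where l: "l \<in> h" "max_sq h w = (w $ l)\<^sup>2" by auto
  have "w $ l \<le> max_over h w" unfolding max_over_def using l(1) by (intro Max_ge) auto
  moreover have "0 \<le> w $ l" using w by (simp add: pos_sphere_def)
  ultimately show "max_sq h w \<le> (max_over h w)\<^sup>2" unfolding l(2) by (rule power_mono)
qed

lemma index_set_nonempty: "index_set q \<noteq> {}"
  using index_set[of q] by (auto simp: scaling_sets_def)

text \<open>The normalized spectral measure is the discrete law with mass \<open>p j\<close> at \<open>\<alpha> j\<close>.\<close>

locale scaling_estimation = prob_space M for M :: "'a measure" +
  fixes X :: "'a \<Rightarrow> (real, 'd::{finite,linorder}) vec" and Xs :: "nat \<Rightarrow> 'a \<Rightarrow> (real, 'd::{finite,linorder}) vec" and k :: "nat \<Rightarrow> nat"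
    and H :: "((real, 'd::{finite,linorder}) vec) measure" and p :: "'d::{finite,linorder} \<Rightarrow> real"
    and \<alpha> :: "'d::{finite,linorder} \<Rightarrow> (real, 'd::{finite,linorder}) vec"
  assumes RV: "regular_variation M X H"
    and integral_H: "\<And>\<phi> :: (real, 'd::{finite,linorder}) vec \<Rightarrow> real. \<phi> \<in> borel_measurable borel \<Longrightarrow> (\<integral>w. \<phi> w \<partial>H) = real CARD('d::{finite,linorder}) * (\<Sum>j\<in>UNIV. p j * \<phi> (\<alpha> j))"
    and p_nonneg: "\<And>j. 0 \<le> p j" and sum_p: "(\<Sum>j\<in>UNIV. p j) = 1" and \<alpha>: "\<And>j. \<alpha> j \<in> pos_sphere"
    and atomless: "\<And>t. prob {x \<in> space M. norm (X x) = t} = 0"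
    and iid: "iid_copies M X Xs"
    and k_small: "(\<lambda>n. real (k n) / real n) \<longlonglongrightarrow> 0"
    and k_large: "filterlim k at_top sequentially"
    and bias: "\<And>q T. uniform_limit {0..T}
        (\<lambda>n t. tail_bias M (Xs 1) (norm_spectral_measure M X) (\<lambda>w. real CARD('d::{finite,linorder}) * max_sq (index_set q) w) n (k n) t) (\<lambda>t. 0) sequentially"
begin

interpretation RV: regular_variation M X H by (rule RV)

text \<open>Expectation under the normalized spectral measure, by
  \<open>integral_norm_spectral\<close>; as a finite sum it is linear without integrability
  conditions.\<close>

definition Ex :: "((real, 'd) vec \<Rightarrow> real) \<Rightarrow> real" where "Ex \<phi> = (\<Sum>j\<in>UNIV. p j * \<phi> (\<alpha> j))"

lemma d_pos: "0 < real CARD('d)" by simp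

lemma mass_H: "measure H UNIV = real CARD('d)" "emeasure H pos_sphere = ennreal (real CARD('d))"
proof -
  interpret H: finite_measure H by (rule RV.finite_H)
  have sp: "space H = UNIV" using sets_eq_imp_space_eq[OF RV.sets_H] by simp
  show 1: "measure H UNIV = real CARD('d)" using integral_H[of "\<lambda>_. 1"] sum_p sp by simp
  have "emeasure H pos_sphere = emeasure H UNIV" using RV.AE_H by (intro emeasure_eq_AE) auto
  then show "emeasure H pos_sphere = ennreal (real CARD('d))" using 1 by (simp add: H.emeasure_eq_measure)
qed

lemma norm_spectral_eq: "norm_spectral_measure M X = scale_measure (ennreal (1 / real CARD('d))) H"
proof -
  have "1 / ennreal (real CARD('d)) = ennreal (1 / real CARD('d))" using divide_ennreal[of 1 "real CARD('d)"] d_pos by simp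
  then show ?thesis by (simp add: norm_spectral_measure_def RV.spectral_measure_eq mass_H)
qed

lemma integral_norm_spectral:
  fixes \<phi> :: "(real, 'd) vec \<Rightarrow> real"
  assumes m: "\<phi> \<in> borel_measurable borel"
  shows "(\<integral>w. \<phi> w \<partial>norm_spectral_measure M X) = Ex \<phi>"
proof -
  have "\<phi> \<in> borel_measurable H" using m by (simp cong: measurable_cong_sets)
  then show ?thesis unfolding norm_spectral_eq using d_pos by (subst integral_scale_measure) (simp_all add: integral_H[OF m] Ex_def)
qed

definition F :: "'d scaling_index \<Rightarrow> (real, 'd) vec \<Rightarrow> real" where "F q w = real CARD('d) * max_sq (index_set q) w"

definition m :: "'d scaling_index \<Rightarrow> real" where "m q = Ex (F q)"

lemma F_measurable[measurable]: "F q \<in> borel_measurable borel"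
  unfolding F_def[abs_def] by (rule borel_measurable_times[OF borel_measurable_const max_sq_measurable[OF index_set_nonempty]])

lemma F_continuous: "continuous_on S (F q)"
  unfolding F_def[abs_def] by (intro continuous_intros continuous_on_max_sq index_set_nonempty)

lemma F_angle_bounds: "0 \<le> F q (angle y)" "F q (angle y) \<le> real CARD('d)"
  using max_sq_angle_bounds[OF index_set_nonempty[of q], of y] by (auto simp: F_def mult_left_le)

text \<open>The centred score in direction \<open>u\<close>: the error of the estimator in this
  direction is the sum of these scores over the k largest observations, divided by sqrt k (see
  \<open>inner_error\<close>). Since its mean under \<open>Ex\<close> is 0, \<open>s u\<close> is
  its variance.\<close>

definition f :: "(real, 'd scaling_index) vec \<Rightarrow> (real, 'd) vec \<Rightarrow> real" where
  "f u w = (\<Sum>q\<in>UNIV. u $ q * (F q w - m q))"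

definition s :: "(real, 'd scaling_index) vec \<Rightarrow> real" where "s u = Ex (\<lambda>w. (f u w)\<^sup>2)"

lemma f_measurable[measurable]: "f u \<in> borel_measurable borel"
  unfolding f_def[abs_def] by measurable

lemma f_continuous: "continuous_on S (f u)"
  unfolding f_def[abs_def] by (intro continuous_intros F_continuous)

definition B :: "(real, 'd scaling_index) vec \<Rightarrow> real" where "B u = (\<Sum>q\<in>UNIV. \<bar>u $ q\<bar> * (real CARD('d) + \<bar>m q\<bar>))"

lemma f_angle_bounded: "\<bar>f u (angle y)\<bar> \<le> B u"
  unfolding f_def B_def
proof (rule order_trans[OF sum_abs sum_mono])
  fix q
  have "\<bar>F q (angle y) - m q\<bar> \<le> real CARD('d) + \<bar>m q\<bar>" using F_angle_bounds[of q y] by linarith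
  then show "\<bar>u $ q * (F q (angle y) - m q)\<bar> \<le> \<bar>u $ q\<bar> * (real CARD('d) + \<bar>m q\<bar>)" by (simp add: abs_mult mult_left_mono)
qed

text \<open>Exceedances of the homogeneous function \<open>max_over\<close>, whose square on the
  sphere is \<open>max_sq\<close>; the factor d in \<open>F\<close> is the total mass of
  \<open>H\<close>.\<close>

lemma S_M_component: "S_M M X $ q = m q"
proof -
  let ?h = "index_set q"
  have h: "?h \<noteq> {}" by (rule index_set_nonempty)
  have "RV.exceed (\<lambda>_. 1) (max_over ?h) \<longlonglongrightarrow> (\<integral>w. 1 * (max_over ?h w)\<^sup>2 \<partial>H)"
    by (rule RV.tendsto_exceed) (auto intro: max_over_measurable[OF h] continuous_on_max_over[OF h] max_over_nonneg[OF h])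
  moreover have "(\<integral>w. 1 * (max_over ?h w)\<^sup>2 \<partial>H) = (\<integral>w. max_sq ?h w \<partial>H)"
    using RV.AE_H max_over_measurable[OF h] max_sq_measurable[OF h]
    by (intro integral_cong_AE) (auto simp: max_over_sq[OF h] cong: measurable_cong_sets)
  moreover have "(\<integral>w. max_sq ?h w \<partial>H) = m q"
    using integral_H[OF max_sq_measurable[OF h]] by (simp add: m_def Ex_def F_def sum_distrib_left mult.left_commute)
  moreover have ex: "RV.exceed (\<lambda>_. 1) (max_over ?h) n = real n * measure M {x \<in> space M. max_over ?h (X x) > sqrt (real n)}" for n
  proof -
    have [measurable]: "(\<lambda>x. max_over ?h (X x)) \<in> borel_measurable M"
      by (rule measurable_compose[OF RV.Y max_over_measurable[OF h]])
    show ?thesis unfolding RV.exceed_def max_over_angle[OF h] mult_1_left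
      by (subst integral_of_bool) auto
  qed
  ultimately have "(\<lambda>n. real n * measure M {x \<in> space M. max_over ?h (X x) > sqrt (real n)}) \<longlonglongrightarrow> m q"
    unfolding ex[symmetric] by (simp only:)
  then show ?thesis by (simp add: S_M_def sq_scaling_def limI)
qed

text \<open>On the state space itself the ranking statistic is simply \<open>norm\<close>, and a
  sample of size n is a point of the n-fold product of \<open>N\<close>.\<close>

definition N :: "((real, 'd) vec) measure" where "N = distr M borel X"

lemma prob_N: "prob_space N" unfolding N_def by (rule prob_space_distr) (rule RV.Y)

interpretation N: prob_space N by (rule prob_N)

lemma sets_N[measurable_cong, simp]: "sets N = sets borel" by (simp add: N_def)

lemma space_N[simp]: "space N = UNIV" by (simp add: N_def)

lemma tail_N: "N.tail norm t = prob {x \<in> space M. t < norm (X x)}"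
  unfolding N.tail_def unfolding N_def using RV.Y by (subst measure_distr) (auto simp: vimage_def Int_def conj_commute)

lemma atomless_N: "N.prob {x \<in> space N. norm x = t} = 0"
proof -
  have "N.prob {x \<in> space N. norm x = t} = prob {x \<in> space M. norm (X x) = t}"
    unfolding N_def using RV.Y by (subst measure_distr) (auto simp: vimage_def Int_def conj_commute)
  then show ?thesis using atomless by simp
qed

lemma norm_N[measurable]: "norm \<in> borel_measurable N" by (simp cong: measurable_cong_sets)

lemma tail_sq: "((\<lambda>t. t\<^sup>2 * N.tail norm t) \<longlongrightarrow> real CARD('d)) at_top"
  using RV.tail_asymp unfolding tail_N mass_H .

text \<open>Positive far out by regular variation, hence everywhere by monotonicity.\<close>

lemma tail_pos: "0 < N.tail norm t"
proof -
  have "eventually (\<lambda>t'. 0 < t'\<^sup>2 * N.tail norm t' \<and> t \<le> t') at_top"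
    using order_tendstoD(1)[OF tail_sq d_pos] by (intro eventually_conj eventually_ge_at_top)
  then obtain t' where t': "0 < t'\<^sup>2 * N.tail norm t'" "t \<le> t'" by (auto simp: eventually_at_top_linorder)
  then have "0 < N.tail norm t'" by (simp add: zero_less_mult_iff)
  also have "\<dots> \<le> N.tail norm t" by (rule N.tail_antimono[OF norm_N t'(2)])
  finally show ?thesis .
qed

lemma k_ge_1: "eventually (\<lambda>n. 1 \<le> k n) sequentially"
  using k_large by (auto simp: filterlim_at_top)

lemma k_le_n: "eventually (\<lambda>n. k n \<le> n) sequentially"
  using order_tendstoD(2)[OF k_small zero_less_one] eventually_gt_at_top[of 0]
  by eventually_elim (simp add: divide_less_eq)

text \<open>\<open>good n x\<close> says that \<open>x\<close> is a plausible value for the observation with the \<open>k n\<close>-th largest norm.\<close>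

definition good :: "nat \<Rightarrow> (real, 'd) vec \<Rightarrow> bool" where
  "good n x \<longleftrightarrow> real (k n) \<le> 8 * real n * N.tail norm (norm x) \<and> real n * N.tail norm (norm x) \<le> 8 * real (k n)"

text \<open>On the window the tail probability is at most 8 k/n, which eventually drops below the
  positive number \<open>N.tail norm L\<close>.\<close>

lemma good_large: "eventually (\<lambda>n. \<forall>x. good n x \<longrightarrow> L < norm x) sequentially"
proof -
  have "(\<lambda>n. 8 * (real (k n) / real n)) \<longlonglongrightarrow> 8 * 0" by (intro tendsto_intros k_small)
  then have "eventually (\<lambda>n. 8 * (real (k n) / real n) < N.tail norm L) sequentially"
    using tail_pos[of L] by (intro order_tendstoD) auto
  then show ?thesis using eventually_gt_at_top[of 0]
  proof eventually_elim
    case (elim n)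
    show ?case
    proof (intro allI impI)
      fix x assume "good n x"
      then have "N.tail norm (norm x) \<le> 8 * (real (k n) / real n)" using elim(2) by (simp add: good_def field_simps)
      then have "N.tail norm (norm x) < N.tail norm L" using elim(1) by linarith
      then show "L < norm x" using N.tail_antimono[OF norm_N, of "norm x" L] by (meson not_less)
    qed
  qed
qed

lemma integral_N:
  fixes g :: "(real, 'd) vec \<Rightarrow> 'b::{banach, second_countable_topology}"
  assumes "g \<in> borel_measurable borel" 
  shows "(\<integral>y. g y \<partial>N) = (\<integral>x. g (X x) \<partial>M)"
  unfolding N_def using assms RV.Y by (rule integral_distr[rotated])

lemma Xs_measurable[measurable]: "1 \<le> l \<Longrightarrow> Xs l \<in> borel_measurable M"
  using iid unfolding iid_copies_def indep_vars_def by auto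

lemma distr_Xs: "1 \<le> l \<Longrightarrow> distr M borel (Xs l) = N"
  using iid unfolding iid_copies_def N_def by auto

text \<open>The parameter of \<open>tail_bias\<close> is chosen so that its threshold becomes the
  radius \<open>t\<close>. The inequality for the norm is closed in \<open>tail_bias\<close> and
  strict here, a difference of probability 0 because the norm has no atoms.\<close>

lemma tail_bias_eq:
  assumes t: "0 < t" and j: "1 \<le> n div k n"
  shows "tail_bias M (Xs 1) (norm_spectral_measure M X) (\<lambda>w. real CARD('d) * max_sq (index_set q) w) n (k n) (real (n div k n) / t\<^sup>2)
    = sqrt (real (k n)) * (real n / real (k n)) * (\<integral>y. (F q (angle y) - m q) * of_bool (t < norm y) \<partial>N)"
proof -
  have X1: "Xs 1 \<in> borel_measurable M" by (rule Xs_measurable) simp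
  have dN: "distr M borel (Xs 1) = N" by (rule distr_Xs) simp
  have thr: "threshold (n div k n) (real (n div k n) / t\<^sup>2) = ereal t"
    using t j by (simp add: threshold_def real_sqrt_divide)
  have "surv M (\<lambda>x. norm (Xs 1 x)) (ereal t) = 1 - prob {x \<in> space M. norm (Xs 1 x) \<le> t}" by (simp add: surv_def)
  also have "prob {x \<in> space M. norm (Xs 1 x) \<le> t} = N.prob {y \<in> space N. norm y \<le> t}"
    unfolding dN[symmetric] using X1 by (subst measure_distr) (auto simp: vimage_def Int_def conj_commute)
  also have "1 - N.prob {y \<in> space N. norm y \<le> t} = N.tail norm t"
    using N.prob_neg[of "\<lambda>y. norm y \<le> t"] by (simp add: N.tail_def not_le)
  finally have surv: "surv M (\<lambda>x. norm (Xs 1 x)) (ereal t) = N.tail norm t" .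
  have AE: "AE y in N. norm y \<noteq> t"
  proof -
    have "emeasure N {y \<in> space N. norm y = t} = 0" using atomless_N by (simp add: N.emeasure_eq_measure)
    then have "AE y in N. y \<notin> {y \<in> space N. norm y = t}" by (intro AE_not_in) (auto simp: null_sets_def)
    then show ?thesis by simp
  qed
  have "(\<integral>x. real CARD('d) * max_sq (index_set q) (angle (Xs 1 x)) * of_bool (threshold (n div k n) (real (n div k n) / t\<^sup>2) \<le> ereal (norm (Xs 1 x))) \<partial>M)
     = (\<integral>x. (\<lambda>y. F q (angle y) * of_bool (t \<le> norm y)) (Xs 1 x) \<partial>M)"
    unfolding thr by (simp add: F_def)
  also have "\<dots> = (\<integral>y. F q (angle y) * of_bool (t \<le> norm y) \<partial>N)"
    unfolding dN[symmetric]
    by (rule integral_distr[symmetric, OF X1]) measurable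
  also have "\<dots> = (\<integral>y. F q (angle y) * of_bool (t < norm y) \<partial>N)"
    by (rule integral_cong_AE) (measurable, use AE in eventually_elim, auto simp: less_le)
  finally have I: "(\<integral>x. real CARD('d) * max_sq (index_set q) (angle (Xs 1 x)) * of_bool (threshold (n div k n) (real (n div k n) / t\<^sup>2) \<le> ereal (norm (Xs 1 x))) \<partial>M)
    = (\<integral>y. F q (angle y) * of_bool (t < norm y) \<partial>N)" .
  have E: "(\<integral>w. real CARD('d) * max_sq (index_set q) w \<partial>norm_spectral_measure M X) = m q"
    using integral_norm_spectral[OF F_measurable[of q]] by (simp add: m_def F_def[abs_def])
  have i1: "integrable N (\<lambda>y. F q (angle y) * of_bool (t < norm y))"
    by (rule N.integrable_const_bound[where B="real CARD('d)"]) (use F_angle_bounds[of q] in \<open>auto simp: of_bool_def\<close>)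
  have i2: "integrable N (\<lambda>y. m q * of_bool (t < norm y))"
    by (rule N.integrable_const_bound[where B="\<bar>m q\<bar>"]) (auto simp: of_bool_def)
  have "(\<integral>y. (F q (angle y) - m q) * of_bool (t < norm y) \<partial>N) = (\<integral>y. F q (angle y) * of_bool (t < norm y) \<partial>N) - (\<integral>y. m q * of_bool (t < norm y) \<partial>N)"
    unfolding left_diff_distrib by (rule Bochner_Integration.integral_diff[OF i1 i2])
  also have "(\<integral>y. m q * of_bool (t < norm y) \<partial>N) = m q * N.tail norm t"
    by (simp add: N.integral_of_bool_tail[OF norm_N atomless_N])
  finally have D: "(\<integral>y. (F q (angle y) - m q) * of_bool (t < norm y) \<partial>N) = (\<integral>y. F q (angle y) * of_bool (t < norm y) \<partial>N) - m q * N.tail norm t" .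
  show ?thesis unfolding tail_bias_def I E D unfolding thr surv by (simp add: algebra_simps)
qed

text \<open>For good points the parameter found in \<open>tail_bias_eq\<close> stays in a fixed
  compact interval, so the locally uniform assumption applies to the random threshold. Replacing n/k
  by the reciprocal of the tail probability costs at most a factor 8.\<close>

lemma component_bias:
  assumes e: "0 < e"
  shows "eventually (\<lambda>n. \<forall>x. good n x \<longrightarrow>
     \<bar>sqrt (real (k n)) * (\<integral>y. (F q (angle y) - m q) * of_bool (norm x < norm y) \<partial>N) / N.tail norm (norm x)\<bar> < e) sequentially"
proof -
  have "eventually (\<lambda>t. real CARD('d) / 2 < t\<^sup>2 * N.tail norm t) at_top" using d_pos by (intro order_tendstoD(1)[OF tail_sq]) simp
  then obtain L0 where L0: "\<And>t. L0 \<le> t \<Longrightarrow> real CARD('d) / 2 < t\<^sup>2 * N.tail norm t" by (auto simp: eventually_at_top_linorder)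
  \<comment> \<open>The 8 compensates the lower bound 1/8 for n G / k on the window.\<close>
  have "eventually (\<lambda>n. \<forall>t\<in>{0..16}. dist (tail_bias M (Xs 1) (norm_spectral_measure M X) (\<lambda>w. real CARD('d) * max_sq (index_set q) w) n (k n) t) 0 < e / 8) sequentially"
    using bias[of q 16, unfolded uniform_limit_iff, rule_format, of "e / 8"] e by simp
  then show ?thesis using good_large[of "max L0 0"] k_ge_1 k_le_n
  proof eventually_elim
    case (elim n)
    show ?case
    proof (intro allI impI)
      fix x assume g: "good n x"
      define t where "t = norm x"
      define G where "G = N.tail norm t"
      define Q where "Q = (\<integral>y. (F q (angle y) - m q) * of_bool (t < norm y) \<partial>N)"
      define K where "K = real (k n)"
      have K: "1 \<le> K" using elim by (simp add: K_def)
      have t: "0 < t" "L0 \<le> t" using elim(2) g by (auto simp: t_def)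
      have G: "K \<le> 8 * real n * G" "real n * G \<le> 8 * K" "0 < G" using g tail_pos[of t] by (auto simp: good_def K_def G_def t_def)
      have dt: "real CARD('d) / 2 < t\<^sup>2 * G" using L0[OF t(2)] by (simp add: G_def)
      have div: "1 \<le> n div k n" using elim by (simp add: div_greater_zero_iff Suc_le_eq)
      have "real (n div k n) * K \<le> real n" unfolding K_def by (metis div_times_less_eq_dividend of_nat_mult of_nat_mono)
      then have nk: "real (n div k n) \<le> real n / K" using K by (simp add: field_simps)
      \<comment> \<open>Regular variation bounds d/2 by G times the square of \<open>t\<close>, and
        n G / k is at most 8 on the window. Together they bound d times \<open>n div k n\<close> by
        16 times that square, and d is at least 1.\<close>
      have "real (n div k n) / t\<^sup>2 \<le> 16"
      proof -
        have "real (n div k n) * (real CARD('d) / 2) \<le> real n / K * (t\<^sup>2 * G)" using nk dt d_pos K by (intro mult_mono) auto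
        also have "\<dots> = (real n * G) / K * t\<^sup>2" by simp
        also have "\<dots> \<le> 8 * t\<^sup>2" using G K by (intro mult_right_mono) (auto simp: divide_le_eq)
        finally have "real (n div k n) * real CARD('d) \<le> 16 * t\<^sup>2" by simp
        moreover have "real (n div k n) * 1 \<le> real (n div k n) * real CARD('d)" using d_pos by (intro mult_left_mono) (auto simp: Suc_le_eq)
        ultimately show ?thesis using t by (simp add: divide_le_eq)
      qed
      then have "real (n div k n) / t\<^sup>2 \<in> {0..16}" by simp
      from elim(1)[rule_format, OF this]
      have "\<bar>sqrt K * (real n / K) * Q\<bar> < e / 8"
        unfolding tail_bias_eq[OF t(1) div] Q_def K_def by simp
      moreover have "sqrt K * (real n / K) * Q = (real n * G / K) * (sqrt K * Q / G)" using G by simp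
      ultimately have 1: "\<bar>(real n * G / K) * (sqrt K * Q / G)\<bar> < e / 8" by (simp only:)
      define a where "a = \<bar>sqrt K * Q / G\<bar>"
      have "\<bar>real n * G / K\<bar> = real n * G / K" using G K by simp
      then have "(real n * G / K) * a < e / 8" using 1 unfolding abs_mult[of "real n * G / K"] a_def by (simp only:)
      moreover have "1 / 8 * a \<le> (real n * G / K) * a"
        using G K by (intro mult_right_mono) (auto simp: field_simps a_def)
      ultimately have "a < e" by linarith
      then have "\<bar>sqrt K * Q / G\<bar> < e" by (simp only: a_def)
      then show "\<bar>sqrt (real (k n)) * (\<integral>y. (F q (angle y) - m q) * of_bool (norm x < norm y) \<partial>N) / N.tail norm (norm x)\<bar> < e"
        by (simp add: K_def Q_def G_def t_def)
    qed
  qed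
qed

lemma direction_bias:
  assumes e: "0 < e"
  shows "eventually (\<lambda>n. \<forall>x. good n x \<longrightarrow>
     \<bar>sqrt (real (k n)) * (\<integral>y. f u (angle y) * of_bool (norm x < norm y) \<partial>N) / N.tail norm (norm x)\<bar> < e) sequentially"
proof -
  \<comment> \<open>The added 1 keeps \<open>c\<close> positive for \<open>u = 0\<close> and makes
    the final inequality strict.\<close>
  define c where "c = (\<Sum>q\<in>UNIV. \<bar>u $ q\<bar>) + 1"
  have c: "0 < c" by (simp add: c_def sum_nonneg add_nonneg_pos)
  have "eventually (\<lambda>n. \<forall>q. \<forall>x. good n x \<longrightarrow>
     \<bar>sqrt (real (k n)) * (\<integral>y. (F q (angle y) - m q) * of_bool (norm x < norm y) \<partial>N) / N.tail norm (norm x)\<bar> < e / c) sequentially"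
    using component_bias e c by (intro eventually_all_finite) simp
  then show ?thesis
  proof eventually_elim
    case (elim n)
    show ?case
    proof (intro allI impI)
      fix x assume g: "good n x"
      define Q where "Q q = (\<integral>y. (F q (angle y) - m q) * of_bool (norm x < norm y) \<partial>N)" for q
      have i: "integrable N (\<lambda>y. (F q (angle y) - m q) * of_bool (norm x < norm y))" for q
      proof (rule N.integrable_const_bound[where B="real CARD('d) + \<bar>m q\<bar>"])
        have "\<bar>F q (angle y) - m q\<bar> \<le> real CARD('d) + \<bar>m q\<bar>" for y using F_angle_bounds[of q y] by linarith
        then show "AE y in N. norm ((F q (angle y) - m q) * of_bool (norm x < norm y)) \<le> real CARD('d) + \<bar>m q\<bar>"
          using d_pos by (intro AE_I2) (simp add: of_bool_def)
      qed measurable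
      have "(\<integral>y. f u (angle y) * of_bool (norm x < norm y) \<partial>N) = (\<integral>y. (\<Sum>q\<in>UNIV. u $ q * ((F q (angle y) - m q) * of_bool (norm x < norm y))) \<partial>N)"
        by (simp add: f_def sum_distrib_right mult.assoc)
      also have "\<dots> = (\<Sum>q\<in>UNIV. u $ q * Q q)"
        using i by (subst Bochner_Integration.integral_sum) (auto simp: Q_def)
      finally have "sqrt (real (k n)) * (\<integral>y. f u (angle y) * of_bool (norm x < norm y) \<partial>N) / N.tail norm (norm x)
        = (\<Sum>q\<in>UNIV. u $ q * (sqrt (real (k n)) * Q q / N.tail norm (norm x)))"
        by (simp add: sum_distrib_left sum_divide_distrib mult.left_commute)
      also have "\<bar>\<dots>\<bar> \<le> (\<Sum>q\<in>UNIV. \<bar>u $ q\<bar> * (e / c))"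
      proof (rule order_trans[OF sum_abs sum_mono])
        fix q
        have "\<bar>sqrt (real (k n)) * Q q / N.tail norm (norm x)\<bar> < e / c" using elim g unfolding Q_def by blast
        then show "\<bar>u $ q * (sqrt (real (k n)) * Q q / N.tail norm (norm x))\<bar> \<le> \<bar>u $ q\<bar> * (e / c)"
          unfolding abs_mult[of "u $ q"] by (intro mult_left_mono) auto
      qed
      also have "\<dots> = (c - 1) * (e / c)" unfolding sum_distrib_right[symmetric] by (simp add: c_def)
      also have "\<dots> < e" using c e by (simp add: field_simps)
      finally show "\<bar>sqrt (real (k n)) * (\<integral>y. f u (angle y) * of_bool (norm x < norm y) \<partial>N) / N.tail norm (norm x)\<bar> < e" .
    qed
  qed
qed

text \<open>Good points have uniformly large norm, so the limit of the conditional second moment at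
  infinity holds uniformly over them.\<close>

lemma direction_variance:
  assumes e: "0 < e"
  shows "eventually (\<lambda>n. \<forall>x. good n x \<longrightarrow>
     \<bar>(\<integral>y. (f u (angle y))\<^sup>2 * of_bool (norm x < norm y) \<partial>N) / N.tail norm (norm x) - s u\<bar> < e) sequentially"
proof -
  have "((\<lambda>t. (\<integral>x. (f u (angle (X x)))\<^sup>2 * of_bool (t < norm (X x)) \<partial>M) / prob {x \<in> space M. t < norm (X x)})
           \<longlongrightarrow> (\<integral>w. (f u w)\<^sup>2 \<partial>H) / measure H UNIV) at_top"
    by (rule RV.tendsto_tail_conditional) (auto intro!: continuous_intros f_continuous simp: mass_H)
  moreover have "(\<integral>x. (f u (angle (X x)))\<^sup>2 * of_bool (t < norm (X x)) \<partial>M) = (\<integral>y. (f u (angle y))\<^sup>2 * of_bool (t < norm y) \<partial>N)" for t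
    by (subst integral_N) auto
  moreover have "(\<integral>w. (f u w)\<^sup>2 \<partial>H) / measure H UNIV = s u"
    by (simp add: mass_H integral_H s_def Ex_def)
  ultimately have "((\<lambda>t. (\<integral>y. (f u (angle y))\<^sup>2 * of_bool (t < norm y) \<partial>N) / N.tail norm t) \<longlongrightarrow> s u) at_top"
    by (simp add: tail_N)
  from tendstoD[OF this e] obtain L where L: "\<And>t. L \<le> t \<Longrightarrow> \<bar>(\<integral>y. (f u (angle y))\<^sup>2 * of_bool (t < norm y) \<partial>N) / N.tail norm t - s u\<bar> < e"
    by (auto simp: eventually_at_top_linorder dist_real_def)
  show ?thesis using good_large[of L] by eventually_elim (use L in \<open>auto intro: less_imp_le\<close>)
qed

lemma tendsto_product_form:
  "(\<lambda>n. \<integral>w. (\<Prod>l\<in>{1..n}. if card (above {1..n} (\<lambda>l. norm (w l)) (norm (w l))) < k n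
                then exp (\<zeta> * complex_of_real (f u (angle (w l)) / sqrt (real (k n)))) else 1) \<partial>PiM {1..n} (\<lambda>_. N))
     \<longlonglongrightarrow> exp (\<zeta>\<^sup>2 / 2 * s u)"
proof (rule N.tendsto_integral_exp_top[OF norm_N atomless_N _ f_angle_bounded k_large k_le_n])
  show "(\<lambda>x. f u (angle x)) \<in> borel_measurable N" by measurable
qed (use direction_bias[of _ u] direction_variance[of _ u] in \<open>simp_all add: good_def\<close>)

end

lemma top_set_measurable:
  fixes V :: "'i \<Rightarrow> 'x \<Rightarrow> real"
  assumes I: "finite I" and V: "\<And>j. j \<in> I \<Longrightarrow> V j \<in> borel_measurable M'" and l: "l \<in> I"
  shows "{x \<in> space M'. card (above I (\<lambda>j. V j x) (V l x)) < k} \<in> sets M'"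
proof -
  have "(\<lambda>x. \<Sum>j\<in>I. (if V l x < V j x then 1 else 0 :: real)) \<in> borel_measurable M'"
    by (intro borel_measurable_sum measurable_If borel_measurable_const borel_measurable_less V l)
  then have "{x \<in> space M'. (\<Sum>j\<in>I. (if V l x < V j x then 1 else 0 :: real)) < real k} \<in> sets M'"
    by (rule borel_measurable_less) (rule borel_measurable_const)
  moreover have "(\<Sum>j\<in>I. (if V l x < V j x then 1 else 0 :: real)) = real (card (above I (\<lambda>j. V j x) (V l x)))" for x
    using I by (simp add: above_def sum.If_cases Int_def)
  ultimately show ?thesis by simp
qed

section \<open>The rescaled error of the estimator and its moments\<close>

context scaling_estimation begin

interpretation RV: regular_variation M X H by (rule RV)
interpretation N: prob_space N by (rule prob_N)

definition admissible :: "nat \<Rightarrow> bool" where "admissible n \<longleftrightarrow> 1 \<le> k n \<and> k n \<le> n"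

lemma eventually_admissible: "eventually admissible sequentially"
  using k_ge_1 k_le_n by eventually_elim (simp add: admissible_def)

definition top :: "nat \<Rightarrow> 'a \<Rightarrow> nat set" where
  "top n x = {l \<in> {1..n}. card (above {1..n} (\<lambda>j. norm (Xs j x)) (norm (Xs l x))) < k n}"

definition error :: "nat \<Rightarrow> 'a \<Rightarrow> (real, 'd scaling_index) vec" where
  "error n x = sqrt (real (k n)) *\<^sub>R (S_M_est Xs n (k n) x - S_M M X)"

text \<open>For the finitely many inadmissible \<open>n\<close> the order statistic is a junk value of \<open>!\<close>.\<close>

definition error' :: "nat \<Rightarrow> 'a \<Rightarrow> (real, 'd scaling_index) vec" where
  "error' n x = (if admissible n then error n x else 0)"

text \<open>By \<open>ge_kth_largest_iff\<close> the comparison with the order statistic is a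
  condition on the rank of the observation.\<close>

lemma est_component:
  assumes "admissible n"
  shows "S_M_est Xs n (k n) x $ q = 1 / real (k n) * (\<Sum>l\<in>top n x. F q (angle (Xs l x)))"
proof -
  have t: "kth_largest n (k n) (\<lambda>j. norm (Xs j x)) \<le> norm (Xs l x) \<longleftrightarrow> l \<in> top n x" if "l \<in> {1..n}" for l
    using ge_kth_largest_iff[of "k n" n "\<lambda>j. norm (Xs j x)" "norm (Xs l x)"] assms that
    unfolding admissible_def top_def above_def by simp
  have "(\<Sum>l=1..n. max_sq (index_set q) (angle (Xs l x)) * of_bool (norm (Xs l x) \<ge> kth_largest n (k n) (\<lambda>j. norm (Xs j x))))
      = (\<Sum>l\<in>top n x. max_sq (index_set q) (angle (Xs l x)))"
  proof (rule sum.mono_neutral_cong_right)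
    show "top n x \<subseteq> {1..n}" by (auto simp: top_def)
    show "\<forall>l\<in>{1..n} - top n x. max_sq (index_set q) (angle (Xs l x)) * of_bool (norm (Xs l x) \<ge> kth_largest n (k n) (\<lambda>j. norm (Xs j x))) = 0"
      using t by simp
    fix l assume l: "l \<in> top n x"
    then have "l \<in> {1..n}" by (simp add: top_def)
    then show "max_sq (index_set q) (angle (Xs l x)) * of_bool (norm (Xs l x) \<ge> kth_largest n (k n) (\<lambda>j. norm (Xs j x))) = max_sq (index_set q) (angle (Xs l x))"
      using t l by simp
  qed simp
  then show ?thesis
    unfolding S_M_est_def scaling_est_def vec_lambda_beta F_def sum_distrib_left[symmetric] by simp
qed

text \<open>Without ties exactly \<open>k n\<close> observations are selected, so the mean
  \<open>m q\<close> can be distributed over the summands.\<close>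

lemma inner_error:
  assumes n: "admissible n" and inj: "inj_on (\<lambda>l. norm (Xs l x)) {1..n}"
  shows "u \<bullet> error n x = (\<Sum>l\<in>top n x. f u (angle (Xs l x)) / sqrt (real (k n)))"
proof -
  have card: "card (top n x) = k n" unfolding top_def using n inj by (intro card_top) (auto simp: admissible_def)
  have k0: "0 < k n" using n by (simp add: admissible_def)
  have sq: "sqrt (real (k n)) * (1 / real (k n)) = 1 / sqrt (real (k n))"
  proof -
    have "sqrt (real (k n)) * sqrt (real (k n)) = real (k n)" by simp
    then show ?thesis using k0 by (simp add: field_simps)
  qed
  have "sqrt (real (k n)) * (S_M_est Xs n (k n) x $ q - m q) = (\<Sum>l\<in>top n x. (F q (angle (Xs l x)) - m q) / sqrt (real (k n)))" for q
  proof -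
    have "m q = 1 / real (k n) * (\<Sum>l\<in>top n x. m q)" using card k0 by simp
    then have "S_M_est Xs n (k n) x $ q - m q = 1 / real (k n) * (\<Sum>l\<in>top n x. F q (angle (Xs l x)) - m q)"
      unfolding est_component[OF n] by (simp only: sum_subtractf right_diff_distrib)
    then have "sqrt (real (k n)) * (S_M_est Xs n (k n) x $ q - m q)
        = sqrt (real (k n)) * (1 / real (k n)) * (\<Sum>l\<in>top n x. F q (angle (Xs l x)) - m q)"
      by (simp only: mult.assoc)
    then show ?thesis unfolding sum_divide_distrib[symmetric] sq by simp
  qed
  then have "u \<bullet> error n x = (\<Sum>q\<in>UNIV. u $ q * (\<Sum>l\<in>top n x. (F q (angle (Xs l x)) - m q) / sqrt (real (k n))))"
    by (simp only: inner_vec_def error_def S_M_component inner_real_def vector_scaleR_component vector_minus_component real_scaleR_def)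
  also have "\<dots> = (\<Sum>l\<in>top n x. \<Sum>q\<in>UNIV. u $ q * (F q (angle (Xs l x)) - m q) / sqrt (real (k n)))"
    unfolding sum_distrib_left times_divide_eq_right[symmetric] by (rule sum.swap)
  also have "\<dots> = (\<Sum>l\<in>top n x. f u (angle (Xs l x)) / sqrt (real (k n)))"
    by (simp only: f_def sum_divide_distrib)
  finally show ?thesis .
qed

lemma top_sets: "l \<in> {1..n} \<Longrightarrow> {x \<in> space M. l \<in> top n x} \<in> sets M"
proof -
  assume l: "l \<in> {1..n}"
  have "(\<lambda>x. norm (Xs j x)) \<in> borel_measurable M" if "j \<in> {1..n}" for j
    using that by (intro measurable_compose[OF Xs_measurable borel_measurable_norm]) simp
  from top_set_measurable[where I="{1..n}" and k="k n" and V="\<lambda>j x. norm (Xs j x)", OF _ this l]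
  show ?thesis using l by (simp add: top_def)
qed

lemma error'_measurable: "error' n \<in> borel_measurable M"
proof (rule borel_measurable_vecI)
  fix q
  show "(\<lambda>x. error' n x $ q) \<in> borel_measurable M"
  proof (cases "admissible n")
    case True
    have "(\<lambda>x. if l \<in> top n x then F q (angle (Xs l x)) else 0) \<in> borel_measurable M" if "l \<in> {1..n}" for l
    proof (rule measurable_If)
      show "(\<lambda>x. F q (angle (Xs l x))) \<in> borel_measurable M"
        using that by (intro measurable_compose[OF measurable_compose[OF Xs_measurable measurable_angle] F_measurable]) simp
    qed (use top_sets[OF that] in auto)
    then have "(\<lambda>x. sqrt (real (k n)) * (1 / real (k n) * (\<Sum>l\<in>{1..n}. if l \<in> top n x then F q (angle (Xs l x)) else 0) - m q)) \<in> borel_measurable M"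
      by (intro borel_measurable_times borel_measurable_diff borel_measurable_const borel_measurable_sum)
    moreover have "(\<Sum>l\<in>{1..n}. if l \<in> top n x then F q (angle (Xs l x)) else 0) = (\<Sum>l\<in>top n x. F q (angle (Xs l x)))" for x
      by (rule sum.mono_neutral_cong_right) (auto simp: top_def)
    ultimately show ?thesis using True by (simp add: error'_def error_def est_component[OF True] S_M_component)
  qed (simp add: error'_def)
qed

text \<open>The bound depends on \<open>n\<close>; it serves to make powers and exponentials of the
  error integrable.\<close>

lemma error'_bounded: "\<exists>C. \<forall>x. norm (error' n x) \<le> C"
proof (cases "admissible n")
  case True
  define b where "b q = sqrt (real (k n)) * (1 / real (k n) * (real n * real CARD('d)) + \<bar>m q\<bar>)" for q
  have "\<bar>error' n x $ q\<bar> \<le> b q" for x q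
  proof -
    have "\<bar>\<Sum>l\<in>top n x. F q (angle (Xs l x))\<bar> \<le> (\<Sum>l\<in>top n x. real CARD('d))"
      using F_angle_bounds by (intro order_trans[OF sum_abs sum_mono]) simp
    also have "\<dots> \<le> real n * real CARD('d)"
    proof -
      have "card (top n x) \<le> card {1..n}" by (intro card_mono) (auto simp: top_def)
      then show ?thesis by simp
    qed
    finally have "\<bar>S_M_est Xs n (k n) x $ q\<bar> \<le> 1 / real (k n) * (real n * real CARD('d))"
      unfolding est_component[OF True] abs_mult by (simp add: divide_right_mono)
    then have "\<bar>S_M_est Xs n (k n) x $ q - m q\<bar> \<le> 1 / real (k n) * (real n * real CARD('d)) + \<bar>m q\<bar>" by linarith
    then show ?thesis using True by (simp add: error'_def error_def S_M_component b_def abs_mult mult_left_mono)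
  qed
  then have "norm (error' n x) \<le> (\<Sum>q\<in>UNIV. b q)" for x
    by (intro order_trans[OF norm_le_l1_cart] sum_mono)
  then show ?thesis by blast
qed (simp add: error'_def, blast)

lemma inner_error'_bounded: "\<exists>C. \<forall>x. \<bar>u \<bullet> error' n x\<bar> \<le> C"
proof -
  obtain C where "\<And>x. norm (error' n x) \<le> C" using error'_bounded by blast
  then have "\<bar>u \<bullet> error' n x\<bar> \<le> norm u * C" for x
    by (intro order_trans[OF Cauchy_Schwarz_ineq2] mult_left_mono) auto
  then show ?thesis by blast
qed

lemma inner_error'_measurable: "(\<lambda>x. u \<bullet> error' n x) \<in> borel_measurable M"
  by (rule borel_measurable_inner[OF borel_measurable_const error'_measurable])

lemma joint_law:
  assumes "1 \<le> n"
  shows "distr M (PiM {1..n} (\<lambda>_. borel)) (\<lambda>x. \<lambda>i\<in>{1..n}. Xs i x) = PiM {1..n} (\<lambda>_. N)"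
proof -
  have "indep_vars (\<lambda>_. borel) Xs {1..n}"
    using iid unfolding iid_copies_def by (auto intro: indep_vars_subset)
  then have "distr M (PiM {1..n} (\<lambda>_. borel)) (\<lambda>x. \<lambda>i\<in>{1..n}. Xs i x) = PiM {1..n} (\<lambda>i. distr M borel (Xs i))"
    using assms by (subst (asm) indep_vars_iff_distr_eq_PiM') (auto intro: Xs_measurable)
  also have "\<dots> = PiM {1..n} (\<lambda>_. N)" by (rule PiM_cong) (auto simp: distr_Xs)
  finally show ?thesis .
qed

text \<open>The sample is transported to the product space. Almost surely there are no ties, and
  then the exponential of the sum over the largest observations is a product over all indices with
  factor 1 at the others.\<close>

lemma exp_error_limit:
  "(\<lambda>n. \<integral>x. exp (\<zeta> * complex_of_real (u \<bullet> error' n x)) \<partial>M) \<longlonglongrightarrow> exp (\<zeta>\<^sup>2 / 2 * s u)"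
proof (rule Lim_transform_eventually[OF tendsto_product_form[of \<zeta> u]])
  show "eventually (\<lambda>n. (\<integral>w. (\<Prod>l\<in>{1..n}. if card (above {1..n} (\<lambda>l. norm (w l)) (norm (w l))) < k n
                then exp (\<zeta> * complex_of_real (f u (angle (w l)) / sqrt (real (k n)))) else 1) \<partial>PiM {1..n} (\<lambda>_. N))
       = (\<integral>x. exp (\<zeta> * complex_of_real (u \<bullet> error' n x)) \<partial>M)) sequentially"
    using eventually_admissible
  proof eventually_elim
    case (elim n)
    define T where "T = (\<lambda>x. \<lambda>i\<in>{1..n}. Xs i x)"
    define g where "g w = (\<Prod>l\<in>{1..n}. if card (above {1..n} (\<lambda>l. norm (w l)) (norm (w l))) < k n
                then exp (\<zeta> * complex_of_real (f u (angle (w l)) / sqrt (real (k n)))) else 1)" for w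
    have n1: "1 \<le> n" using elim by (simp add: admissible_def)
    have T: "T \<in> measurable M (PiM {1..n} (\<lambda>_. borel))"
      unfolding T_def by (rule measurable_restrict) (auto intro: Xs_measurable)
    have comp: "(\<lambda>w. w l) \<in> measurable (PiM {1..n} (\<lambda>_. borel)) borel" if "l \<in> {1..n}" for l
      using that by (rule measurable_component_singleton)
    have g: "g \<in> borel_measurable (PiM {1..n} (\<lambda>_. borel))"
      unfolding g_def
    proof (intro borel_measurable_prod measurable_If borel_measurable_const)
      fix l assume l: "l \<in> {1..n}"
      show "{w \<in> space (PiM {1..n} (\<lambda>_. borel)). card (above {1..n} (\<lambda>l. norm (w l)) (norm (w l))) < k n} \<in> sets (PiM {1..n} (\<lambda>_. borel))"
        by (rule top_set_measurable[of "{1..n}" "\<lambda>l w. norm (w l)", OF _ measurable_compose[OF comp borel_measurable_norm] l]) auto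
      have "(\<lambda>y. exp (\<zeta> * complex_of_real (f u (angle y) / sqrt (real (k n))))) \<in> borel_measurable borel" by measurable
      from measurable_compose[OF comp[OF l] this]
      show "(\<lambda>w. exp (\<zeta> * complex_of_real (f u (angle (w l)) / sqrt (real (k n))))) \<in> borel_measurable (PiM {1..n} (\<lambda>_. borel))" .
    qed
    have "AE w in PiM {1..n} (\<lambda>_. N). inj_on (\<lambda>l. norm (w l)) {1..n}"
      by (rule N.AE_inj_on_PiM[OF norm_N atomless_N]) simp
    then have "AE w in distr M (PiM {1..n} (\<lambda>_. borel)) T. inj_on (\<lambda>l. norm (w l)) {1..n}"
      unfolding T_def joint_law[OF n1] .
    then have inj: "AE x in M. inj_on (\<lambda>l. norm (T x l)) {1..n}" by (rule AE_distrD[OF T])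
    have "(\<integral>w. g w \<partial>PiM {1..n} (\<lambda>_. N)) = (\<integral>x. g (T x) \<partial>M)"
      unfolding joint_law[OF n1, folded T_def, symmetric] by (rule integral_distr[OF T g])
    also have "\<dots> = (\<integral>x. exp (\<zeta> * complex_of_real (u \<bullet> error' n x)) \<partial>M)"
    proof (rule integral_cong_AE)
      show "(\<lambda>x. g (T x)) \<in> borel_measurable M" by (rule measurable_compose[OF T g])
      have "(\<lambda>y. exp (\<zeta> * complex_of_real y)) \<in> borel_measurable borel" by measurable
      from measurable_compose[OF inner_error'_measurable this]
      show "(\<lambda>x. exp (\<zeta> * complex_of_real (u \<bullet> error' n x))) \<in> borel_measurable M" .
      show "AE x in M. g (T x) = exp (\<zeta> * complex_of_real (u \<bullet> error' n x))"
        using inj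
      proof eventually_elim
        case inj: (elim x)
        have Tl: "T x l = Xs l x" if "l \<in> {1..n}" for l using that by (simp add: T_def)
        have ab: "above {1..n} (\<lambda>l. norm (T x l)) v = above {1..n} (\<lambda>l. norm (Xs l x)) v" for v
          unfolding above_def using Tl by auto
        have inj': "inj_on (\<lambda>l. norm (Xs l x)) {1..n}" using inj by (rule inj_on_cong[THEN iffD1, rotated]) (simp add: Tl)
        have "g (T x) = (\<Prod>l\<in>{1..n}. if l \<in> top n x then exp (\<zeta> * complex_of_real (f u (angle (Xs l x)) / sqrt (real (k n)))) else 1)"
          unfolding g_def
        proof (rule prod.cong[OF refl])
          fix l assume l: "l \<in> {1..n}"
          show "(if card (above {1..n} (\<lambda>l. norm (T x l)) (norm (T x l))) < k n
                then exp (\<zeta> * complex_of_real (f u (angle (T x l)) / sqrt (real (k n)))) else 1)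
            = (if l \<in> top n x then exp (\<zeta> * complex_of_real (f u (angle (Xs l x)) / sqrt (real (k n)))) else 1)"
            by (simp only: ab Tl[OF l] top_def mem_Collect_eq l simp_thms)
        qed
        also have "\<dots> = (\<Prod>l\<in>top n x. exp (\<zeta> * complex_of_real (f u (angle (Xs l x)) / sqrt (real (k n)))))"
          by (rule prod.mono_neutral_cong_right) (auto simp: top_def)
        also have "\<dots> = exp (\<Sum>l\<in>top n x. \<zeta> * complex_of_real (f u (angle (Xs l x)) / sqrt (real (k n))))"
          by (rule exp_sum[symmetric]) (simp add: top_def)
        also have "\<dots> = exp (\<zeta> * complex_of_real (u \<bullet> error' n x))"
          using elim inner_error[OF elim inj', of u] by (simp add: error'_def sum_distrib_left)
        finally show ?case .
      qed
    qed
    finally show ?case by (simp add: g_def)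
  qed
qed

lemma mgf_limit: "(\<lambda>n. \<integral>x. exp (c * (u \<bullet> error' n x)) \<partial>M) \<longlonglongrightarrow> exp (c\<^sup>2 / 2 * s u)"
proof -
  have "(\<integral>x. exp (complex_of_real c * complex_of_real (u \<bullet> error' n x)) \<partial>M) = complex_of_real (\<integral>x. exp (c * (u \<bullet> error' n x)) \<partial>M)" for n
    unfolding integral_complex_of_real[symmetric] by (simp add: exp_of_real[symmetric])
  moreover have "exp ((complex_of_real c)\<^sup>2 / 2 * s u) = complex_of_real (exp (c\<^sup>2 / 2 * s u))"
    by (simp add: exp_of_real[symmetric])
  ultimately show ?thesis using exp_error_limit[of "complex_of_real c" u] by (simp only: tendsto_of_real_iff)
qed

text \<open>The moment generating functions at 1 and -1 are bounded for large n, which bounds the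
  fourth moments through \<open>power4_le_exp\<close>; the limits of the first two moments are then
  read off the characteristic functions.\<close>

lemma moment_limits:
  "(\<lambda>n. \<integral>x. u \<bullet> error' n x \<partial>M) \<longlonglongrightarrow> 0" "(\<lambda>n. \<integral>x. (u \<bullet> error' n x)\<^sup>2 \<partial>M) \<longlonglongrightarrow> s u"
proof -
  have conv: "(\<lambda>n. \<integral>x. iexp (h * (u \<bullet> error' n x)) \<partial>M) \<longlonglongrightarrow> complex_of_real (exp (- (h\<^sup>2 * s u) / 2))" for h :: real
  proof -
    have "\<i> * complex_of_real (h * y) = (\<i> * complex_of_real h) * complex_of_real y" for y by simp
    moreover have "exp ((\<i> * complex_of_real h)\<^sup>2 / 2 * s u) = complex_of_real (exp (- (h\<^sup>2 * s u) / 2))"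
      by (simp add: exp_of_real[symmetric] power_mult_distrib)
    ultimately show ?thesis using exp_error_limit[of "\<i> * complex_of_real h" u] by (simp only:)
  qed
  have e: "integrable M (\<lambda>x. exp (c * (u \<bullet> error' n x)))" for c n
  proof -
    obtain C where C: "\<And>x. \<bar>u \<bullet> error' n x\<bar> \<le> C" using inner_error'_bounded by blast
    show ?thesis
    proof (rule integrable_const_bound[where B="exp (\<bar>c\<bar> * C)"])
      have "c * (u \<bullet> error' n x) \<le> \<bar>c\<bar> * C" for x
        using order_trans[OF abs_ge_self[of "c * (u \<bullet> error' n x)"]] C[of x] by (simp add: abs_mult mult_left_mono)
      then show "AE x in M. norm (exp (c * (u \<bullet> error' n x))) \<le> exp (\<bar>c\<bar> * C)" by simp
      have "(\<lambda>y. exp (c * y)) \<in> borel_measurable borel" by measurable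
      from measurable_compose[OF inner_error'_measurable this] show "(\<lambda>x. exp (c * (u \<bullet> error' n x))) \<in> borel_measurable M" .
    qed
  qed
  have m4: "integrable M (\<lambda>x. (u \<bullet> error' n x) ^ 4)" for n
  proof -
    obtain C where C: "\<And>x. \<bar>u \<bullet> error' n x\<bar> \<le> C" using inner_error'_bounded by blast
    show ?thesis
    proof (rule integrable_const_bound[where B="C ^ 4"])
      show "AE x in M. norm ((u \<bullet> error' n x) ^ 4) \<le> C ^ 4"
      proof (rule AE_I2)
        fix x
        have "\<bar>u \<bullet> error' n x\<bar> ^ 4 \<le> C ^ 4" by (rule power_mono[OF C]) simp
        then show "norm ((u \<bullet> error' n x) ^ 4) \<le> C ^ 4" by (simp add: norm_power)
      qed
    qed (rule borel_measurable_power[OF inner_error'_measurable])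
  qed
  \<comment> \<open>Just above exp (s u / 2), the common limit of the two moment generating
    functions.\<close>
  define K where "K = exp (s u / 2) + 1"
  have "eventually (\<lambda>n. (\<integral>x. exp (1 * (u \<bullet> error' n x)) \<partial>M) < K) sequentially"
    "eventually (\<lambda>n. (\<integral>x. exp (-1 * (u \<bullet> error' n x)) \<partial>M) < K) sequentially"
    by (rule order_tendstoD(2)[OF mgf_limit], simp add: K_def)+
  then have moment4: "eventually (\<lambda>n. (\<integral>x. (u \<bullet> error' n x) ^ 4 \<partial>M) \<le> 64 * (K + K)) sequentially"
  proof eventually_elim
    case (elim n)
    have "(\<integral>x. (u \<bullet> error' n x) ^ 4 \<partial>M) \<le> (\<integral>x. 64 * (exp (1 * (u \<bullet> error' n x)) + exp (-1 * (u \<bullet> error' n x))) \<partial>M)"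
    proof (intro integral_mono m4 integrable_mult_right Bochner_Integration.integrable_add e)
      show "(u \<bullet> error' n x) ^ 4 \<le> 64 * (exp (1 * (u \<bullet> error' n x)) + exp (-1 * (u \<bullet> error' n x)))" for x
        using power4_le_exp[of "u \<bullet> error' n x"] by simp
    qed
    also have "\<dots> = 64 * ((\<integral>x. exp (1 * (u \<bullet> error' n x)) \<partial>M) + (\<integral>x. exp (-1 * (u \<bullet> error' n x)) \<partial>M))"
      unfolding integral_mult_right_zero by (subst Bochner_Integration.integral_add[OF e e]) simp
    also have "\<dots> \<le> 64 * (K + K)" using elim by (intro mult_left_mono) auto
    finally show ?case .
  qed
  from tendsto_moments_of_char[OF prob_space_axioms inner_error'_measurable inner_error'_bounded conv moment4]
  show "(\<lambda>n. \<integral>x. u \<bullet> error' n x \<partial>M) \<longlonglongrightarrow> 0" "(\<lambda>n. \<integral>x. (u \<bullet> error' n x)\<^sup>2 \<partial>M) \<longlonglongrightarrow> s u" .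
qed

end

section \<open>The limiting covariance matrix, normality and singularity\<close>

context scaling_estimation begin

interpretation RV: regular_variation M X H by (rule RV)

lemma Ex_add: "Ex (\<lambda>w. \<phi> w + \<psi> w) = Ex \<phi> + Ex \<psi>"
  by (simp add: Ex_def distrib_left sum.distrib)

lemma Ex_cmult: "Ex (\<lambda>w. c * \<phi> w) = c * Ex \<phi>"
  by (simp add: Ex_def sum_distrib_left mult.left_commute)

lemma Ex_sum: "Ex (\<lambda>w. \<Sum>i\<in>A. \<phi> i w) = (\<Sum>i\<in>A. Ex (\<phi> i))"
  unfolding Ex_def sum_distrib_left by (rule sum.swap)

lemma Ex_square_add: "Ex (\<lambda>w. (\<phi> w + \<psi> w)\<^sup>2) = Ex (\<lambda>w. (\<phi> w)\<^sup>2) + Ex (\<lambda>w. (\<psi> w)\<^sup>2) + 2 * Ex (\<lambda>w. \<phi> w * \<psi> w)"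
proof -
  have "(\<phi> w + \<psi> w)\<^sup>2 = (\<phi> w)\<^sup>2 + (\<psi> w)\<^sup>2 + 2 * (\<phi> w * \<psi> w)" for w by (simp add: power2_sum)
  then show ?thesis by (simp only: Ex_add Ex_cmult)
qed

definition cov :: "'d scaling_index \<Rightarrow> 'd scaling_index \<Rightarrow> real" where
  "cov q r = Ex (\<lambda>w. (F q w - m q) * (F r w - m r))"

lemma cov_commute: "cov q r = cov r q"
  by (simp add: cov_def mult.commute)

lemma variance_norm_spectral:
  fixes \<phi> :: "(real, 'd) vec \<Rightarrow> real"
  assumes \<phi>: "\<phi> \<in> borel_measurable borel"
  shows "(\<integral>w. (\<phi> w - (\<integral>w. \<phi> w \<partial>norm_spectral_measure M X))\<^sup>2 \<partial>norm_spectral_measure M X) = Ex (\<lambda>w. (\<phi> w - Ex \<phi>)\<^sup>2)"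
  unfolding integral_norm_spectral[OF \<phi>]
  by (rule integral_norm_spectral[OF borel_measurable_power[OF borel_measurable_diff[OF \<phi> borel_measurable_const]]])

text \<open>Polarization: the variance of a sum minus both variances is twice the covariance. So
  \<open>W_M\<close> is the covariance matrix of the functions \<open>F q\<close> under the
  normalized spectral measure, with the two factors d absorbed into \<open>F\<close>.\<close>

lemma W_M_entry: "W_M M X $ q $ r = cov q r"
proof -
  let ?d = "real CARD('d)"
  define g where "g q = max_sq (index_set q)" for q :: "'d scaling_index"
  have gm: "g q \<in> borel_measurable borel" for q unfolding g_def by (rule max_sq_measurable[OF index_set_nonempty])
  have mg: "m q = ?d * Ex (g q)" for q unfolding m_def F_def[abs_def] g_def by (rule Ex_cmult)
  have Fg: "F q w - m q = ?d * (g q w - Ex (g q))" for q w by (simp add: F_def mg g_def right_diff_distrib)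
  have cov: "cov q r = ?d\<^sup>2 * Ex (\<lambda>w. (g q w - Ex (g q)) * (g r w - Ex (g r)))" for q r
  proof -
    have "(F q w - m q) * (F r w - m r) = ?d\<^sup>2 * ((g q w - Ex (g q)) * (g r w - Ex (g r)))" for w
      unfolding Fg by (simp add: power2_eq_square)
    then show ?thesis unfolding cov_def by (simp only: Ex_cmult)
  qed
  have v1: "Ex (\<lambda>w. (g q w - Ex (g q))\<^sup>2) = Ex (\<lambda>w. (g q w - Ex (g q)) * (g q w - Ex (g q)))" for q
    by (simp add: power2_eq_square)
  have v2: "Ex (\<lambda>w. (g q w + g r w - Ex (\<lambda>w. g q w + g r w))\<^sup>2) = Ex (\<lambda>w. (g q w - Ex (g q))\<^sup>2) + Ex (\<lambda>w. (g r w - Ex (g r))\<^sup>2)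
      + 2 * Ex (\<lambda>w. (g q w - Ex (g q)) * (g r w - Ex (g r)))"
  proof -
    have "g q w + g r w - Ex (\<lambda>w. g q w + g r w) = (g q w - Ex (g q)) + (g r w - Ex (g r))" for w
      unfolding Ex_add[of "g q" "g r"] by simp
    then show ?thesis by (simp only: Ex_square_add)
  qed
  have var: "(\<integral>w. (g q w - (\<integral>w. g q w \<partial>norm_spectral_measure M X))\<^sup>2 \<partial>norm_spectral_measure M X) = Ex (\<lambda>w. (g q w - Ex (g q))\<^sup>2)" for q
    by (rule variance_norm_spectral[OF gm])
  have varp: "(\<integral>w. (g q w + g r w - (\<integral>w. g q w + g r w \<partial>norm_spectral_measure M X))\<^sup>2 \<partial>norm_spectral_measure M X)
      = Ex (\<lambda>w. (g q w + g r w - Ex (\<lambda>w. g q w + g r w))\<^sup>2)"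
    by (rule variance_norm_spectral[OF borel_measurable_add[OF gm gm]])
  show ?thesis
    unfolding W_M_def Let_def vec_lambda_beta g_def[symmetric] var varp v2 cov
    by (auto simp: power2_eq_square)
qed

lemma s_eq_quadratic_form: "s u = u \<bullet> (W_M M X *v u)"
proof -
  have "u \<bullet> (W_M M X *v u) = (\<Sum>q\<in>UNIV. \<Sum>r\<in>UNIV. u $ q * (u $ r * cov q r))"
    by (simp add: inner_vec_def matrix_vector_mult_def W_M_entry sum_distrib_left mult.commute)
  also have "\<dots> = Ex (\<lambda>w. \<Sum>q\<in>UNIV. \<Sum>r\<in>UNIV. u $ q * (u $ r * ((F q w - m q) * (F r w - m r))))"
    unfolding Ex_sum Ex_cmult cov_def ..
  also have "\<dots> = s u"
    unfolding s_def f_def power2_eq_square sum_product by (simp add: ac_simps)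
  finally show ?thesis by simp
qed

lemma s_axis: "s (axis q 1) = W_M M X $ q $ q"
proof -
  have "f (axis q 1) w = F q w - m q" for w
    by (simp add: f_def axis_def if_distrib[of "\<lambda>x. x * _"] cong: if_cong)
  then show ?thesis by (simp add: s_def W_M_entry cov_def power2_eq_square)
qed

lemma s_add: "s (u + v) = s u + s v + 2 * Ex (\<lambda>w. f u w * f v w)"
proof -
  have "f (u + v) w = f u w + f v w" for w by (simp add: f_def distrib_right sum.distrib)
  then show ?thesis unfolding s_def by (simp only: Ex_square_add)
qed

lemma s_axis_add: "s (axis q 1 + axis r 1) = W_M M X $ q $ q + W_M M X $ r $ r + 2 * W_M M X $ q $ r"
proof -
  have "f (axis q 1) w = F q w - m q" for w q
    by (simp add: f_def axis_def if_distrib[of "\<lambda>x. x * _"] cong: if_cong)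
  then show ?thesis by (simp add: s_add s_axis W_M_entry[of q r] cov_def)
qed

lemma transpose_W: "transpose (W_M M X) = W_M M X"
  by (simp add: transpose_def vec_eq_iff W_M_entry cov_commute)

theorem asymptotic_normality:
  "\<exists>L. is_normal L 0 (W_M M X) \<and> conv_in_distr M (\<lambda>n x. sqrt (real (k n)) *\<^sub>R (S_M_est Xs n (k n) x - S_M M X)) L"
proof -
  \<comment> \<open>The centred values at the atoms, weighted by the roots of the masses: the outer
    products of these vectors with themselves sum to \<open>W_M\<close>, so
    \<open>gaussian_combination\<close> yields the required covariance.\<close>
  define v where "v j = sqrt (p j) *\<^sub>R (\<chi> q. F q (\<alpha> j) - m q)" for j
  obtain L where L: "prob_space L" "sets L = sets (borel :: (real, 'd scaling_index) vec measure)"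
    "\<And>u. (\<integral>y. iexp (u \<bullet> y) \<partial>L) = complex_of_real (exp (- (\<Sum>j\<in>UNIV. (u \<bullet> v j)\<^sup>2) / 2))"
    using gaussian_combination[of v] by metis
  have "(\<Sum>j\<in>UNIV. (u \<bullet> v j)\<^sup>2) = s u" for u
  proof -
    have "u \<bullet> v j = sqrt (p j) * f u (\<alpha> j)" for j
      by (simp add: v_def inner_vec_def f_def sum_distrib_left mult.left_commute)
    then show ?thesis using p_nonneg by (simp add: s_def Ex_def power_mult_distrib)
  qed
  then have char: "(\<integral>y. iexp (u \<bullet> y) \<partial>L) = complex_of_real (exp (- s u / 2))" for u by (simp only: L(3))
  have normal: "is_normal L 0 (W_M M X)"
    unfolding is_normal_def
  proof (intro conjI allI L(1,2) transpose_W)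
    fix u
    show "(\<integral>y. exp (\<i> * complex_of_real (u \<bullet> y)) \<partial>L) = exp (\<i> * complex_of_real (u \<bullet> 0) - complex_of_real (u \<bullet> (W_M M X *v u)) / 2)"
      unfolding char s_eq_quadratic_form[symmetric] by (simp add: exp_of_real[symmetric])
  qed
  have conv': "conv_in_distr M error' L"
  proof (rule levy_continuity_vec[OF prob_space_axioms L(1,2) error'_measurable])
    show "(\<lambda>n. \<integral>x. iexp (u \<bullet> error' n x) \<partial>M) \<longlonglongrightarrow> (\<integral>y. iexp (u \<bullet> y) \<partial>L)" for u
    proof -
      have "exp (\<i>\<^sup>2 / 2 * complex_of_real (s u)) = complex_of_real (exp (- s u / 2))" by (simp add: exp_of_real[symmetric])
      then show ?thesis unfolding char using exp_error_limit[of \<i> u] by (simp only:)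
    qed
    have comp: "axis q 1 \<bullet> y = y $ q" for q and y :: "(real, 'd scaling_index) vec" by (simp add: inner_axis')
    show "integrable M (\<lambda>x. (error' n x $ q)\<^sup>2)" for n q
    proof -
      obtain C where C: "\<And>x. \<bar>axis q 1 \<bullet> error' n x\<bar> \<le> C" using inner_error'_bounded by blast
      show ?thesis
      proof (rule integrable_const_bound[where B="C\<^sup>2"])
        have "(error' n x $ q)\<^sup>2 \<le> C\<^sup>2" for x using power_mono[OF C[of x], of 2] by (simp add: comp)
        then show "AE x in M. norm ((error' n x $ q)\<^sup>2) \<le> C\<^sup>2" by simp
        show "(\<lambda>x. (error' n x $ q)\<^sup>2) \<in> borel_measurable M"
          using borel_measurable_power[OF inner_error'_measurable[of "axis q 1" n], of 2] unfolding comp .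
      qed
    qed
    \<comment> \<open>One constant for all coordinates, strictly above each of the limits
      \<open>s (axis q 1)\<close>.\<close>
    show "eventually (\<lambda>n. (\<integral>x. (error' n x $ q)\<^sup>2 \<partial>M) \<le> (\<Sum>r\<in>UNIV. \<bar>s (axis r 1)\<bar>) + 1) sequentially" for q
    proof -
      have "\<bar>s (axis q 1)\<bar> \<le> (\<Sum>r\<in>UNIV. \<bar>s (axis r 1)\<bar>)" by (rule member_le_sum) auto
      then have "s (axis q 1) < (\<Sum>r\<in>UNIV. \<bar>s (axis r 1)\<bar>) + 1" by linarith
      from order_tendstoD(2)[OF moment_limits(2)[of "axis q 1"] this]
      show ?thesis unfolding comp by eventually_elim simp
    qed
  qed
  have lim': "(\<lambda>n. \<integral>x. g (error' n x) \<partial>M) \<longlonglongrightarrow> (\<integral>y. g y \<partial>L)"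
    if "continuous_on UNIV g \<and> bounded (range g)" for g :: "(real, 'd scaling_index) vec \<Rightarrow> real"
    using conv'[unfolded conv_in_distr_def, THEN spec, THEN mp, OF that] .
  have "conv_in_distr M error L"
    unfolding conv_in_distr_def
  proof (intro allI impI)
    fix g :: "(real, 'd scaling_index) vec \<Rightarrow> real"
    assume g: "continuous_on UNIV g \<and> bounded (range g)"
    show "(\<lambda>n. \<integral>x. g (error n x) \<partial>M) \<longlonglongrightarrow> (\<integral>y. g y \<partial>L)"
    proof (rule Lim_transform_eventually[OF lim'[OF g]])
      show "eventually (\<lambda>n. (\<integral>x. g (error' n x) \<partial>M) = (\<integral>x. g (error n x) \<partial>M)) sequentially"
        using eventually_admissible by eventually_elim (simp add: error'_def)
    qed
  qed
  with normal show ?thesis unfolding error_def[abs_def] by (intro exI conjI)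
qed

lemma est_measurable_bounded:
  assumes n: "admissible n"
  shows "integrable M (\<lambda>x. S_M_est Xs n (k n) x $ q)"
    and "\<And>x. S_M_est Xs n (k n) x $ q = axis q 1 \<bullet> error' n x / sqrt (real (k n)) + m q"
proof -
  have k0: "0 < k n" using n by (simp add: admissible_def)
  show eq: "S_M_est Xs n (k n) x $ q = axis q 1 \<bullet> error' n x / sqrt (real (k n)) + m q" for x
    using n k0 by (simp add: error'_def error_def inner_axis' S_M_component)
  obtain C where C: "\<And>x. \<bar>axis q 1 \<bullet> error' n x\<bar> \<le> C" using inner_error'_bounded by blast
  have "integrable M (\<lambda>x. axis q 1 \<bullet> error' n x)"
    by (rule integrable_const_bound[where B=C, OF _ inner_error'_measurable]) (use C in simp)
  then show "integrable M (\<lambda>x. S_M_est Xs n (k n) x $ q)" unfolding eq by simp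
qed

lemma integrable_error': "integrable M (\<lambda>x. u \<bullet> error' n x)" "integrable M (\<lambda>x. (u \<bullet> error' n x) * (v \<bullet> error' n x))"
proof -
  obtain C where C: "\<And>x. \<bar>u \<bullet> error' n x\<bar> \<le> C" using inner_error'_bounded by blast
  obtain D where D: "\<And>x. \<bar>v \<bullet> error' n x\<bar> \<le> D" using inner_error'_bounded by blast
  show "integrable M (\<lambda>x. u \<bullet> error' n x)"
    by (rule integrable_const_bound[where B=C, OF _ inner_error'_measurable]) (use C in simp)
  show "integrable M (\<lambda>x. (u \<bullet> error' n x) * (v \<bullet> error' n x))"
  proof (rule integrable_const_bound[where B="C * D", OF _ borel_measurable_times[OF inner_error'_measurable inner_error'_measurable]])
    have "0 \<le> C" using C order_trans abs_ge_zero by blast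
    show "AE x in M. norm ((u \<bullet> error' n x) * (v \<bullet> error' n x)) \<le> C * D"
    proof (intro AE_I2)
      fix x
      show "norm ((u \<bullet> error' n x) * (v \<bullet> error' n x)) \<le> C * D"
        unfolding real_norm_def abs_mult by (rule mult_mono[OF C D \<open>0 \<le> C\<close>]) simp
    qed
  qed
qed

text \<open>Polarization reduces the mixed moment to second moments in the directions of
  \<open>q\<close>, of \<open>r\<close> and of their sum, where \<open>moment_limits\<close>
  applies; the product of the means vanishes in the limit.\<close>

lemma covar_limit:
  "(\<lambda>n. real (k n) * covar M (\<lambda>x. S_M_est Xs n (k n) x $ q) (\<lambda>x. S_M_est Xs n (k n) x $ r)) \<longlonglongrightarrow> W_M M X $ q $ r"
proof -
  define e where "e q = (axis q 1 :: (real, 'd scaling_index) vec)" for q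
  define E where "E u n = (\<integral>x. u \<bullet> error' n x \<partial>M)" for u n
  define E2 where "E2 u n = (\<integral>x. (u \<bullet> error' n x)\<^sup>2 \<partial>M)" for u n
  have lim: "(\<lambda>n. (E2 (e q + e r) n - E2 (e q) n - E2 (e r) n) / 2 - E (e q) n * E (e r) n)
     \<longlonglongrightarrow> (s (e q + e r) - s (e q) - s (e r)) / 2 - 0 * 0"
    unfolding E_def E2_def by (intro tendsto_intros moment_limits) simp
  have W: "(s (e q + e r) - s (e q) - s (e r)) / 2 - 0 * 0 = W_M M X $ q $ r"
    unfolding e_def s_axis_add s_axis by simp
  have ev: "eventually (\<lambda>n. (E2 (e q + e r) n - E2 (e q) n - E2 (e r) n) / 2 - E (e q) n * E (e r) n
    = real (k n) * covar M (\<lambda>x. S_M_est Xs n (k n) x $ q) (\<lambda>x. S_M_est Xs n (k n) x $ r)) sequentially"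
    using eventually_admissible
  proof eventually_elim
    case (elim n)
    have k0: "0 < real (k n)" using elim by (simp add: admissible_def)
    define U where "U q x = e q \<bullet> error' n x" for q x
    have est: "S_M_est Xs n (k n) x $ q = U q x / sqrt (real (k n)) + m q" for q x
      unfolding U_def e_def by (rule est_measurable_bounded(2)[OF elim])
    have iU: "integrable M (U q)" "integrable M (\<lambda>x. U q x * U r x)" for q r unfolding U_def by (rule integrable_error')+
    have EU: "(\<integral>x. U q x \<partial>M) = E (e q) n" for q by (simp add: U_def E_def)
    have mean: "(\<integral>x. S_M_est Xs n (k n) x $ q \<partial>M) = E (e q) n / sqrt (real (k n)) + m q" for q
      unfolding est using iU(1)[of q] by (simp add: EU prob_space)
    have cent: "S_M_est Xs n (k n) x $ q - (\<integral>y. S_M_est Xs n (k n) y $ q \<partial>M) = (U q x - E (e q) n) / sqrt (real (k n))" for q x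
      unfolding mean unfolding est by (simp add: diff_divide_distrib)
    have "real (k n) * covar M (\<lambda>x. S_M_est Xs n (k n) x $ q) (\<lambda>x. S_M_est Xs n (k n) x $ r)
       = real (k n) * (\<integral>x. (1 / real (k n)) * ((U q x - E (e q) n) * (U r x - E (e r) n)) \<partial>M)"
      unfolding covar_def cent times_divide_times_eq real_sqrt_mult_self using k0 by simp
    also have "\<dots> = (\<integral>x. (U q x - E (e q) n) * (U r x - E (e r) n) \<partial>M)" unfolding integral_mult_right_zero using k0 by simp
    also have "\<dots> = (\<integral>x. U q x * U r x - E (e q) n * U r x - E (e r) n * U q x + E (e q) n * E (e r) n \<partial>M)"
      by (simp add: algebra_simps)
    also have "\<dots> = (\<integral>x. U q x * U r x \<partial>M) - E (e q) n * E (e r) n"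
      using iU by (simp add: EU prob_space)
    also have "(\<integral>x. U q x * U r x \<partial>M) = (E2 (e q + e r) n - E2 (e q) n - E2 (e r) n) / 2"
    proof -
      have "E2 (e q + e r) n = (\<integral>x. U q x * U q x + U r x * U r x + 2 * (U q x * U r x) \<partial>M)"
        unfolding E2_def U_def by (simp add: inner_add_left power2_eq_square algebra_simps)
      also have "\<dots> = (\<integral>x. U q x * U q x \<partial>M) + (\<integral>x. U r x * U r x \<partial>M) + 2 * (\<integral>x. U q x * U r x \<partial>M)"
        using iU by simp
      finally show ?thesis by (simp add: E2_def U_def power2_eq_square)
    qed
    finally show ?case by simp
  qed
  from Lim_transform_eventually[OF lim ev] show ?thesis unfolding W .
qed

lemma variance_limit:
  "(\<lambda>n. real (k n) * variance (\<lambda>x. S_M_est Xs n (k n) x $ q)) \<longlonglongrightarrow> W_M M X $ q $ q"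
  using covar_limit[of q q] by (simp add: covar_def power2_eq_square)

lemma sum_singletons:
  fixes w :: "(real, 'd) vec"
  assumes w: "norm w = 1"
  shows "(\<Sum>q\<in>UNIV. (if \<exists>i. index_set q = {i} then 1 else 0) * max_sq (index_set q) w) = (1 :: real)"
proof -
  have sing: "{i} \<in> (scaling_sets :: 'd set set)" for i by (auto simp: scaling_sets_def)
  define A where "A i = Abs_scaling_index {i}" for i :: 'd
  have A: "index_set (A i) = {i}" for i unfolding A_def by (rule Abs_scaling_index_inverse[OF sing])
  have inj: "inj A" by (rule injI) (metis A singleton_inject)
  have "(\<Sum>q\<in>UNIV. (if \<exists>i. index_set q = {i} then 1 else 0) * max_sq (index_set q) w) = (\<Sum>q\<in>range A. max_sq (index_set q) w)"
  proof (rule sum.mono_neutral_cong_right)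
    show "\<forall>q\<in>UNIV - range A. (if \<exists>i. index_set q = {i} then 1 else 0) * max_sq (index_set q) w = 0"
    proof
      fix q assume q: "q \<in> UNIV - range A"
      have "\<nexists>i. index_set q = {i}"
      proof
        assume "\<exists>i. index_set q = {i}"
        then obtain i where "index_set q = index_set (A i)" using A by auto
        then have "q = A i" by (simp add: index_set_inject)
        then show False using q by auto
      qed
      then show "(if \<exists>i. index_set q = {i} then 1 else 0) * max_sq (index_set q) w = 0" by simp
    qed
  qed (auto simp: A)
  also have "\<dots> = (\<Sum>i\<in>UNIV. max_sq {i} w)" using inj by (simp add: sum.reindex A)
  also have "\<dots> = (\<Sum>i\<in>UNIV. (w $ i)\<^sup>2)" by (simp add: max_sq_def)
  also have "\<dots> = (norm w)\<^sup>2" by (simp add: norm_vec_def L2_set_def sum_nonneg)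
  finally show ?thesis using w by simp
qed

theorem W_singular: "\<not> invertible (W_M M X)"
proof
  assume "invertible (W_M M X)"
  then obtain V where V: "V ** W_M M X = mat 1" by (auto simp: invertible_def)
  define u where "u = ((\<chi> q. if \<exists>i. index_set q = {i} then 1 else 0) :: (real, 'd scaling_index) vec)"
  have F1: "(\<Sum>q\<in>UNIV. u $ q * F q (\<alpha> j)) = real CARD('d)" for j
  proof -
    have "(\<Sum>q\<in>UNIV. u $ q * F q (\<alpha> j)) = real CARD('d) * (\<Sum>q\<in>UNIV. (if \<exists>i. index_set q = {i} then 1 else 0) * max_sq (index_set q) (\<alpha> j))"
      by (simp add: u_def F_def sum_distrib_left mult.left_commute)
    also have "\<dots> = real CARD('d)" using \<alpha>[of j] by (subst sum_singletons) (auto simp: pos_sphere_def)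
    finally show ?thesis .
  qed
  have m1: "(\<Sum>q\<in>UNIV. u $ q * m q) = real CARD('d)"
  proof -
    have "(\<Sum>q\<in>UNIV. u $ q * m q) = Ex (\<lambda>w. \<Sum>q\<in>UNIV. u $ q * F q w)" unfolding Ex_sum Ex_cmult m_def ..
    also have "\<dots> = real CARD('d)" unfolding Ex_def F1 using sum_p by (simp add: sum_distrib_right[symmetric])
    finally show ?thesis .
  qed
  \<comment> \<open>The combination of the \<open>F q\<close> with weights \<open>u\<close> is
    constant on the sphere, hence equal to its mean at every atom. Each entry of the image of
    \<open>u\<close> is an expectation with this vanishing score as a factor.\<close>
  have f0: "f u (\<alpha> j) = 0" for j
    by (simp add: f_def right_diff_distrib sum_subtractf F1 m1)
  have "(W_M M X *v u) $ q = 0" for q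
  proof -
    have "(W_M M X *v u) $ q = (\<Sum>r\<in>UNIV. u $ r * cov q r)"
      by (simp add: matrix_vector_mult_def W_M_entry mult.commute)
    also have "\<dots> = Ex (\<lambda>w. \<Sum>r\<in>UNIV. u $ r * ((F q w - m q) * (F r w - m r)))"
      unfolding Ex_sum Ex_cmult cov_def ..
    also have "\<dots> = Ex (\<lambda>w. (F q w - m q) * f u w)"
      by (simp add: f_def sum_distrib_left mult.left_commute)
    also have "\<dots> = 0" by (simp add: Ex_def f0)
    finally show ?thesis .
  qed
  then have "W_M M X *v u = 0" by (simp add: vec_eq_iff)
  then have "u = 0" using V by (metis matrix_vector_mul_assoc matrix_vector_mul_lid matrix_vector_mult_0_right)
  moreover obtain i :: 'd where True by simp
  moreover have "index_set (Abs_scaling_index {i}) = {i}" by (rule Abs_scaling_index_inverse) (auto simp: scaling_sets_def)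
  then have "u $ Abs_scaling_index {i} = 1" by (auto simp: u_def)
  ultimately show False by simp
qed

end

section \<open>Application to recursive max-linear vectors\<close>

lemma (in prob_space) indep_vars_pair_exceed:
  assumes indep: "indep_vars (\<lambda>_. borel) V UNIV" and ij: "i \<noteq> j"
  shows "prob {x \<in> space M. t < V i x \<and> t < V j x} = prob {x \<in> space M. t < V i x} * prob {x \<in> space M. t < (V j x :: real)}"
proof -
  have "prob (\<Inter>l\<in>{i, j}. V l -` {t<..} \<inter> space M) = (\<Prod>l\<in>{i, j}. prob (V l -` {t<..} \<inter> space M))"
    by (rule indep_varsD[OF indep]) auto
  moreover have "(\<Inter>l\<in>{i, j}. V l -` {t<..} \<inter> space M) = {x \<in> space M. t < V i x \<and> t < V j x}" by auto
  moreover have "V l -` {t<..} \<inter> space M = {x \<in> space M. t < V l x}" for l by auto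
  ultimately show ?thesis using ij by simp
qed

theorem theorem5:
  fixes M :: "'a measure"
    and E :: "('d::{finite,linorder} \<times> 'd) set"
    and c :: "'d \<Rightarrow> 'd \<Rightarrow> real"
    and Z X :: "'a \<Rightarrow> real ^ 'd::{finite,linorder}"
    and Xs :: "nat \<Rightarrow> 'a \<Rightarrow> real ^ 'd::{finite,linorder}"
    and k :: "nat \<Rightarrow> nat"
  assumes "prob_space M"
    and rec: "recursive_ml M E c Z X"
    and A1: "standardized_innovations M Z"
    and A3: "standardized_matrix (ml_coeff E c)"
    and iid: "iid_copies M X Xs"
    and k_small: "(\<lambda>n. real (k n) / real n) \<longlonglongrightarrow> 0"
    and k_large: "filterlim k at_top sequentially"
    and var_pos: "\<forall>h \<in> scaling_sets.
      prob_space.variance (norm_spectral_measure M X) (\<lambda>w. real CARD('d) * max_sq h w) > 0"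
    and bias: "\<forall>h \<in> scaling_sets. \<forall>T.
      uniform_limit {0..T}
        (\<lambda>n t. tail_bias M (Xs 1) (norm_spectral_measure M X)
                 (\<lambda>w. real CARD('d) * max_sq h w) n (k n) t)
        (\<lambda>t. 0) sequentially"
  shows "(\<exists>N. is_normal N 0 (W_M M X) \<and>
            conv_in_distr M (\<lambda>n x. sqrt (real (k n)) *\<^sub>R (S_M_est Xs n (k n) x - S_M M X)) N)
       \<and> (\<forall>p. (\<lambda>n. real (k n) * prob_space.variance M (\<lambda>x. S_M_est Xs n (k n) x $ p))
                \<longlonglongrightarrow> W_M M X $ p $ p)
       \<and> (\<forall>p q. p \<noteq> q \<longrightarrow>
            (\<lambda>n. real (k n) * covar M (\<lambda>x. S_M_est Xs n (k n) x $ p) (\<lambda>x. S_M_est Xs n (k n) x $ q))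
                \<longlonglongrightarrow> W_M M X $ p $ q)
       \<and> \<not> invertible (W_M M X)"
proof -
  interpret prob_space M by fact
  define A where "A = ml_coeff E c"
  note rec' = rec[unfolded recursive_ml_def]
  have ac: "acyclic E" by (rule rec'[THEN conjunct1])
  have cpos: "\<And>i k. k \<in> pa E i \<union> {i} \<Longrightarrow> 0 < c i k"
    by (rule rec'[THEN conjunct2, THEN conjunct1, rule_format])
  have inn: "innovations M Z" by (rule rec'[THEN conjunct2, THEN conjunct2, THEN conjunct1])
  have recX: "\<And>x i. x \<in> space M \<Longrightarrow> X x $ i = Max (insert (c i i * Z x $ i) ((\<lambda>k. c i k * X x $ k) ` pa E i))"
    by (rule rec'[THEN conjunct2, THEN conjunct2, THEN conjunct2, rule_format])
  have indep: "indep_vars (\<lambda>_. borel) (\<lambda>i x. Z x $ i) UNIV"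
    by (rule inn[unfolded innovations_def, THEN conjunct1])
  have Z_atomless: "\<And>i z. prob {x \<in> space M. Z x $ i = z} = 0"
    by (rule inn[unfolded innovations_def, THEN conjunct2, THEN conjunct1, rule_format])
  have Zm: "(\<lambda>x. Z x $ i) \<in> borel_measurable M" for i using indep unfolding indep_vars_def by auto
  have A0: "0 \<le> A $ i $ j" for i j
    unfolding A_def by (rule ml_coeff_nonneg[OF ac cpos])
  have diag: "0 < A $ i $ i" for i
    unfolding A_def by (rule ml_coeff_diag_pos[OF ac cpos])
  have RV2Z: "RV2 M Z" by (rule A1[unfolded standardized_innovations_def, THEN conjunct1])
  have std1: "(\<lambda>n. real n * measure M {x \<in> space M. Z x $ i / sqrt (real n) > 1}) \<longlonglongrightarrow> 1 / 1\<^sup>2" for i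
    by (rule A1[unfolded standardized_innovations_def, THEN conjunct2, THEN spec, THEN spec, THEN mp, OF zero_less_one])
  obtain HZ where "spectral_measure_of M Z HZ" using RV2Z unfolding RV2_def by blast
  moreover have "Z \<in> borel_measurable M" "AE x in M. \<forall>i. 0 \<le> Z x $ i" using RV2Z unfolding RV2_def by blast+
  ultimately interpret Z: regular_variation M Z HZ by unfold_locales
  have std: "(\<lambda>n. real n * prob {x \<in> space M. sqrt (real n) < Z x $ i}) \<longlonglongrightarrow> 1" for i
  proof -
    have "eventually (\<lambda>n. real n * measure M {x \<in> space M. Z x $ i / sqrt (real n) > 1} = real n * prob {x \<in> space M. sqrt (real n) < Z x $ i}) sequentially"
      using eventually_gt_at_top[of 0] by eventually_elim (simp add: less_divide_eq)
    from Lim_transform_eventually[OF std1 this] show ?thesis by simp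
  qed
  have HZ: "(\<integral>w. \<phi> w \<partial>HZ) = (\<Sum>i\<in>UNIV. \<phi> (axis i 1))" if "\<phi> \<in> borel_measurable borel" for \<phi> :: "(real, 'd) vec \<Rightarrow> real"
    by (rule Z.integral_spectral_indep[OF std indep_vars_pair_exceed[OF indep] that])
  \<comment> \<open>Measurability of \<open>X\<close> is inherited from the innovations along the
    edges.\<close>
  have Xm: "X \<in> borel_measurable M"
    by (rule ml_recursion_measurable[OF ac cpos recX Zm])
  \<comment> \<open>Only almost surely: the solution formula is for nonnegative innovations, and
    \<open>RV2\<close> makes them nonnegative almost everywhere.\<close>
  have XZ: "AE x in M. X x = max_linear A (Z x)"
    using Z.nonneg AE_space
  proof eventually_elim
    case (elim x)
    show ?case unfolding A_def by (rule ml_recursion_solution[OF ac cpos recX[OF elim(2)] elim(1)[rule_format]])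
  qed
  have RVX: "regular_variation M X (max_linear_spectral A)"
    by (rule regular_variation_max_linear[OF A0 diag Z.regular_variation_axioms HZ Xm XZ])
  have row: "(\<Sum>j\<in>UNIV. (A $ i $ j)\<^sup>2) = 1" for i
    using A3 unfolding standardized_matrix_def A_def by simp
  have norm_col: "(norm (column j A))\<^sup>2 = (\<Sum>i\<in>UNIV. (A $ i $ j)\<^sup>2)" for j
    by (simp add: norm_vec_def L2_set_def column_def sum_nonneg)
  \<comment> \<open>Summing the squared entries by rows instead of columns: the d rows have norm 1.
    Hence the total spectral mass is d, and the weights handed to the locale sum to 1.\<close>
  have total: "(\<Sum>j\<in>UNIV. (norm (column j A))\<^sup>2) = real CARD('d)"
    unfolding norm_col by (subst sum.swap) (simp add: row)
  interpret S: scaling_estimation M X Xs k "max_linear_spectral A" "\<lambda>j. (norm (column j A))\<^sup>2 / real CARD('d)" "\<lambda>j. angle (column j A)"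
  proof (intro scaling_estimation.intro scaling_estimation_axioms.intro prob_space_axioms)
    show "regular_variation M X (max_linear_spectral A)" by (rule RVX)
    show "(\<integral>w. \<phi> w \<partial>max_linear_spectral A) = real CARD('d) * (\<Sum>j\<in>UNIV. (norm (column j A))\<^sup>2 / real CARD('d) * \<phi> (angle (column j A)))"
      if "\<phi> \<in> borel_measurable borel" for \<phi> :: "(real, 'd) vec \<Rightarrow> real"
      unfolding integral_max_linear_spectral[OF that] by (simp add: sum_distrib_left)
    show "(\<Sum>j\<in>UNIV. (norm (column j A))\<^sup>2 / real CARD('d)) = 1"
      unfolding sum_divide_distrib[symmetric] total by simp
    show "angle (column j A) \<in> pos_sphere" for j by (rule angle_column[OF A0 diag])
    show "prob {x \<in> space M. norm (X x) = t} = 0" for t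
      by (rule atomless_norm_max_linear[OF A0 diag indep Z_atomless Z.nonneg Xm XZ])
    show "uniform_limit {0..T} (\<lambda>n t. tail_bias M (Xs 1) (norm_spectral_measure M X) (\<lambda>w. real CARD('d) * max_sq (index_set q) w) n (k n) t) (\<lambda>t. 0) sequentially"
      for q :: "'d scaling_index" and T
      by (rule bias[THEN bspec, OF index_set, THEN spec])
  qed (use iid k_small k_large in auto)
  show ?thesis
    by (intro conjI allI impI S.asymptotic_normality S.variance_limit S.covar_limit S.W_singular)
qed

end
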